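(* Let $dM_0\in\mathbb{A}_{\mathbb{M}}$ and $\omega\in\Sigma(dM_0)$ with $\alpha=\mathrm{Re}\,\omega>0$. Assume that $\omega$ is a weakly* $dM_0$-local boundary point of $\Sigma[\mathbb{A}_{\mathbb{M}}]$ (in particular, this holds if $\omega$ and $dM_0$ are of minimal decay for $\alpha$ over $\mathbb{A}_{\mathbb{M}}$). Then $dM_0=\sum_{j=1}^nm_j\,\delta(x-a_j)\,dx$ with $n\in\mathbb{N}$, $m_j>0$, and distinct increasingly ordered $a_j\in[0,\ell]$. Moreover, with $\Phi(x):=\varphi(x,\omega;dM_0)$ and $a_*:=\min\operatorname{supp}dM_0=a_1$, the following hold. (i) There exist a line $L\subset\mathbb{C}$ passing through $z_0:=m^{-1}\int_{[0,\ell]}\Phi^2(x)\,dM_0(x)$ and a unit normal $p$ to $L$ such that: (i.a) The trajectory $\{\Phi(x):x\in[0,\ell]\}$ is a piecewise linear path lying in $\{\zeta\in\mathbb{C}:\langle\zeta^2-1,p\rangle_{\mathbb{C}}\le0\}$ and consisting of the closed line-segments $[\Phi(a_j),\Phi(a_{j+1})]$, $j=1,\dots,n$, where $a_{n+1}:=\ell$. (i.b) If $a_n<\ell$, then $\{a_j\}_{j=1}^n=\{x\in[a_*,\ell):\Phi^2(x)\in L\}$. If $a_n=\ell$, then $\{a_j\}_{j=1}^n=\{x\in[a_*,\ell]:\Phi^2(x)\in L\}$. (In both cases $1=\Phi(a_1)\in L$, and so $L=1+ip\mathbb{R}$.) (ii) When $n\ge2$, the line $L$ and the unit normal $p$ are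 uniquely determined by (i.a)-(i.b), and: (ii.a) $a_1=0$. (ii.b) Let the real numbers $s_j$ ($j=1,\dots,n$) be defined by $\Phi^2(a_j)=1+ip\,s_j$. Then $0=s_1>s_2>\dots>s_n$. (ii.c) When $j\ge2$ and $a_j<\ell$, $$m_j=\frac{\langle\partial_x^-\Phi^2(a_j),\,p\rangle_{\mathbb{C}}}{\langle\omega^2\Phi^2(a_j),\,p\rangle_{\mathbb{C}}}=-\frac{\langle\partial_x^+\Phi^2(a_j),\,p\rangle_{\mathbb{C}}}{\langle\omega^2\Phi^2(a_j),\,p\rangle_{\mathbb{C}}}.$$ (ii.d) When $a_n=\ell$, $\displaystyle m_n=\frac{\partial_x^-\Phi(a_n)}{\omega^2\Phi(a_n)}-\frac{i}{\omega}$. (iii) If $\|dM_0\|<m$, then $L=\mathbb{R}$, $n\le2$, and $a_1=0$.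
   Context: Fix $\ell>0$ and $m>0$. $\mathbb{M}_{\mathbb{C}}$ is the Banach space of complex Borel measures on $[0,\ell]$ with the total variation norm $\|\cdot\|$ (the dual of $C[0,\ell]$, which gives its weak* topology); $\delta(x-a)\,dx$ is the unit point mass at $a$. For $z\in\mathbb{C}$, $dM\in\mathbb{M}_{\mathbb{C}}$, $\varphi(\cdot)=\varphi(\cdot,z;dM)$ is the unique continuous solution on $[0,\ell]$ of $\varphi(x)=1-z^2\int_{[0,x]}(x-s)\varphi(s)\,dM(s)$; its one-sided derivatives (with $dM$ extended by the zero measure outside $[0,\ell]$) are $\partial_x^-\varphi(x)=-z^2\int_{[0,x)}\varphi\,dM$ and $\partial_x^+\varphi(x)=-z^2\int_{[0,x]}\varphi\,dM$. Put $F(z;dM):=\varphi(\ell)-iz\int_{[0,\ell]}\varphi\,dM$. The set of quasi-eigenvalues $\Sigma(dM)$ is the set of zeroes of $F(\cdot;dM)$. $\mathbb{A}_{\mathbb{M}}$ is the set of nonnegative Borel measures on $[0,\ell]$ with total mass $\le m$. For $S\subset\mathbb{M}_{\mathbb{C}}$, $\Sigma[S]:=\bigcup_{dM\in S}\Sigma(dM)$. For $dM\in\mathbb{A}_{\mathbb{M}}$ and $\omega\in\Sigma(dM)$, $\omega$ is a weakly* $dM$-local boundary point of $\Sigma[\mathbb{A}_{\mathbb{M}}]$ if $\omega$ is a boundary point of $\Sigma[\mathbb{A}_{\mathbb{M}}\cap W]$ for a certain weak*-open neighborhood $W$ of $dM$ in $\mathbb{M}_{\mathbb{C}}$. For $\alpha\in\mathbb{R}$,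 $\beta_{\min}(\alpha):=\inf\{\beta\in\mathbb{R}:\alpha-i\beta\in\Sigma[\mathbb{A}_{\mathbb{M}}]\}$; if $\omega=\alpha-i\beta_{\min}(\alpha)\in\Sigma(dM)$ with $dM\in\mathbb{A}_{\mathbb{M}}$, then $\omega$ and $dM$ are of minimal decay for $\alpha$ over $\mathbb{A}_{\mathbb{M}}$. $\langle z_1,z_2\rangle_{\mathbb{C}}:=\mathrm{Re}\,z_1\,\mathrm{Re}\,z_2+\mathrm{Im}\,z_1\,\mathrm{Im}\,z_2$; $\mathbb{C}$ is viewed as $\mathbb{R}^2$ and a unit normal to a line is a complex number $p$ with $|p|=1$ orthogonal to the line. $\Phi^2(x)=(\Phi(x))^2$. $[z_1,z_2]$ is the closed line-segment between $z_1$ and $z_2$ (possibly degenerate). *)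

theory Defs
  imports "HOL-Analysis.Analysis"
begin

text \<open>
  A complex Borel measure on \<open>[0,l]\<close> is represented by its set function on the Borel subsets of
  \<open>[0,l]\<close>, extended by \<open>0\<close> to all other sets so that equality of measures is equality of functions.
\<close>

definition borel_subsets :: "real \<Rightarrow> real set set" where
  "borel_subsets l = {A \<in> sets borel. A \<subseteq> {0..l}}"

definition complex_measures :: "real \<Rightarrow> (real set \<Rightarrow> complex) set" where
  "complex_measures l = {\<mu>.
     (\<forall>A. A \<notin> borel_subsets l \<longrightarrow> \<mu> A = 0) \<and>
     (\<forall>A :: nat \<Rightarrow> real set. range A \<subseteq> borel_subsets l \<and> disjoint_family A \<longrightarrow>
        (\<lambda>i. \<mu> (A i)) sums \<mu> (\<Union>i. A i))}"

definition point_mass :: "real \<Rightarrow> real \<Rightarrow> real set \<Rightarrow> complex" where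
  "point_mass l a A = (if A \<in> borel_subsets l \<and> a \<in> A then 1 else 0)"

text \<open>The supremum is finite for every complex measure.\<close>

definition total_variation :: "real \<Rightarrow> (real set \<Rightarrow> complex) \<Rightarrow> real" where
  "total_variation l \<mu> =
     (SUP P \<in> {P. finite P \<and> disjoint P \<and> P \<subseteq> borel_subsets l}. \<Sum>A\<in>P. norm (\<mu> A))"

text \<open>
  The upper variation of a signed measure, i.e. the positive part of its Jordan decomposition, as a
  library measure (\<open>ennreal\<close> sends negative reals to \<open>0\<close>).  The lower variation of \<open>\<nu>\<close> is the
  upper variation of \<open>- \<nu>\<close>.
\<close>

definition upper_variation :: "real \<Rightarrow> (real set \<Rightarrow> real) \<Rightarrow> real measure" where
  "upper_variation l \<nu> = measure_of {0..l} (borel_subsets l)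
     (\<lambda>A. SUP B \<in> {B \<in> borel_subsets l. B \<subseteq> A}. ennreal (\<nu> B))"

definition signed_integral :: "real \<Rightarrow> (real set \<Rightarrow> real) \<Rightarrow> (real \<Rightarrow> complex) \<Rightarrow> complex" where
  "signed_integral l \<nu> f =
     integral\<^sup>L (upper_variation l \<nu>) f - integral\<^sup>L (upper_variation l (\<lambda>A. - \<nu> A)) f"

definition cm_integral :: "real \<Rightarrow> (real set \<Rightarrow> complex) \<Rightarrow> (real \<Rightarrow> complex) \<Rightarrow> complex" where
  "cm_integral l \<mu> f =
     signed_integral l (\<lambda>A. Re (\<mu> A)) f + \<i> * signed_integral l (\<lambda>A. Im (\<mu> A)) f"

definition measure_support :: "real \<Rightarrow> (real set \<Rightarrow> complex) \<Rightarrow> real set" where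
  "measure_support l \<mu> = {x \<in> {0..l}. \<forall>U. open U \<and> x \<in> U \<longrightarrow>
     (\<exists>B \<in> borel_subsets l. B \<subseteq> U \<and> \<mu> B \<noteq> 0)}"

text \<open>The coarsest topology making all functionals \<open>\<mu> \<mapsto> \<integral> f d\<mu>\<close> with \<open>f \<in> C[0,l]\<close> continuous.\<close>

definition weak_star_topology :: "real \<Rightarrow> (real set \<Rightarrow> complex) topology" where
  "weak_star_topology l = topology_generated_by
     {{\<mu> \<in> complex_measures l. cm_integral l \<mu> f \<in> U} | f U. continuous_on {0..l} f \<and> open U}"

text \<open>
  The continuous solution on \<open>[0,l]\<close> is unique; membership in \<open>extensional\<close> merely fixes its
  irrelevant values outside \<open>[0,l]\<close>.
\<close>

definition string_phi :: "real \<Rightarrow> complex \<Rightarrow> (real set \<Rightarrow> complex) \<Rightarrow> real \<Rightarrow> complex" where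
  "string_phi l z \<mu> = (THE f. f \<in> extensional {0..l} \<and> continuous_on {0..l} f \<and>
     (\<forall>x \<in> {0..l}. f x =
        1 - z\<^sup>2 * cm_integral l \<mu> (\<lambda>s. indicator {0..x} s * complex_of_real (x - s) * f s)))"

definition string_F :: "real \<Rightarrow> complex \<Rightarrow> (real set \<Rightarrow> complex) \<Rightarrow> complex" where
  "string_F l z \<mu> =
     string_phi l z \<mu> l - \<i> * z * cm_integral l \<mu> (string_phi l z \<mu>)"

definition quasi_eigenvalues :: "real \<Rightarrow> (real set \<Rightarrow> complex) \<Rightarrow> complex set" where
  "quasi_eigenvalues l \<mu> = {z. string_F l z \<mu> = 0}"

definition quasi_eigenvalues_of :: "real \<Rightarrow> (real set \<Rightarrow> complex) set \<Rightarrow> complex set" where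
  "quasi_eigenvalues_of l S = (\<Union>\<mu>\<in>S. quasi_eigenvalues l \<mu>)"

definition admissible :: "real \<Rightarrow> real \<Rightarrow> (real set \<Rightarrow> complex) set" where
  "admissible l m = {\<mu> \<in> complex_measures l.
     (\<forall>A \<in> borel_subsets l. \<mu> A \<in> \<real> \<and> 0 \<le> Re (\<mu> A)) \<and> Re (\<mu> {0..l}) \<le> m}"

definition weak_star_local_boundary_point ::
    "real \<Rightarrow> real \<Rightarrow> (real set \<Rightarrow> complex) \<Rightarrow> complex \<Rightarrow> bool" where
  "weak_star_local_boundary_point l m \<mu> \<omega> \<longleftrightarrow>
     \<mu> \<in> admissible l m \<and> \<omega> \<in> quasi_eigenvalues l \<mu> \<and>
     (\<exists>W. openin (weak_star_topology l) W \<and> \<mu> \<in> W \<and>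
          \<omega> \<in> frontier (quasi_eigenvalues_of l (admissible l m \<inter> W)))"

definition beta_min :: "real \<Rightarrow> real \<Rightarrow> real \<Rightarrow> ereal" where
  "beta_min l m \<alpha> =
     (INF \<beta> \<in> {\<beta>. complex_of_real \<alpha> - \<i> * complex_of_real \<beta>
                    \<in> quasi_eigenvalues_of l (admissible l m)}. ereal \<beta>)"

definition minimal_decay ::
    "real \<Rightarrow> real \<Rightarrow> real \<Rightarrow> complex \<Rightarrow> (real set \<Rightarrow> complex) \<Rightarrow> bool" where
  "minimal_decay l m \<alpha> \<omega> \<mu> \<longleftrightarrow>
     \<mu> \<in> admissible l m \<and> \<omega> \<in> quasi_eigenvalues l \<mu> \<and>
     (\<exists>\<beta>. \<omega> = complex_of_real \<alpha> - \<i> * complex_of_real \<beta> \<and> ereal \<beta> = beta_min l m \<alpha>)"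

text \<open>
  On \<open>complex\<close>, the library inner product \<open>z \<bullet> w\<close> is \<open>Re z * Re w + Im z * Im w\<close>.
\<close>

definition line_with_unit_normal :: "complex set \<Rightarrow> complex \<Rightarrow> bool" where
  "line_with_unit_normal L p \<longleftrightarrow> affine L \<and> aff_dim L = 1 \<and>
     norm p = 1 \<and> (\<forall>u\<in>L. \<forall>v\<in>L. orthogonal (u - v) p)"

definition affine_map_on :: "real set \<Rightarrow> (real \<Rightarrow> complex) \<Rightarrow> bool" where
  "affine_map_on S f \<longleftrightarrow> (\<exists>c d. \<forall>x\<in>S. f x = c + of_real x * d)"

text \<open>
  In the next two conditions the breakpoints are \<open>a 1 < \<dots> < a n\<close>, and \<open>a (n + 1) = l\<close>
  (so the last segment is degenerate if \<open>a n = l\<close>).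
\<close>

definition trajectory_condition ::
    "real \<Rightarrow> (real \<Rightarrow> complex) \<Rightarrow> nat \<Rightarrow> (nat \<Rightarrow> real) \<Rightarrow> complex \<Rightarrow> bool" where
  "trajectory_condition l \<Phi> n a p \<longleftrightarrow>
     affine_map_on {0..a 1} \<Phi> \<and> (\<forall>j\<in>{1..n}. affine_map_on {a j..a (j + 1)} \<Phi>) \<and>
     \<Phi> ` {0..l} \<subseteq> {\<zeta>. (\<zeta>\<^sup>2 - 1) \<bullet> p \<le> 0} \<and>
     \<Phi> ` {0..l} = (\<Union>j\<in>{1..n}. closed_segment (\<Phi> (a j)) (\<Phi> (a (j + 1))))"

definition mass_position_condition ::
    "real \<Rightarrow> (real \<Rightarrow> complex) \<Rightarrow> nat \<Rightarrow> (nat \<Rightarrow> real) \<Rightarrow> complex set \<Rightarrow> bool" where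
  "mass_position_condition l \<Phi> n a L \<longleftrightarrow>
     (a n < l \<longrightarrow> a ` {1..n} = {x \<in> {a 1..<l}. (\<Phi> x)\<^sup>2 \<in> L}) \<and>
     (a n = l \<longrightarrow> a ` {1..n} = {x \<in> {a 1..l}. (\<Phi> x)\<^sup>2 \<in> L})"

abbreviation left_deriv :: "(real \<Rightarrow> complex) \<Rightarrow> real \<Rightarrow> complex" where
  "left_deriv f x \<equiv> vector_derivative f (at_left x)"

abbreviation right_deriv :: "(real \<Rightarrow> complex) \<Rightarrow> real \<Rightarrow> complex" where
  "right_deriv f x \<equiv> vector_derivative f (at_right x)"

end

theory Submission
  imports Defs
begin

text \<open>
  Why the theorem holds.  Fix \<open>\<omega>\<close> and let the measure vary.  If \<open>\<phi>\<close> and \<open>\<psi>\<close> are the solutions for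
  \<open>dM\<^sub>0\<close> and \<open>dM\<close>, Green's identity (\<open>string_F_difference\<close>) gives
  \<open>F(\<omega>; dM) \<phi>(l) = - \<i> \<omega> \<integral> \<phi> \<psi> (dM - dM\<^sub>0)\<close>, so the derivative of \<open>F(\<omega>; \<cdot>)\<close> in a direction \<open>dV\<close> is
  a nonzero multiple of \<open>\<integral> \<phi>\<^sup>2 dV\<close>.  Suppose these numbers, taken over the admissible directions,
  fill a neighbourhood of \<open>0\<close>.  Then, for each \<open>z\<close> near \<open>\<omega>\<close>, the equation \<open>F(z; dM) = 0\<close> can be
  solved for an admissible \<open>dM\<close> near \<open>dM\<^sub>0\<close> by Brouwer's fixed point theorem
  (\<open>perturbation_interior\<close>), and \<open>\<omega>\<close> is an interior point.  Solving for the measure rather than for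
  the eigenvalue makes the multiplicity of the zero \<open>\<omega>\<close> irrelevant.  Hence at a boundary point there
  is a unit vector \<open>p\<close> with \<open>\<langle>\<integral> \<phi>\<^sup>2 dM, p\<rangle> \<le> \<langle>\<integral> \<phi>\<^sup>2 dM\<^sub>0, p\<rangle>\<close> for all admissible \<open>dM\<close>
  (\<open>first_order_condition_fixed\<close>).  Testing with point masses and with the zero measure shows that
  \<open>g = \<langle>\<phi>\<^sup>2, p\<rangle> - c\<close> is nonpositive, that \<open>dM\<^sub>0\<close> lives on the contact set \<open>{g = 0}\<close>, that
  \<open>c = Re p \<ge> 0\<close>, and that \<open>c = 0\<close> if the total mass is less than \<open>m\<close> (\<open>extremal_lib\<close>).

  The rest is plane geometry.  The angular momentum \<open>Im (cnj \<phi> \<phi>')\<close> is a positive multiple of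
  \<open>\<integral>\<^bsub>[0,x]\<^esub> |\<phi>|\<^sup>2 dM\<^sub>0\<close>, so that \<open>\<phi>\<close> never vanishes and turns counterclockwise once it has met mass.
  The contact set corresponds to the points of the hyperbola \<open>Re (\<zeta>\<^sup>2 cnj p) = c\<close>, and \<open>g \<le> 0\<close> is the
  region between its branches.  In a gap of the contact set \<open>\<phi>\<close> is linear, and a chord between two
  points of one branch leaves that region; so a gap always leads to the other branch, a rotation by
  at least a right angle (\<open>chord\<close>).  Contact points that are close to each other therefore bound an
  interval of contact points (\<open>close_points_fill\<close>).  Such an arc is impossible: along it
  \<open>\<phi>\<^sup>2\<close> moves in the direction in which \<open>\<langle>\<omega>\<^sup>2 \<phi>\<^sup>2, p\<rangle>\<close> increases, this quantity is nonnegative at the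
  left end of a maximal arc, and once it is positive a second-order expansion makes \<open>g\<close> negative
  (\<open>no_arc\<close>).  So the contact set is finite to the right of the first mass, \<open>dM\<^sub>0\<close> is a finite sum of
  point masses, and the order of the numbers \<open>s\<^sub>j\<close> records that each gap changes the branch.

  Moving one interior mass to the left and to the right adds two opposite directions to the
  admissible ones (\<open>first_order_condition_shift\<close>).  For the mass \<open>m\<^sub>j\<close> at \<open>a\<^sub>j\<close> they are multiples of
  \<open>\<phi>(a\<^sub>j) (\<phi>'(a\<^sub>j -) + \<phi>'(a\<^sub>j +))\<close>, which must be orthogonal to \<open>p\<close>; this gives the formulas for the
  masses, and it excludes \<open>a\<^sub>1 > 0\<close> if there are two masses or if the total mass is less than \<open>m\<close>.
\<close>

section \<open>Nonnegative complex measures as library measures\<close>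

definition nonneg_measures :: "real \<Rightarrow> (real set \<Rightarrow> complex) set" where
  "nonneg_measures l = {\<mu> \<in> complex_measures l. \<forall>A \<in> borel_subsets l. \<mu> A \<in> \<real> \<and> 0 \<le> Re (\<mu> A)}"

definition lib_measure :: "real \<Rightarrow> (real set \<Rightarrow> complex) \<Rightarrow> real measure" where
  "lib_measure l \<mu> = measure_of {0..l} (borel_subsets l) (\<lambda>A. ennreal (Re (\<mu> A)))"

locale string_measure = finite_measure M for M :: "real measure" +
  fixes l :: real
  assumes l_pos: "0 < l" and sets_M: "sets M = sets (restrict_space borel {0..l})"
begin

lemma space_M: "space M = {0..l}"
  using sets_eq_imp_space_eq[OF sets_M] by (simp add: space_restrict_space)

lemma sets_M_iff: "A \<in> sets M \<longleftrightarrow> A \<in> borel_subsets l"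
  by (auto simp: sets_M sets_restrict_space_iff borel_subsets_def)

lemma borel_in_sets: "A \<in> sets borel \<Longrightarrow> A \<subseteq> {0..l} \<Longrightarrow> A \<in> sets M"
  by (simp add: sets_M_iff borel_subsets_def)

lemma measurable_M:
  fixes f :: "real \<Rightarrow> 'b::topological_space"
  assumes "continuous_on {0..l} f" shows "f \<in> borel_measurable M"
  using borel_measurable_continuous_on_restrict[OF assms] measurable_cong_sets[OF sets_M refl] by blast

lemma integrable_M:
  fixes f :: "real \<Rightarrow> 'b::{banach,second_countable_topology}"
  assumes "continuous_on {0..l} f" shows "integrable M f"
proof -
  have "compact (f ` {0..l})" using assms by (intro compact_continuous_image) auto
  then obtain B where "\<forall>x\<in>f ` {0..l}. norm x \<le> B" using compact_imp_bounded bounded_iff by metis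
  then show ?thesis
    by (intro integrable_const_bound[where B=B] measurable_M assms) (auto simp: space_M)
qed

text \<open>
  Integrands cut off by an indicator occur below because the derivative of a solution is an
  integral over an initial interval.
\<close>

lemma integrable_M_indicator:
  fixes f :: "real \<Rightarrow> complex"
  assumes f: "continuous_on {0..l} f" and A: "A \<in> sets borel"
  shows "integrable M (\<lambda>s. indicator A s * f s)"
proof -
  have "A \<inter> space M \<in> sets M" using A by (intro borel_in_sets) (auto simp: space_M)
  then have "integrable M (\<lambda>s. indicator (A \<inter> space M) s *\<^sub>R f s)"
    by (intro integrable_mult_indicator integrable_M[OF f])
  then show ?thesis
    by (rule Bochner_Integration.integrable_cong[THEN iffD1, rotated 2]) (auto simp: indicator_def)
qed

lemma norm_integral_le:
  fixes f :: "real \<Rightarrow> complex"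
  assumes f: "\<And>s. s \<in> {0..l} \<Longrightarrow> norm (f s) \<le> B" 
  shows "norm (\<integral>s. f s \<partial>M) \<le> B * measure M {0..l}"
proof (cases "integrable M f")
  case True
  have "norm (\<integral>s. f s \<partial>M) \<le> (\<integral>s. norm (f s) \<partial>M)" by (rule integral_norm_bound)
  also have "\<dots> \<le> (\<integral>s. B \<partial>M)"
    using True f by (intro integral_mono) (auto simp: space_M)
  also have "\<dots> = B * measure M {0..l}" by (simp add: space_M)
  finally show ?thesis .
next
  case False
  have "norm (f 0) \<le> B" using f[of 0] l_pos by auto
  then have "B \<ge> 0" by (rule order_trans[OF norm_ge_zero])
  then show ?thesis using False by (simp add: not_integrable_integral_eq)
qed

end

lemma string_measure_lib:
  assumes "\<mu> \<in> nonneg_measures l" "0 < l"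
  shows "string_measure (lib_measure l \<mu>) l"
    and emeasure_lib: "\<And>A. A \<in> borel_subsets l \<Longrightarrow> emeasure (lib_measure l \<mu>) A = ennreal (Re (\<mu> A))"
proof -
  have s1: "borel_subsets l = sets (restrict_space borel {0..l})"
    by (rule set_eqI) (simp add: sets_restrict_space_iff borel_subsets_def conj_commute)
  have alg: "sigma_algebra {0..l} (borel_subsets l)"
    unfolding s1 using sets.sigma_algebra_axioms[of "restrict_space borel {0..l}"] by (simp add: space_restrict_space)
  interpret sigma_algebra "{0..l}" "borel_subsets l" by (rule alg)
  have mu: "\<mu> \<in> complex_measures l" "\<And>A. A \<in> borel_subsets l \<Longrightarrow> \<mu> A \<in> \<real> \<and> 0 \<le> Re (\<mu> A)"
    using assms by (auto simp: nonneg_measures_def)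
  have sums: "(\<lambda>i. \<mu> (A i)) sums \<mu> (\<Union>i. A i)" if "range A \<subseteq> borel_subsets l" "disjoint_family A" for A :: "nat \<Rightarrow> real set"
    using mu(1) that by (auto simp: complex_measures_def)
  have e0: "\<mu> {} = 0"
  proof -
    have "(\<lambda>i. \<mu> {}) sums \<mu> {}" using sums[of "\<lambda>_. {}"] by (auto simp: disjoint_family_on_def)
    then have "(\<lambda>i::nat. \<mu> {}) \<longlonglongrightarrow> 0" using sums_summable summable_LIMSEQ_zero by blast
    then show ?thesis by (simp add: LIMSEQ_const_iff)
  qed
  have ms: "measure_space {0..l} (borel_subsets l) (\<lambda>A. ennreal (Re (\<mu> A)))"
    unfolding measure_space_def
  proof (intro conjI alg)
    show "positive (borel_subsets l) (\<lambda>A. ennreal (Re (\<mu> A)))" by (simp add: positive_def e0)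
    show "countably_additive (borel_subsets l) (\<lambda>A. ennreal (Re (\<mu> A)))"
    proof (rule countably_additiveI)
      fix A :: "nat \<Rightarrow> real set" assume A: "range A \<subseteq> borel_subsets l" "disjoint_family A" "\<Union> (range A) \<in> borel_subsets l"
      have "(\<lambda>i. Re (\<mu> (A i))) sums Re (\<mu> (\<Union>i. A i))" using sums[OF A(1,2)] by (rule sums_Re)
      then show "(\<Sum>i. ennreal (Re (\<mu> (A i)))) = ennreal (Re (\<mu> (\<Union> (range A))))"
        using mu(2) A(1) by (intro suminf_ennreal_eq) auto
    qed
  qed
  have sets: "sets (lib_measure l \<mu>) = borel_subsets l" unfolding lib_measure_def
    using sigma_sets_eq by (simp add: space_closed sets_measure_of)
  show em: "emeasure (lib_measure l \<mu>) A = ennreal (Re (\<mu> A))" if "A \<in> borel_subsets l" for A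
    unfolding lib_measure_def using ms that by (intro emeasure_measure_of_sigma) (auto simp: measure_space_def)
  have sp: "space (lib_measure l \<mu>) = {0..l}" by (simp add: lib_measure_def space_measure_of space_closed)
  show "string_measure (lib_measure l \<mu>) l"
    by (intro string_measure.intro string_measure_axioms.intro finite_measureI)
      (use assms sets s1 sp em[OF top] in \<open>simp_all\<close>)
qed

lemma measure_lib:
  assumes "\<mu> \<in> nonneg_measures l" "0 < l" "A \<in> borel_subsets l"
  shows "measure (lib_measure l \<mu>) A = Re (\<mu> A)" and "\<mu> A = of_real (measure (lib_measure l \<mu>) A)"
proof -
  have "\<mu> A \<in> \<real> \<and> 0 \<le> Re (\<mu> A)" using assms by (auto simp: nonneg_measures_def)
  then show "measure (lib_measure l \<mu>) A = Re (\<mu> A)" "\<mu> A = of_real (measure (lib_measure l \<mu>) A)"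
    using emeasure_lib[OF assms] by (auto simp: measure_def complex_is_Real_iff complex_eq_iff)
qed

text \<open>
  The upper variation of the real part is the measure itself; the other three variations that
  enter the integral vanish.
\<close>

lemma cm_integral_nonneg:
  assumes "\<mu> \<in> nonneg_measures l" "0 < l"
  shows "cm_integral l \<mu> f = (\<integral>s. f s \<partial>lib_measure l \<mu>)"
proof -
  interpret string_measure "lib_measure l \<mu>" l by (rule string_measure_lib[OF assms])
  have mu: "\<And>A. A \<in> borel_subsets l \<Longrightarrow> \<mu> A \<in> \<real> \<and> 0 \<le> Re (\<mu> A)"
    using assms by (auto simp: nonneg_measures_def)
  have sets_eq: "sets (lib_measure l \<mu>) = borel_subsets l" using sets_M_iff by auto
  have sc: "borel_subsets l \<subseteq> Pow {0..l}" by (auto simp: borel_subsets_def)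
  have ss: "sigma_sets {0..l} (borel_subsets l) = borel_subsets l"
    using sets.sigma_sets_eq[of "lib_measure l \<mu>"] by (simp add: space_M sets_eq)
  have 1: "upper_variation l (\<lambda>A. Re (\<mu> A)) = lib_measure l \<mu>"
    unfolding upper_variation_def lib_measure_def
  proof (rule measure_of_eq[OF sc])
    fix A assume "A \<in> sigma_sets {0..l} (borel_subsets l)"
    then have A: "A \<in> borel_subsets l" by (simp add: ss)
    show "(SUP B\<in>{B \<in> borel_subsets l. B \<subseteq> A}. ennreal (Re (\<mu> B))) = ennreal (Re (\<mu> A))"
    proof (rule antisym)
      show "(SUP B\<in>{B \<in> borel_subsets l. B \<subseteq> A}. ennreal (Re (\<mu> B))) \<le> ennreal (Re (\<mu> A))"
      proof (rule SUP_least)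
        fix B assume "B \<in> {B \<in> borel_subsets l. B \<subseteq> A}"
        then show "ennreal (Re (\<mu> B)) \<le> ennreal (Re (\<mu> A))"
          using emeasure_mono[of B A "lib_measure l \<mu>"] emeasure_lib[OF assms] A sets_eq by auto
      qed
      show "ennreal (Re (\<mu> A)) \<le> (SUP B\<in>{B \<in> borel_subsets l. B \<subseteq> A}. ennreal (Re (\<mu> B)))"
        using A by (intro SUP_upper) auto
    qed
  qed
  have zero: "integral\<^sup>L (upper_variation l \<nu>) f = 0" if \<nu>: "\<And>A. A \<in> borel_subsets l \<Longrightarrow> \<nu> A \<le> 0" for \<nu> and f :: "real \<Rightarrow> complex"
  proof -
    have e: "{} \<in> borel_subsets l" by (auto simp: borel_subsets_def)
    have "upper_variation l \<nu> = measure_of {0..l} (borel_subsets l) (\<lambda>A. 0)"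
      unfolding upper_variation_def
    proof (rule measure_of_eq[OF sc])
      fix A
      have "(SUP B\<in>{B \<in> borel_subsets l. B \<subseteq> A}. ennreal (\<nu> B)) \<le> 0"
        using \<nu> by (intro SUP_least) (auto simp: ennreal_neg)
      then show "(SUP B\<in>{B \<in> borel_subsets l. B \<subseteq> A}. ennreal (\<nu> B)) = 0" by simp
    qed
    also have "\<dots> = null_measure (lib_measure l \<mu>)"
      by (rule measure_eqI) (auto simp: sc ss sets_eq emeasure_sigma)
    finally show ?thesis by simp
  qed
  show ?thesis
    unfolding cm_integral_def signed_integral_def 1
    using mu by (subst (1 2 3) zero) (auto simp: complex_is_Real_iff)
qed

text \<open>
  Both sides agree on indicators and are additive and continuous from below in the integrand.
\<close>

lemma nn_integral_mixture:
  fixes f :: "'a \<Rightarrow> ennreal"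
  assumes sets: "sets M1 = sets M" "sets M2 = sets M"
    and em: "\<And>A. A \<in> sets M \<Longrightarrow> emeasure M A = c1 * emeasure M1 A + c2 * emeasure M2 A"
    and f: "f \<in> borel_measurable M"
  shows "(\<integral>\<^sup>+s. f s \<partial>M) = c1 * (\<integral>\<^sup>+s. f s \<partial>M1) + c2 * (\<integral>\<^sup>+s. f s \<partial>M2)"
proof -
  note ms = measurable_cong_sets[OF sets(1) refl] measurable_cong_sets[OF sets(2) refl]
  note sp = sets_eq_imp_space_eq[OF sets(1)] sets_eq_imp_space_eq[OF sets(2)]
  show ?thesis using f
  proof (induction rule: borel_measurable_induct)
    case (cong f g)
    have "(\<integral>\<^sup>+s. f s \<partial>N) = (\<integral>\<^sup>+s. g s \<partial>N)" if "space N = space M" for N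
      using cong(3) that by (intro nn_integral_cong) auto
    then show ?case using cong(4) sp by metis
  next
    case (set A) then show ?case using em sets by simp
  next
    case (mult u c)
    then show ?case by (simp add: nn_integral_cmult ms distrib_left mult.left_commute)
  next
    case (add u v)
    then show ?case by (simp add: nn_integral_add ms distrib_left add_ac)
  next
    case (seq U)
    have U: "\<And>i. U i \<in> borel_measurable M" "incseq U" by fact+
    have S: "(\<integral>\<^sup>+s. (SUP i. U i) s \<partial>N) = (SUP i. \<integral>\<^sup>+s. U i s \<partial>N)" if "sets N = sets M" for N
      unfolding SUP_apply using U measurable_cong_sets[OF that refl]
      by (intro nn_integral_monotone_convergence_SUP) auto
    have inc: "incseq (\<lambda>i. c * (\<integral>\<^sup>+s. U i s \<partial>N))" for N c
      using U(2) by (auto simp: incseq_def le_fun_def intro!: mult_left_mono nn_integral_mono)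
    show ?case
      unfolding S[OF refl] S[OF sets(1)] S[OF sets(2)] SUP_mult_left_ennreal seq.IH
      by (rule ennreal_SUP_add[OF inc inc])
  qed
qed

lemma integral_mixture:
  fixes f :: "real \<Rightarrow> complex"
  assumes "string_measure M l" "string_measure M1 l" "string_measure M2 l" "0 \<le> c1" "0 \<le> c2"
    and em: "\<And>A. A \<in> sets M \<Longrightarrow> measure M A = c1 * measure M1 A + c2 * measure M2 A"
    and f: "continuous_on {0..l} f"
  shows "(\<integral>s. f s \<partial>M) = c1 * (\<integral>s. f s \<partial>M1) + c2 * (\<integral>s. f s \<partial>M2)"
proof -
  interpret M: string_measure M l by fact
  interpret M1: string_measure M1 l by fact
  interpret M2: string_measure M2 l by fact
  have sets: "sets M1 = sets M" "sets M2 = sets M" by (simp_all add: M.sets_M M1.sets_M M2.sets_M)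
  have em': "emeasure M A = ennreal c1 * emeasure M1 A + ennreal c2 * emeasure M2 A" if "A \<in> sets M" for A
    using em[OF that] assms(4,5)
    by (simp add: M.emeasure_eq_measure M1.emeasure_eq_measure M2.emeasure_eq_measure ennreal_mult' ennreal_plus)
  have real: "(\<integral>s. g s \<partial>M) = c1 * (\<integral>s. g s \<partial>M1) + c2 * (\<integral>s. g s \<partial>M2)"
    if g: "continuous_on {0..l} g" for g :: "real \<Rightarrow> real"
  proof -
    have "compact (g ` {0..l})" using g by (intro compact_continuous_image) auto
    then obtain B where B: "\<forall>x\<in>g ` {0..l}. norm x \<le> B" using compact_imp_bounded bounded_iff by metis
    \<comment> \<open>Adding a constant makes the integrand nonnegative, so that the statement for
      \<open>nn_integral\<close> applies.\<close>
    let ?h = "\<lambda>s. g s + B"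
    have h: "continuous_on {0..l} ?h" by (intro continuous_intros g)
    have h0: "\<And>s. s \<in> {0..l} \<Longrightarrow> 0 \<le> ?h s"
    proof -
      fix s assume "s \<in> {0..l}"
      then have "\<bar>g s\<bar> \<le> B" using B by simp
      then show "0 \<le> ?h s" by linarith
    qed
    have nn: "(\<integral>\<^sup>+s. ennreal (?h s) \<partial>N) = ennreal (\<integral>s. ?h s \<partial>N)" if "string_measure N l" for N
    proof -
      interpret string_measure N l by fact
      show ?thesis using h0 by (intro nn_integral_eq_integral integrable_M h AE_I2) (auto simp: space_M)
    qed
    have pos: "0 \<le> (\<integral>s. ?h s \<partial>N)" if "string_measure N l" for N
    proof -
      interpret string_measure N l by fact
      show ?thesis using h0 by (intro integral_nonneg_AE AE_I2) (auto simp: space_M)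
    qed
    have "ennreal (\<integral>s. ?h s \<partial>M) = ennreal c1 * ennreal (\<integral>s. ?h s \<partial>M1) + ennreal c2 * ennreal (\<integral>s. ?h s \<partial>M2)"
      using nn_integral_mixture[OF sets em', of "\<lambda>s. ennreal (?h s)"] M.measurable_M[OF h]
      by (simp add: nn assms(1-3))
    also have "\<dots> = ennreal (c1 * (\<integral>s. ?h s \<partial>M1) + c2 * (\<integral>s. ?h s \<partial>M2))"
      using assms pos by (simp add: ennreal_mult' ennreal_plus)
    finally have "(\<integral>s. ?h s \<partial>M) = c1 * (\<integral>s. ?h s \<partial>M1) + c2 * (\<integral>s. ?h s \<partial>M2)"
      using assms pos by (subst (asm) ennreal_inj) auto
    moreover have "(\<integral>s. ?h s \<partial>M) = (\<integral>s. g s \<partial>M) + B * measure M {0..l}"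
      "(\<integral>s. ?h s \<partial>M1) = (\<integral>s. g s \<partial>M1) + B * measure M1 {0..l}"
      "(\<integral>s. ?h s \<partial>M2) = (\<integral>s. g s \<partial>M2) + B * measure M2 {0..l}"
      by (simp_all add: M.integrable_M M1.integrable_M M2.integrable_M g M.space_M M1.space_M M2.space_M)
    moreover have "measure M {0..l} = c1 * measure M1 {0..l} + c2 * measure M2 {0..l}"
      using em[of "{0..l}"] M.borel_in_sets by simp
    ultimately show ?thesis by (simp add: algebra_simps)
  qed
  have c: "continuous_on {0..l} (\<lambda>s. Re (f s))" "continuous_on {0..l} (\<lambda>s. Im (f s))"
    by (intro continuous_intros f)+
  show ?thesis
    using real[OF c(1)] real[OF c(2)]
    by (simp add: complex_eq_iff M.integrable_M M1.integrable_M M2.integrable_M f)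
qed

lemma nonneg_mixture:
  assumes "\<mu> \<in> nonneg_measures l" "\<nu> \<in> nonneg_measures l" "0 \<le> c1" "0 \<le> c2"
  shows "(\<lambda>A. complex_of_real c1 * \<mu> A + complex_of_real c2 * \<nu> A) \<in> nonneg_measures l"
  using assms unfolding nonneg_measures_def complex_measures_def
  by (auto intro!: sums_add sums_mult)

lemma cm_integral_mixture:
  assumes "\<mu> \<in> nonneg_measures l" "\<nu> \<in> nonneg_measures l" "0 \<le> c1" "0 \<le> c2" "0 < l"
    and f: "continuous_on {0..l} f"
  shows "cm_integral l (\<lambda>A. complex_of_real c1 * \<mu> A + complex_of_real c2 * \<nu> A) f
       = c1 * cm_integral l \<mu> f + c2 * cm_integral l \<nu> f"
proof -
  note mix = nonneg_mixture[OF assms(1-4)]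
  interpret string_measure "lib_measure l (\<lambda>A. complex_of_real c1 * \<mu> A + complex_of_real c2 * \<nu> A)" l
    by (rule string_measure_lib[OF mix \<open>0 < l\<close>])
  show ?thesis
    unfolding cm_integral_nonneg[OF mix \<open>0 < l\<close>] cm_integral_nonneg[OF assms(1,5)] cm_integral_nonneg[OF assms(2,5)]
    by (rule integral_mixture[OF string_measure_axioms string_measure_lib(1)[OF assms(1,5)]
          string_measure_lib(1)[OF assms(2,5)] assms(3,4)])
      (use assms f in \<open>auto simp: sets_M_iff measure_lib(1)[OF mix \<open>0 < l\<close>] measure_lib(1)[OF assms(1,5)] measure_lib(1)[OF assms(2,5)]\<close>)
qed

lemma point_mass_nonneg: "point_mass l a \<in> nonneg_measures l"
proof -
  have "(\<lambda>i. point_mass l a (A i)) sums point_mass l a (\<Union>i. A i)"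
    if A: "range A \<subseteq> borel_subsets l" "disjoint_family A" for A :: "nat \<Rightarrow> real set"
  proof -
    have U: "(\<Union>i. A i) \<in> borel_subsets l" using A(1) by (auto simp: borel_subsets_def subset_eq)
    show ?thesis
    proof (cases "\<exists>i. a \<in> A i")
      case True
      then obtain i where i: "a \<in> A i" by blast
      have "(\<lambda>j. point_mass l a (A j)) = (\<lambda>j. if j = i then 1 else 0)"
        using A i by (auto simp: point_mass_def disjoint_family_on_def fun_eq_iff)
      then show ?thesis using sums_single[of i "\<lambda>_. 1::complex"] U i by (auto simp: point_mass_def)
    next
      case False then show ?thesis using U by (simp add: point_mass_def)
    qed
  qed
  then show ?thesis by (auto simp: nonneg_measures_def complex_measures_def point_mass_def)
qed

lemma cm_integral_point_mass:
  assumes "a \<in> {0..l}" "0 < l" and f: "continuous_on {0..l} f"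
  shows "cm_integral l (point_mass l a) f = f a"
proof -
  interpret string_measure "lib_measure l (point_mass l a)" l
    by (rule string_measure_lib[OF point_mass_nonneg assms(2)])
  let ?P = "lib_measure l (point_mass l a)"
  have a: "{a} \<in> borel_subsets l" "{0..l} - {a} \<in> borel_subsets l" using assms by (auto simp: borel_subsets_def)
  have "AE s in ?P. s = a"
  proof (rule AE_I')
    show "{0..l} - {a} \<in> null_sets ?P"
      using a by (auto simp: null_sets_def sets_M_iff emeasure_lib[OF point_mass_nonneg assms(2)] point_mass_def)
  qed (auto simp: space_M)
  then have "(\<integral>s. f s \<partial>?P) = (\<integral>s. f a \<partial>?P)"
    by (intro integral_cong_AE measurable_M f) auto
  also have "\<dots> = f a" using assms
    by (simp add: space_M measure_lib(1)[OF point_mass_nonneg assms(2)] borel_subsets_def point_mass_def)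
  finally show ?thesis by (simp add: cm_integral_nonneg[OF point_mass_nonneg assms(2)])
qed

section \<open>The Volterra equation of the string\<close>

text \<open>
  This bound makes the Volterra operator with kernel \<open>max 0 u\<close> a contraction in the norm weighted
  by \<open>exp (- (c * x))\<close>, however large the mass is.
\<close>

lemma kernel_le:
  fixes u c :: real
  assumes "0 < c"
  shows "max 0 u * exp (- (c * u)) \<le> 1 / c"
proof (cases "0 \<le> u")
  case True
  have "c * u \<le> exp (c * u)" using exp_ge_add_one_self[of "c * u"] by linarith
  then have "c * u * exp (- (c * u)) \<le> 1" by (simp add: exp_minus field_simps)
  then show ?thesis using assms True by (simp add: field_simps max_def)
next
  case False then show ?thesis using assms by (simp add: max_def)
qed

text \<open>
  The constant produced by the weighted norm with the weight chosen in \<open>gronwall\<close>.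
\<close>

definition growth :: "real \<Rightarrow> real \<Rightarrow> real \<Rightarrow> real" where
  "growth l m R = 2 * exp (2 * ((2 * R * m + 1) * l))"

lemma growth_pos: "0 < growth l m R" by (simp add: growth_def)

context string_measure begin

text \<open>
  Take the maximum of \<open>exp (- (c * (\<sigma> * x))) * d x\<close>.  By \<open>kernel_le\<close> the integral contributes at most
  half of it.  The sign \<open>\<sigma> = 1\<close> gives estimates from the left end; \<open>\<sigma> = -1\<close> gives uniqueness from the
  right end, where a resonant mode satisfies its outgoing condition.
\<close>

lemma gronwall:
  fixes d :: "real \<Rightarrow> real"
  assumes d: "continuous_on {0..l} d" "\<And>x. x \<in> {0..l} \<Longrightarrow> 0 \<le> d x"
    and le: "\<And>x. x \<in> {0..l} \<Longrightarrow> d x \<le> e + R * (\<integral>s. max 0 (\<sigma> * (x - s)) * d s \<partial>M)"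
    and R: "0 \<le> R" and m: "measure M {0..l} \<le> m" and \<sigma>: "\<bar>\<sigma>\<bar> \<le> 1" and e: "0 \<le> e"
    and x: "x \<in> {0..l}"
  shows "d x \<le> growth l m R * e"
proof -
  define c where "c = 2 * R * m + 1"
  have m0: "0 \<le> m" using m measure_nonneg[of M "{0..l}"] by linarith
  have c: "0 < c" "R * m \<le> c / 2" using R m0 by (auto simp: c_def intro!: add_nonneg_pos)
  have "continuous_on {0..l} (\<lambda>s. exp (- (c * (\<sigma> * s))) * d s)"
    by (intro continuous_intros d)
  then obtain y where y: "y \<in> {0..l}" "\<And>s. s \<in> {0..l} \<Longrightarrow> exp (- (c * (\<sigma> * s))) * d s \<le> exp (- (c * (\<sigma> * y))) * d y"
    using continuous_attains_sup[of "{0..l}" "\<lambda>s. exp (- (c * (\<sigma> * s))) * d s"] l_pos by auto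
  define D where "D = exp (- (c * (\<sigma> * y))) * d y"
  have D0: "0 \<le> D" using d(2)[OF y(1)] by (simp add: D_def)
  have dle: "d s \<le> D * exp (c * (\<sigma> * s))" if "s \<in> {0..l}" for s
  proof -
    have "exp (c * (\<sigma> * s)) * (exp (- (c * (\<sigma> * s))) * d s) \<le> exp (c * (\<sigma> * s)) * D"
      using y(2)[OF that] by (intro mult_left_mono) (auto simp: D_def)
    then show ?thesis by (simp add: exp_minus field_simps)
  qed
  have I: "(\<integral>s. max 0 (\<sigma> * (y - s)) * d s \<partial>M) \<le> D * exp (c * (\<sigma> * y)) / c * m"
  proof -
    have "(\<integral>s. max 0 (\<sigma> * (y - s)) * d s \<partial>M) \<le> (\<integral>s. D * exp (c * (\<sigma> * y)) / c \<partial>M)"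
    proof (rule integral_mono)
      show "integrable M (\<lambda>s. max 0 (\<sigma> * (y - s)) * d s)"
        by (intro integrable_M continuous_intros d)
      fix s assume s: "s \<in> space M"
      let ?u = "\<sigma> * (y - s)"
      have "max 0 ?u * d s \<le> max 0 ?u * (D * exp (c * (\<sigma> * s)))"
        using dle s by (intro mult_left_mono) (auto simp: space_M)
      also have "\<dots> = D * exp (c * (\<sigma> * y)) * (max 0 ?u * exp (- (c * ?u)))"
        by (simp add: algebra_simps flip: exp_add)
      also have "\<dots> \<le> D * exp (c * (\<sigma> * y)) * (1 / c)"
        using kernel_le[OF c(1)] D0 by (intro mult_left_mono) auto
      finally show "max 0 ?u * d s \<le> D * exp (c * (\<sigma> * y)) / c" by simp
    qed simp
    also have "\<dots> = D * exp (c * (\<sigma> * y)) / c * measure M {0..l}" by (simp add: space_M)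
    also have "\<dots> \<le> D * exp (c * (\<sigma> * y)) / c * m" using m D0 c by (intro mult_left_mono) auto
    finally show ?thesis .
  qed
  have "d y \<le> e + R * (D * exp (c * (\<sigma> * y)) / c * m)"
    using le[OF y(1)] mult_left_mono[OF I R] by linarith
  also have "\<dots> = e + (R * m / c) * (D * exp (c * (\<sigma> * y)))" by simp
  also have "\<dots> \<le> e + (1/2) * (D * exp (c * (\<sigma> * y)))"
    using c D0 by (intro add_left_mono mult_right_mono) (auto simp: field_simps)
  finally have "d y \<le> e + (1/2) * (D * exp (c * (\<sigma> * y)))" .
  moreover have "D * exp (c * (\<sigma> * y)) = d y" by (simp add: D_def exp_minus)
  ultimately have dy: "d y \<le> 2 * e" by simp
  have bnd: "exp (c * (\<sigma> * s)) \<le> exp (c * l)" "exp (- (c * (\<sigma> * s))) \<le> exp (c * l)" if "s \<in> {0..l}" for s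
  proof -
    have "\<bar>\<sigma> * s\<bar> \<le> 1 * l" unfolding abs_mult using \<sigma> that by (intro mult_mono) auto
    then have "\<bar>c * (\<sigma> * s)\<bar> \<le> c * l" using c by (simp add: abs_mult)
    then show "exp (c * (\<sigma> * s)) \<le> exp (c * l)" "exp (- (c * (\<sigma> * s))) \<le> exp (c * l)" by auto
  qed
  have "d x \<le> D * exp (c * (\<sigma> * x))" by (rule dle[OF x])
  also have "\<dots> \<le> (exp (c * l) * (2 * e)) * exp (c * l)"
    unfolding D_def using bnd x y dy d(2)[OF y(1)] by (intro mult_mono) auto
  also have "\<dots> = growth l m R * e"
    by (simp add: growth_def c_def algebra_simps flip: exp_add)
  finally show ?thesis .
qed

end

text \<open>
  With the kernel \<open>max 0 (x - s)\<close> the integrand is continuous, and a mass at \<open>x\<close> itself does not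
  influence the value at \<open>x\<close>.
\<close>

definition string_eq :: "real measure \<Rightarrow> real \<Rightarrow> complex \<Rightarrow> (real \<Rightarrow> complex) \<Rightarrow> bool" where
  "string_eq M l \<kappa> f \<longleftrightarrow> continuous_on {0..l} f \<and>
     (\<forall>x\<in>{0..l}. f x = 1 - \<kappa> * (\<integral>s. of_real (max 0 (x - s)) * f s \<partial>M))"

context string_measure begin

text \<open>
  Banach's fixed point theorem for \<open>exp (- (c * x)) * f x\<close>: the weight turns the kernel into
  \<open>max 0 u * exp (- (c * u))\<close>, which \<open>kernel_le\<close> bounds.
\<close>

lemma string_eq_exists: "\<exists>f. string_eq M l \<kappa> f"
proof -
  define m where "m = measure M {0..l}"
  define c where "c = 2 * norm \<kappa> * m + 1"
  have c: "0 < c" "norm \<kappa> * m \<le> c / 2" by (auto simp: c_def m_def intro!: add_nonneg_pos)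
  define k where "k u = max 0 u * exp (- (c * u))" for u :: real
  have k: "norm (complex_of_real (k u)) \<le> 1 / c" "0 \<le> k u" for u
    using kernel_le[OF c(1), of u] unfolding norm_of_real k_def by auto
  have contk: "continuous_on UNIV k" unfolding k_def by (intro continuous_intros)
  define T where "T g x = complex_of_real (exp (- (c * max 0 x))) - \<kappa> * (\<integral>s. of_real (k (x - s)) * g s \<partial>M)"
    for g :: "real \<Rightarrow> complex" and x
  have Ibound: "norm (\<kappa> * (\<integral>s. of_real (k (x - s)) * g s \<partial>M)) \<le> B / 2"
    if "\<And>s. norm (g s) \<le> B" for g :: "real \<Rightarrow> complex" and B x
  proof -
    have B: "0 \<le> B" using that[of 0] norm_ge_zero order_trans by blast
    have "norm (\<integral>s. of_real (k (x - s)) * g s \<partial>M) \<le> (1 / c * B) * measure M {0..l}"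
    proof (rule norm_integral_le)
      fix s
      show "norm (of_real (k (x - s)) * g s) \<le> 1 / c * B"
        unfolding norm_mult using that k(1) B c by (intro mult_mono) auto
    qed
    then have "norm \<kappa> * norm (\<integral>s. of_real (k (x - s)) * g s \<partial>M) \<le> norm \<kappa> * ((1 / c * B) * m)"
      by (intro mult_left_mono) (auto simp: m_def)
    also have "\<dots> = (norm \<kappa> * m / c) * B" by simp
    also have "\<dots> \<le> (1/2) * B" using c B by (intro mult_right_mono) (auto simp: field_simps)
    finally show ?thesis by (simp add: norm_mult)
  qed
  have Tb: "T (apply_bcontfun g) \<in> bcontfun" for g
  proof -
    obtain B where B: "\<And>s. norm (apply_bcontfun g s) \<le> B"
      using bounded_apply_bcontfun[of g] unfolding bounded_iff by auto
    have meas: "(\<lambda>s. of_real (k (x - s)) * apply_bcontfun g s) \<in> borel_measurable M" for x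
      by (intro measurable_M continuous_intros continuous_on_compose2[OF contk] continuous_on_apply_bcontfun) auto
    have "continuous_on UNIV (\<lambda>x. \<integral>s. of_real (k (x - s)) * apply_bcontfun g s \<partial>M)"
      unfolding continuous_on_sequentially o_def
    proof (intro ballI allI impI)
      fix a :: real and x assume "(\<forall>n. x n \<in> UNIV) \<and> x \<longlonglongrightarrow> a"
      then have x: "x \<longlonglongrightarrow> a" by simp
      show "(\<lambda>n. \<integral>s. of_real (k (x n - s)) * apply_bcontfun g s \<partial>M) \<longlonglongrightarrow> (\<integral>s. of_real (k (a - s)) * apply_bcontfun g s \<partial>M)"
      proof (rule integral_dominated_convergence[where w="\<lambda>_. 1 / c * B"])
        show "AE s in M. (\<lambda>n. of_real (k (x n - s)) * apply_bcontfun g s) \<longlonglongrightarrow> of_real (k (a - s)) * apply_bcontfun g s"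
        proof (intro AE_I2 tendsto_intros)
          fix s
          show "(\<lambda>n. k (x n - s)) \<longlonglongrightarrow> k (a - s)"
            by (rule continuous_on_tendsto_compose[OF contk]) (auto intro!: tendsto_intros x)
        qed
        show "AE s in M. norm (of_real (k (x n - s)) * apply_bcontfun g s) \<le> 1 / c * B" for n
          unfolding norm_mult using B k c by (intro AE_I2 mult_mono) auto
      qed (use meas in auto)
    qed
    then have "continuous_on UNIV (T (apply_bcontfun g))"
      unfolding T_def by (intro continuous_intros)
    moreover have "norm (T (apply_bcontfun g) x) \<le> 1 + B / 2" for x
      unfolding T_def using Ibound[OF B, of x] c
      by (intro order_trans[OF norm_triangle_ineq4] add_mono) auto
    ultimately show ?thesis unfolding bcontfun_def bounded_iff by auto
  qed
  have "\<exists>!g. Bcontfun (T (apply_bcontfun g)) = g"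
  proof (rule banach_fix_type[where c="1/2"])
    show "\<forall>g h. dist (Bcontfun (T (apply_bcontfun g))) (Bcontfun (T (apply_bcontfun h))) \<le> 1/2 * dist g h"
    proof (intro allI dist_bound)
      fix g h :: "real \<Rightarrow>\<^sub>C complex" and x
      have int: "integrable M (\<lambda>s. of_real (k (x - s)) * apply_bcontfun g s)" for g :: "real \<Rightarrow>\<^sub>C complex"
        by (intro integrable_M continuous_intros continuous_on_compose2[OF contk] continuous_on_apply_bcontfun) auto
      have "T (apply_bcontfun g) x - T (apply_bcontfun h) x
          = - (\<kappa> * (\<integral>s. of_real (k (x - s)) * (apply_bcontfun g s - apply_bcontfun h s) \<partial>M))"
        using int by (simp add: T_def right_diff_distrib Bochner_Integration.integral_diff)
      then have "norm (T (apply_bcontfun g) x - T (apply_bcontfun h) x) \<le> dist g h / 2"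
        using Ibound[of "\<lambda>s. apply_bcontfun g s - apply_bcontfun h s" "dist g h" x] dist_bounded[of g _ h]
        by (simp add: dist_norm)
      then show "dist (apply_bcontfun (Bcontfun (T (apply_bcontfun g))) x) (apply_bcontfun (Bcontfun (T (apply_bcontfun h))) x) \<le> 1/2 * dist g h"
        using Tb by (simp add: Bcontfun_inverse dist_norm)
    qed
  qed auto
  then obtain g where g: "Bcontfun (T (apply_bcontfun g)) = g" by blast
  have geq: "apply_bcontfun g x = T (apply_bcontfun g) x" for x
    using Bcontfun_inverse[OF Tb[of g]] g by metis
  define f where "f x = complex_of_real (exp (c * x)) * apply_bcontfun g x" for x
  have "string_eq M l \<kappa> f"
    unfolding string_eq_def
  proof (intro conjI ballI)
    show "continuous_on {0..l} f" unfolding f_def by (intro continuous_intros continuous_on_apply_bcontfun)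
    fix x assume x: "x \<in> {0..l}"
    have "of_real (exp (c * x)) * (\<integral>s. of_real (k (x - s)) * apply_bcontfun g s \<partial>M)
        = (\<integral>s. of_real (exp (c * x)) * (of_real (k (x - s)) * apply_bcontfun g s) \<partial>M)"
      by simp
    also have "\<dots> = (\<integral>s. of_real (max 0 (x - s)) * f s \<partial>M)"
    proof (rule Bochner_Integration.integral_cong[OF refl])
      fix s
      have "exp (c * x) * exp (- (c * (x - s))) = exp (c * s)" by (simp add: algebra_simps flip: exp_add)
      then have "exp (c * x) * k (x - s) = max 0 (x - s) * exp (c * s)" unfolding k_def by (simp add: mult.left_commute)
      then have "complex_of_real (exp (c * x)) * of_real (k (x - s)) = of_real (max 0 (x - s)) * of_real (exp (c * s))"
        by (metis of_real_mult)
      then show "of_real (exp (c * x)) * (of_real (k (x - s)) * apply_bcontfun g s) = of_real (max 0 (x - s)) * f s"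
        unfolding f_def by (metis mult.assoc)
    qed
    finally have I: "of_real (exp (c * x)) * (\<integral>s. of_real (k (x - s)) * apply_bcontfun g s \<partial>M) = (\<integral>s. of_real (max 0 (x - s)) * f s \<partial>M)" .
    have "f x = of_real (exp (c * x)) * of_real (exp (- (c * x))) - \<kappa> * (of_real (exp (c * x)) * (\<integral>s. of_real (k (x - s)) * apply_bcontfun g s \<partial>M))"
      unfolding f_def geq[of x] using x by (simp add: T_def algebra_simps)
    also have "of_real (exp (c * x)) * of_real (exp (- (c * x))) = (1::complex)"
      by (simp flip: of_real_mult exp_add)
    finally show "f x = 1 - \<kappa> * (\<integral>s. of_real (max 0 (x - s)) * f s \<partial>M)" unfolding I .
  qed
  then show ?thesis by blast
qed

lemma integrable_kernel:
  assumes "continuous_on {0..l} f"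
  shows "integrable M (\<lambda>s. of_real (max 0 (\<sigma> * (x - s))) * (f s :: complex))"
  by (intro integrable_M continuous_intros assms)

lemma norm_kernel_integral:
  assumes f: "continuous_on {0..l} (f :: real \<Rightarrow> complex)"
  shows "norm (\<integral>s. of_real (max 0 (\<sigma> * (x - s))) * f s \<partial>M) \<le> (\<integral>s. max 0 (\<sigma> * (x - s)) * norm (f s) \<partial>M)"
proof -
  have "norm (\<integral>s. of_real (max 0 (\<sigma> * (x - s))) * f s \<partial>M) \<le> (\<integral>s. norm (of_real (max 0 (\<sigma> * (x - s))) * f s) \<partial>M)"
    by (rule integral_norm_bound)
  also have "\<dots> = (\<integral>s. max 0 (\<sigma> * (x - s)) * norm (f s) \<partial>M)"
    by (intro Bochner_Integration.integral_cong) (auto simp: norm_mult)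
  finally show ?thesis .
qed

lemma volterra_bound:
  assumes f: "continuous_on {0..l} (f :: real \<Rightarrow> complex)"
    and le: "\<And>x. x \<in> {0..l} \<Longrightarrow> norm (f x) \<le> e + R * norm (\<integral>s. of_real (max 0 (\<sigma> * (x - s))) * f s \<partial>M)"
    and R: "0 \<le> R" and m: "measure M {0..l} \<le> m" and \<sigma>: "\<bar>\<sigma>\<bar> \<le> 1" and e: "0 \<le> e"
    and x: "x \<in> {0..l}"
  shows "norm (f x) \<le> growth l m R * e"
proof (rule gronwall[OF _ _ _ R m \<sigma> e x])
  show "continuous_on {0..l} (\<lambda>x. norm (f x))" by (intro continuous_intros f)
  fix x assume "x \<in> {0..l}"
  then show "norm (f x) \<le> e + R * (\<integral>s. max 0 (\<sigma> * (x - s)) * norm (f s) \<partial>M)"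
    using le[of x] mult_left_mono[OF norm_kernel_integral[OF f, of \<sigma> x] R] by linarith
qed auto

lemma string_eq_unique:
  assumes "string_eq M l \<kappa> f" "string_eq M l \<kappa> g" "x \<in> {0..l}"
  shows "f x = g x"
proof -
  have c: "continuous_on {0..l} f" "continuous_on {0..l} g" using assms by (auto simp: string_eq_def)
  have "norm ((\<lambda>x. f x - g x) x) \<le> growth l (measure M {0..l}) (norm \<kappa>) * 0"
  proof (rule volterra_bound[where \<sigma>=1])
    show "continuous_on {0..l} (\<lambda>x. f x - g x)" by (intro continuous_intros c)
    fix x assume x: "x \<in> {0..l}"
    have "f x - g x = - \<kappa> * (\<integral>s. of_real (max 0 (1 * (x - s))) * (f s - g s) \<partial>M)"
      using assms x integrable_kernel[OF c(1), of 1 x] integrable_kernel[OF c(2), of 1 x] unfolding string_eq_def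
      by (simp add: right_diff_distrib)
    then show "norm (f x - g x) \<le> 0 + norm \<kappa> * norm (\<integral>s. of_real (max 0 (1 * (x - s))) * (f s - g s) \<partial>M)"
      by (simp add: norm_mult)
  qed (use assms in auto)
  then show ?thesis by simp
qed

lemma string_eq_bound:
  assumes "string_eq M l \<kappa> f" "norm \<kappa> \<le> R" "measure M {0..l} \<le> m" "x \<in> {0..l}"
  shows "norm (f x) \<le> growth l m R"
proof -
  have "norm (f x) \<le> growth l m R * 1"
  proof (rule volterra_bound[where \<sigma>=1])
    show "continuous_on {0..l} f" using assms by (simp add: string_eq_def)
    show "0 \<le> R" using assms(2) norm_ge_zero order_trans by blast
    fix x assume x: "x \<in> {0..l}"
    have "norm (f x) = norm (1 - \<kappa> * (\<integral>s. of_real (max 0 (1 * (x - s))) * f s \<partial>M))"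
      using assms(1) x by (simp add: string_eq_def)
    also have "\<dots> \<le> norm (1::complex) + norm (\<kappa> * (\<integral>s. of_real (max 0 (1 * (x - s))) * f s \<partial>M))" by (rule norm_triangle_ineq4)
    also have "\<dots> \<le> 1 + R * norm (\<integral>s. of_real (max 0 (1 * (x - s))) * f s \<partial>M)"
      using assms(2) by (simp add: norm_mult mult_right_mono)
    finally show "norm (f x) \<le> 1 + R * norm (\<integral>s. of_real (max 0 (1 * (x - s))) * f s \<partial>M)" .
  qed (use assms in auto)
  then show ?thesis by simp
qed

end

section \<open>The Wronskian of two strings\<close>

text \<open>
  If \<open>f\<close> solves \<open>string_eq M l \<kappa>\<close>, then \<open>- \<kappa> * integral_upto M f x\<close> is the right derivative of \<open>f\<close>
  at \<open>x\<close>.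
\<close>

definition integral_upto :: "real measure \<Rightarrow> (real \<Rightarrow> complex) \<Rightarrow> real \<Rightarrow> complex" where
  "integral_upto M f y = (\<integral>s. indicator {0..y} s * f s \<partial>M)"

text \<open>
  Fubini, for a kernel that is symmetric in its two arguments.
\<close>

lemma kernel_swap:
  assumes M0: "string_measure M0 l" and M1: "string_measure M1 l"
    and f: "continuous_on {0..l} f0" "continuous_on {0..l} f1"
  shows "integral_upto M1 (\<lambda>x. f1 x * integral_upto M0 (\<lambda>s. of_real \<bar>x - s\<bar> * f0 s) y) y
       = integral_upto M0 (\<lambda>s. f0 s * integral_upto M1 (\<lambda>x. of_real \<bar>s - x\<bar> * f1 x) y) y"
proof -
  interpret M0: string_measure M0 l by fact
  interpret M1: string_measure M1 l by fact
  interpret pair_sigma_finite M0 M1 ..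
  interpret P: finite_measure "M0 \<Otimes>\<^sub>M M1" by (intro finite_measure_pair_measure) unfold_locales
  define h where "h s x = indicator {0..y} s * indicator {0..y} x * of_real \<bar>x - s\<bar> * f0 s * f1 x" for s x
  have bdd: "\<exists>B. \<forall>x\<in>{0..l}. norm (f x) \<le> B" if "continuous_on {0..l} f" for f :: "real \<Rightarrow> complex"
  proof -
    have "compact (f ` {0..l})" using that by (intro compact_continuous_image) auto
    then show ?thesis using compact_imp_bounded bounded_iff by (metis imageI)
  qed
  obtain B0 B1 where B: "\<And>x. x \<in> {0..l} \<Longrightarrow> norm (f0 x) \<le> B0" "\<And>x. x \<in> {0..l} \<Longrightarrow> norm (f1 x) \<le> B1"
    using bdd[OF f(1)] bdd[OF f(2)] by blast
  have B0: "0 \<le> B0" "0 \<le> B1" using order_trans[OF norm_ge_zero B(1)[of 0]] order_trans[OF norm_ge_zero B(2)[of 0]] M0.l_pos by simp_all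
  have ind: "(\<lambda>s. indicator {0..y} s :: complex) \<in> borel_measurable M" if "string_measure M l" for M
  proof -
    interpret string_measure M l by fact
    have "{0..y} \<inter> space M \<in> sets M" by (intro borel_in_sets) (auto simp: space_M)
    then have "(\<lambda>s. indicator ({0..y} \<inter> space M) s :: complex) \<in> borel_measurable M" by simp
    then show ?thesis by (rule measurable_cong[THEN iffD1, rotated]) (auto simp: indicator_def)
  qed
  have id: "(\<lambda>s. complex_of_real s) \<in> borel_measurable M" "(\<lambda>s. s) \<in> borel_measurable M" if "string_measure M l" for M
    by (rule string_measure.measurable_M[OF that], intro continuous_intros)+
  note [measurable] = ind[OF M0] ind[OF M1] id[OF M0] id[OF M1] M0.measurable_M[OF f(1)] M1.measurable_M[OF f(2)]
  have int: "integrable (M0 \<Otimes>\<^sub>M M1) (case_prod h)"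
  proof (rule P.integrable_const_bound[where B="l * B0 * B1"])
    show "case_prod h \<in> borel_measurable (M0 \<Otimes>\<^sub>M M1)" unfolding h_def by measurable
    show "AE x in M0 \<Otimes>\<^sub>M M1. norm (case_prod h x) \<le> l * B0 * B1"
    proof (rule AE_I2)
      fix p assume "p \<in> space (M0 \<Otimes>\<^sub>M M1)"
      then obtain s x where p: "p = (s, x)" "s \<in> {0..l}" "x \<in> {0..l}"
        by (auto simp: space_pair_measure M0.space_M M1.space_M)
      have "norm (h s x) \<le> 1 * 1 * l * B0 * B1"
        unfolding h_def norm_mult using p B B0 M0.l_pos
        by (intro mult_mono mult_nonneg_nonneg) (auto simp: indicator_def)
      then show "norm (case_prod h p) \<le> l * B0 * B1" by (simp add: p)
    qed
  qed
  have "integral_upto M1 (\<lambda>x. f1 x * integral_upto M0 (\<lambda>s. of_real \<bar>x - s\<bar> * f0 s) y) y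
      = (\<integral>x. (\<integral>s. h s x \<partial>M0) \<partial>M1)"
    unfolding integral_upto_def h_def
    by (intro Bochner_Integration.integral_cong refl)
      (simp add: mult_ac flip: integral_mult_right_zero)
  also have "\<dots> = (\<integral>s. (\<integral>x. h s x \<partial>M1) \<partial>M0)" by (rule Fubini_integral[OF int])
  also have "\<dots> = integral_upto M0 (\<lambda>s. f0 s * integral_upto M1 (\<lambda>x. of_real \<bar>s - x\<bar> * f1 x) y) y"
    unfolding integral_upto_def h_def
    by (intro Bochner_Integration.integral_cong refl)
      (simp add: mult_ac abs_minus_commute flip: integral_mult_right_zero)
  finally show ?thesis .
qed

context string_measure begin

lemma integrable_upto:
  assumes "continuous_on {0..l} f" shows "integrable M (\<lambda>s. indicator {0..y} s * (f s :: complex))"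
  by (intro integrable_M_indicator assms) simp

lemma integral_upto_add:
  "continuous_on {0..l} f \<Longrightarrow> continuous_on {0..l} g \<Longrightarrow>
    integral_upto M (\<lambda>s. f s + g s) y = integral_upto M f y + integral_upto M g y"
  using integrable_upto[of f y] integrable_upto[of g y] by (simp add: integral_upto_def distrib_left)

lemma integral_upto_diff:
  "continuous_on {0..l} f \<Longrightarrow> continuous_on {0..l} g \<Longrightarrow>
    integral_upto M (\<lambda>s. f s - g s) y = integral_upto M f y - integral_upto M g y"
  using integrable_upto[of f y] integrable_upto[of g y] by (simp add: integral_upto_def right_diff_distrib)

lemma integral_upto_cmult: "integral_upto M (\<lambda>s. c * f s) y = c * integral_upto M f y"
  by (simp add: integral_upto_def mult.left_commute)

lemma integral_upto_cong: "(\<And>s. s \<in> {0..l} \<Longrightarrow> 0 \<le> s \<Longrightarrow> s \<le> y \<Longrightarrow> f s = g s) \<Longrightarrow> integral_upto M f y = integral_upto M g y"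
  unfolding integral_upto_def by (intro Bochner_Integration.integral_cong) (auto simp: indicator_def space_M)

lemma integral_upto_full: "integral_upto M f l = (\<integral>s. f s \<partial>M)"
  unfolding integral_upto_def by (intro Bochner_Integration.integral_cong) (auto simp: indicator_def space_M)

text \<open>
  Writing \<open>max 0 (x - s)\<close> as \<open>(\<bar>x - s\<bar> + (x - s)) / 2\<close> replaces the one-sided kernel by a symmetric
  one and a kernel of finite rank.
\<close>

lemma string_eq_abs_kernel:
  assumes f: "string_eq M l \<kappa> f" and x: "0 \<le> x" "x \<le> y" "y \<le> l"
  shows "f x = 1 - \<kappa> / 2 * (of_real x * integral_upto M f y - integral_upto M (\<lambda>s. of_real s * f s) y)
       - \<kappa> / 2 * integral_upto M (\<lambda>s. of_real \<bar>x - s\<bar> * f s) y"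
proof -
  have c: "continuous_on {0..l} f" and e: "f x = 1 - \<kappa> * (\<integral>s. of_real (max 0 (x - s)) * f s \<partial>M)"
    using f x by (auto simp: string_eq_def)
  have "(\<integral>s. of_real (max 0 (x - s)) * f s \<partial>M) = integral_upto M (\<lambda>s. 1 / 2 * ((of_real x * f s - of_real s * f s) + of_real \<bar>x - s\<bar> * f s)) y"
    unfolding integral_upto_def
    by (intro Bochner_Integration.integral_cong refl)
      (use x in \<open>auto simp: indicator_def max_def abs_if space_M field_simps\<close>)
  also have "\<dots> = 1 / 2 * (of_real x * integral_upto M f y - integral_upto M (\<lambda>s. of_real s * f s) y + integral_upto M (\<lambda>s. of_real \<bar>x - s\<bar> * f s) y)"
    unfolding integral_upto_cmult
    by (subst integral_upto_add integral_upto_diff; (intro continuous_intros c)?; simp add: integral_upto_cmult)+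
  finally have I: "(\<integral>s. of_real (max 0 (x - s)) * f s \<partial>M)
    = 1 / 2 * (of_real x * integral_upto M f y - integral_upto M (\<lambda>s. of_real s * f s) y + integral_upto M (\<lambda>s. of_real \<bar>x - s\<bar> * f s) y)" .
  show ?thesis unfolding e I by (simp add: field_simps)
qed

lemma string_eq_at_end:
  assumes f: "string_eq M l \<kappa> f" and y: "y \<in> {0..l}"
  shows "f y = 1 - \<kappa> * (of_real y * integral_upto M f y - integral_upto M (\<lambda>s. of_real s * f s) y)"
proof -
  have c: "continuous_on {0..l} f" using f by (simp add: string_eq_def)
  have "(\<integral>s. of_real (max 0 (y - s)) * f s \<partial>M) = integral_upto M (\<lambda>s. of_real y * f s - of_real s * f s) y"
    unfolding integral_upto_def
    by (intro Bochner_Integration.integral_cong refl)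
      (auto simp: indicator_def max_def space_M algebra_simps)
  also have "\<dots> = of_real y * integral_upto M f y - integral_upto M (\<lambda>s. of_real s * f s) y"
    by (subst integral_upto_diff; (intro continuous_intros c)?; simp add: integral_upto_cmult)
  finally show ?thesis using f y by (simp add: string_eq_def)
qed

end

text \<open>
  Integrate the representation of \<open>f0\<close> by the symmetric kernel against \<open>f1\<close> in \<open>M1\<close>, and the one of
  \<open>f1\<close> against \<open>f0\<close> in \<open>M0\<close>.  The double integrals cancel by \<open>kernel_swap\<close>; what remains are the
  moments of order zero and one, that is, the data at \<open>y\<close>.
\<close>

lemma wronskian:
  assumes M0: "string_measure M0 l" and M1: "string_measure M1 l"
    and f0: "string_eq M0 l \<kappa>0 f0" and f1: "string_eq M1 l \<kappa>1 f1" and y: "y \<in> {0..l}"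
  shows "f0 y * (\<kappa>1 * integral_upto M1 f1 y) - \<kappa>0 * integral_upto M0 f0 y * f1 y
       = \<kappa>1 * integral_upto M1 (\<lambda>s. f0 s * f1 s) y - \<kappa>0 * integral_upto M0 (\<lambda>s. f0 s * f1 s) y"
proof -
  interpret M0: string_measure M0 l by fact
  interpret M1: string_measure M1 l by fact
  have c: "continuous_on {0..l} f0" "continuous_on {0..l} f1" using f0 f1 by (auto simp: string_eq_def)
  have expand: "integral_upto N (\<lambda>s. g s * f s) y
      = integral_upto N g y - \<kappa> / 2 * (integral_upto N (\<lambda>s. of_real s * g s) y * integral_upto M f y - integral_upto N g y * integral_upto M (\<lambda>s. of_real s * f s) y)
        - \<kappa> / 2 * integral_upto N (\<lambda>x. g x * integral_upto M (\<lambda>s. of_real \<bar>x - s\<bar> * f s) y) y"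
    if N: "string_measure N l" and M: "string_measure M l" and f: "string_eq M l \<kappa> f" and g: "continuous_on {0..l} g" for N M \<kappa> f g
  proof -
    interpret N: string_measure N l by fact
    interpret M: string_measure M l by fact
    have fc: "continuous_on {0..l} f" using f by (simp add: string_eq_def)
    let ?I = "integral_upto M f y" and ?J = "integral_upto M (\<lambda>s. of_real s * f s) y"
    let ?K = "\<lambda>x. integral_upto M (\<lambda>s. of_real \<bar>x - s\<bar> * f s) y"
    let ?h = "\<lambda>x. g x + (- \<kappa> / 2 * ?I) * (of_real x * g x) + (\<kappa> / 2 * ?J) * g x"
    have eq: "g x * f x = ?h x - (\<kappa> / 2) * (g x * ?K x)" if "0 \<le> x" "x \<le> y" for x
      using y by (subst M.string_eq_abs_kernel[OF f that]) (auto simp: field_simps)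
    have kc: "integrable N (\<lambda>s. indicator {0..y} s * ((\<kappa> / 2) * (g s * ?K s)))"
    proof -
      have "integrable N (\<lambda>s. indicator {0..y} s * (?h s - g s * f s))"
        by (intro N.integrable_upto continuous_intros g fc)
      then show ?thesis
        by (rule Bochner_Integration.integrable_cong[THEN iffD1, rotated 2]) (auto simp: eq indicator_def)
    qed
    have hc: "integrable N (\<lambda>s. indicator {0..y} s * ?h s)" by (intro N.integrable_upto continuous_intros g fc)
    have "integral_upto N (\<lambda>s. g s * f s) y = integral_upto N (\<lambda>x. ?h x - (\<kappa> / 2) * (g x * ?K x)) y"
      by (rule N.integral_upto_cong) (simp add: eq)
    also have "\<dots> = integral_upto N ?h y - integral_upto N (\<lambda>x. (\<kappa> / 2) * (g x * ?K x)) y"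
      using hc kc unfolding integral_upto_def by (simp add: right_diff_distrib)
    also have "integral_upto N (\<lambda>x. (\<kappa> / 2) * (g x * ?K x)) y = (\<kappa> / 2) * integral_upto N (\<lambda>x. g x * ?K x) y"
      by (rule N.integral_upto_cmult)
    also have "integral_upto N ?h y = integral_upto N g y + (- \<kappa> / 2 * ?I) * integral_upto N (\<lambda>s. of_real s * g s) y + (\<kappa> / 2 * ?J) * integral_upto N g y"
      by (subst N.integral_upto_add, (intro continuous_intros g)+)+ (simp only: N.integral_upto_cmult)
    finally show ?thesis by (simp add: algebra_simps)
  qed
  note e1 = expand[OF M1 M0 f0 c(2)] and e0 = expand[OF M0 M1 f1 c(1)]
  have D: "integral_upto M1 (\<lambda>x. f1 x * integral_upto M0 (\<lambda>s. of_real \<bar>x - s\<bar> * f0 s) y) y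
         = integral_upto M0 (\<lambda>x. f0 x * integral_upto M1 (\<lambda>s. of_real \<bar>x - s\<bar> * f1 s) y) y"
    by (rule kernel_swap[OF M0 M1 c])
  have s: "(\<lambda>s. f0 s * f1 s) = (\<lambda>s. f1 s * f0 s)" by (simp add: mult.commute)
  show ?thesis
    unfolding M0.string_eq_at_end[OF f0 y] M1.string_eq_at_end[OF f1 y] e0
    unfolding s e1 D
    by (simp add: field_simps)
qed

context string_measure begin

text \<open>
  The solution is continued from \<open>x\<close> by its tangent line and the masses met after \<open>x\<close>.
\<close>

lemma string_eq_propagate_right:
  assumes f: "string_eq M l \<kappa> f" and x: "0 \<le> x" "x \<le> y" "y \<le> l"
  shows "f y = f x - of_real (y - x) * (\<kappa> * integral_upto M f x)
             - \<kappa> * (\<integral>s. indicator {x<..<y} s * (of_real (y - s) * f s) \<partial>M)"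
proof -
  have c: "continuous_on {0..l} f" using f by (auto simp: string_eq_def)
  have "(\<integral>s. of_real (max 0 (y - s)) * f s \<partial>M)
      = (\<integral>s. of_real (max 0 (x - s)) * f s + of_real (y - x) * (indicator {0..x} s * f s) + indicator {x<..<y} s * (of_real (y - s) * f s) \<partial>M)"
    by (intro Bochner_Integration.integral_cong refl)
      (use x in \<open>auto simp: indicator_def max_def space_M algebra_simps\<close>)
  also have "\<dots> = (\<integral>s. of_real (max 0 (x - s)) * f s \<partial>M) + of_real (y - x) * integral_upto M f x + (\<integral>s. indicator {x<..<y} s * (of_real (y - s) * f s) \<partial>M)"
    using integrable_kernel[OF c, of 1 x] integrable_upto[OF c, of x] integrable_M_indicator[of "\<lambda>s. of_real (y - s) * f s" "{x<..<y}"]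
    by (simp add: integral_upto_def c continuous_intros)
  finally have I: "(\<integral>s. of_real (max 0 (y - s)) * f s \<partial>M)
    = (\<integral>s. of_real (max 0 (x - s)) * f s \<partial>M) + of_real (y - x) * integral_upto M f x
      + (\<integral>s. indicator {x<..<y} s * (of_real (y - s) * f s) \<partial>M)" .
  have fx: "f x = 1 - \<kappa> * (\<integral>s. of_real (max 0 (x - s)) * f s \<partial>M)"
    and fy: "f y = 1 - \<kappa> * (\<integral>s. of_real (max 0 (y - s)) * f s \<partial>M)"
    using f x by (auto simp: string_eq_def)
  show ?thesis unfolding fx fy I by (simp only: ring_distribs) simp
qed

lemma string_eq_affine_gap:
  assumes f: "string_eq M l \<kappa> f" and x: "0 \<le> x" "x \<le> y" "y \<le> l" and null: "measure M {x<..<b} = 0" "y \<le> b" "b \<le> l"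
  shows "f y = f x - of_real (y - x) * (\<kappa> * integral_upto M f x)"
proof -
  have s: "{x<..<b} \<in> sets M" using x null by (intro borel_in_sets) auto
  then have "AE s in M. s \<notin> {x<..<b}"
    using null(1) by (intro AE_not_in) (auto simp: null_sets_def emeasure_eq_measure)
  then have "AE s in M. indicator {x<..<y} s * (of_real (y - s) * f s) = 0"
    by eventually_elim (use null in \<open>auto simp: indicator_def\<close>)
  then have "(\<integral>s. indicator {x<..<y} s * (of_real (y - s) * f s) \<partial>M) = 0"
    by (rule integral_eq_zero_AE)
  then show ?thesis using string_eq_propagate_right[OF f x] by simp
qed

lemma integral_upto_jump:
  assumes f: "continuous_on {0..l} f" and x: "0 \<le> x" "x \<le> y" "y \<le> l" and null: "measure M {x<..<y} = 0" "x < y"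
  shows "integral_upto M f y = integral_upto M f x + of_real (measure M {y}) * f y"
proof -
  have s: "{x<..<y} \<in> sets M" using x null by (intro borel_in_sets) auto
  then have "AE s in M. s \<notin> {x<..<y}"
    using null(1) by (intro AE_not_in) (auto simp: null_sets_def emeasure_eq_measure)
  then have ae: "AE s in M. indicator {0..y} s * f s = indicator {0..x} s * f s + indicator {y} s * f y"
    by eventually_elim (use x null in \<open>auto simp: indicator_def\<close>)
  have y: "{y} \<in> sets M" using x by (intro borel_in_sets) auto
  have iy: "integrable M (\<lambda>s. indicator {y} s * f y)" using x by (intro integrable_M_indicator) auto
  have "integral_upto M f y = (\<integral>s. indicator {0..x} s * f s + indicator {y} s * f y \<partial>M)"
    unfolding integral_upto_def using integrable_upto[OF f] iy
    by (intro integral_cong_AE ae borel_measurable_integrable) auto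
  also have "\<dots> = integral_upto M f x + (\<integral>s. indicator {y} s * f y \<partial>M)"
    using integrable_upto[OF f] iy by (simp add: integral_upto_def)
  also have "(\<integral>s. indicator {y} s * f y \<partial>M) = (\<integral>s. indicator {y} s *\<^sub>R f y \<partial>M)"
    by (intro Bochner_Integration.integral_cong) (auto simp: indicator_def)
  also have "\<dots> = of_real (measure M {y}) * f y"
    using y x by (simp add: scaleR_conv_of_real space_M Int_absorb2)
  finally show ?thesis .
qed

end

section \<open>Stability in the bounded-Lipschitz distance\<close>

lemma admissible_iff: "\<mu> \<in> admissible l m \<longleftrightarrow> \<mu> \<in> nonneg_measures l \<and> Re (\<mu> {0..l}) \<le> m"
  by (auto simp: admissible_def nonneg_measures_def)

lemma interval_borel_subset: "{0..l} \<in> borel_subsets l"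
  by (auto simp: borel_subsets_def)

lemma admissible_lib:
  assumes "\<mu> \<in> admissible l m" "0 < l"
  shows "string_measure (lib_measure l \<mu>) l" "measure (lib_measure l \<mu>) {0..l} \<le> m"
  using assms string_measure_lib measure_lib(1)[OF _ _ interval_borel_subset] by (auto simp: admissible_iff)

lemma string_phi_eq:
  assumes \<mu>: "\<mu> \<in> nonneg_measures l" and l: "0 < l"
  shows "string_eq (lib_measure l \<mu>) l (z\<^sup>2) (string_phi l z \<mu>)"
proof -
  interpret string_measure "lib_measure l \<mu>" l by (rule string_measure_lib[OF \<mu> l])
  let ?P = "\<lambda>f. f \<in> extensional {0..l} \<and> continuous_on {0..l} f \<and>
     (\<forall>x \<in> {0..l}. f x = 1 - z\<^sup>2 * cm_integral l \<mu> (\<lambda>s. indicator {0..x} s * complex_of_real (x - s) * f s))"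
  have P_iff: "?P f \<longleftrightarrow> f \<in> extensional {0..l} \<and> string_eq (lib_measure l \<mu>) l (z\<^sup>2) f" for f
  proof -
    have "cm_integral l \<mu> (\<lambda>s. indicator {0..x} s * complex_of_real (x - s) * f s) = (\<integral>s. of_real (max 0 (x - s)) * f s \<partial>lib_measure l \<mu>)" for x
      unfolding cm_integral_nonneg[OF \<mu> l]
      by (intro Bochner_Integration.integral_cong refl) (auto simp: indicator_def max_def space_M)
    then show ?thesis by (simp add: string_eq_def)
  qed
  obtain g where g: "string_eq (lib_measure l \<mu>) l (z\<^sup>2) g" using string_eq_exists by blast
  let ?f = "restrict g {0..l}"
  have "string_eq (lib_measure l \<mu>) l (z\<^sup>2) ?f"
  proof -
    have "(\<integral>s. of_real (max 0 (x - s)) * ?f s \<partial>lib_measure l \<mu>) = (\<integral>s. of_real (max 0 (x - s)) * g s \<partial>lib_measure l \<mu>)" for x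
      by (intro Bochner_Integration.integral_cong refl) (auto simp: space_M)
    moreover have "continuous_on {0..l} ?f \<longleftrightarrow> continuous_on {0..l} g" by (rule continuous_on_cong) auto
    ultimately show ?thesis using g by (simp add: string_eq_def)
  qed
  then have "?P ?f" unfolding P_iff by simp
  moreover have "h = ?f" if "?P h" for h
  proof (rule extensionalityI[of _ "{0..l}"])
    show "h \<in> extensional {0..l}" using that by simp
    fix x assume "x \<in> {0..l}"
    then show "h x = ?f x"
      using string_eq_unique[of "z\<^sup>2" h ?f x] that \<open>?P ?f\<close> unfolding P_iff by blast
  qed simp
  ultimately have "?P (THE f. ?P f)" by (rule theI)
  then show ?thesis unfolding P_iff string_phi_def by blast
qed

lemma continuous_on_string_phi:
  assumes "\<mu> \<in> nonneg_measures l" "0 < l" shows "continuous_on {0..l} (string_phi l z \<mu>)"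
  using string_phi_eq[OF assms] by (simp add: string_eq_def)

text \<open>
  At \<open>l\<close> the Wronskian can be expressed by the two values of \<open>F\<close>.  If one of them vanishes, the
  right-hand side is the first-order effect of the change of the measure.
\<close>

lemma string_F_difference:
  fixes z :: complex
  assumes \<mu>: "\<mu> \<in> nonneg_measures l" and \<nu>: "\<nu> \<in> nonneg_measures l" and l: "0 < l"
  defines "f \<equiv> string_phi l z \<mu>" and "g \<equiv> string_phi l z \<nu>"
  shows "string_F l z \<nu> * f l - string_F l z \<mu> * g l
       = - \<i> * z * (cm_integral l \<nu> (\<lambda>s. f s * g s) - cm_integral l \<mu> (\<lambda>s. f s * g s))"
proof -
  interpret M: string_measure "lib_measure l \<mu>" l by (rule string_measure_lib[OF \<mu> l])
  interpret N: string_measure "lib_measure l \<nu>" l by (rule string_measure_lib[OF \<nu> l])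
  note cm = cm_integral_nonneg[OF \<mu> l] cm_integral_nonneg[OF \<nu> l]
  have "f l * (z\<^sup>2 * cm_integral l \<nu> g) - z\<^sup>2 * cm_integral l \<mu> f * g l
      = z\<^sup>2 * cm_integral l \<nu> (\<lambda>s. f s * g s) - z\<^sup>2 * cm_integral l \<mu> (\<lambda>s. f s * g s)"
    using wronskian[OF M.string_measure_axioms N.string_measure_axioms
        string_phi_eq[OF \<mu> l, of z] string_phi_eq[OF \<nu> l, of z], of l] l
    by (simp add: cm M.integral_upto_full N.integral_upto_full f_def g_def)
  then have "z\<^sup>2 * (f l * cm_integral l \<nu> g - cm_integral l \<mu> f * g l - (cm_integral l \<nu> (\<lambda>s. f s * g s) - cm_integral l \<mu> (\<lambda>s. f s * g s))) = 0"
    by (simp add: algebra_simps)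
  then have "z = 0 \<or> f l * cm_integral l \<nu> g - cm_integral l \<mu> f * g l = cm_integral l \<nu> (\<lambda>s. f s * g s) - cm_integral l \<mu> (\<lambda>s. f s * g s)"
    by simp
  then show ?thesis
  proof
    assume z: "z = 0"
    have "f l = 1" "g l = 1"
      using string_phi_eq[OF \<mu> l, of z] string_phi_eq[OF \<nu> l, of z] l z by (auto simp: string_eq_def f_def g_def)
    then show ?thesis unfolding string_F_def f_def[symmetric] g_def[symmetric] by (simp add: z)
  next
    assume e: "f l * cm_integral l \<nu> g - cm_integral l \<mu> f * g l = cm_integral l \<nu> (\<lambda>s. f s * g s) - cm_integral l \<mu> (\<lambda>s. f s * g s)"
    show ?thesis unfolding e[symmetric] string_F_def f_def[symmetric] g_def[symmetric]
      by (simp add: algebra_simps)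
  qed
qed

text \<open>
  Bounded-Lipschitz test functions control moved masses as well as added ones: shifting a unit
  mass by \<open>t\<close> is a perturbation of size \<open>\<bar>t\<bar>\<close>.
\<close>

definition bl_close :: "real \<Rightarrow> (real set \<Rightarrow> complex) \<Rightarrow> (real set \<Rightarrow> complex) \<Rightarrow> real \<Rightarrow> bool" where
  "bl_close l \<mu> \<nu> d \<longleftrightarrow> (\<forall>f B. (\<forall>s\<in>{0..l}. norm (f s) \<le> B) \<and>
       (\<forall>s\<in>{0..l}. \<forall>t\<in>{0..l}. norm (f s - f t) \<le> B * \<bar>s - t\<bar>) \<longrightarrow>
     norm (cm_integral l \<mu> f - cm_integral l \<nu> f) \<le> d * B)"

lemma bl_closeD:
  assumes "bl_close l \<mu> \<nu> d" "\<And>s. s \<in> {0..l} \<Longrightarrow> norm (f s) \<le> B"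
    "\<And>s t. s \<in> {0..l} \<Longrightarrow> t \<in> {0..l} \<Longrightarrow> norm (f s - f t) \<le> B * \<bar>s - t\<bar>"
  shows "norm (cm_integral l \<mu> f - cm_integral l \<nu> f) \<le> d * B"
  using assms unfolding bl_close_def by blast

lemma string_phi_bounds:
  assumes \<mu>: "\<mu> \<in> admissible l m" and l: "0 < l" and z: "norm z \<le> R"
  shows "x \<in> {0..l} \<Longrightarrow> norm (string_phi l z \<mu> x) \<le> growth l m (R\<^sup>2)"
    and "x \<in> {0..l} \<Longrightarrow> y \<in> {0..l} \<Longrightarrow> norm (string_phi l z \<mu> x - string_phi l z \<mu> y) \<le> R\<^sup>2 * growth l m (R\<^sup>2) * m * \<bar>x - y\<bar>"
proof -
  have \<mu>': "\<mu> \<in> nonneg_measures l" using \<mu> by (simp add: admissible_iff)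
  interpret string_measure "lib_measure l \<mu>" l by (rule string_measure_lib[OF \<mu>' l])
  note mass = admissible_lib(2)[OF \<mu> l]
  note eq = string_phi_eq[OF \<mu>' l, of z]
  have k: "norm (z\<^sup>2) \<le> R\<^sup>2" using z by (simp add: norm_power power_mono)
  show b: "norm (string_phi l z \<mu> x) \<le> growth l m (R\<^sup>2)" if "x \<in> {0..l}" for x
    by (rule string_eq_bound[OF eq k mass that])
  let ?f = "string_phi l z \<mu>"
  have c: "continuous_on {0..l} ?f" using eq by (simp add: string_eq_def)
  show "norm (?f x - ?f y) \<le> R\<^sup>2 * growth l m (R\<^sup>2) * m * \<bar>x - y\<bar>" if x: "x \<in> {0..l}" and y: "y \<in> {0..l}"
  proof -
    have "?f x - ?f y = - (z\<^sup>2) * (\<integral>s. of_real (max 0 (x - s) - max 0 (y - s)) * ?f s \<partial>lib_measure l \<mu>)"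
      using eq x y integrable_kernel[OF c, of 1 x] integrable_kernel[OF c, of 1 y]
      by (simp add: string_eq_def left_diff_distrib right_diff_distrib)
    then have "norm (?f x - ?f y) = norm (z\<^sup>2) * norm (\<integral>s. of_real (max 0 (x - s) - max 0 (y - s)) * ?f s \<partial>lib_measure l \<mu>)"
      by (simp add: norm_mult)
    also have "\<dots> \<le> R\<^sup>2 * ((\<bar>x - y\<bar> * growth l m (R\<^sup>2)) * measure (lib_measure l \<mu>) {0..l})"
    proof (rule mult_mono[OF k norm_integral_le])
      fix s assume s: "s \<in> {0..l}"
      have "\<bar>max 0 (x - s) - max 0 (y - s)\<bar> \<le> \<bar>x - y\<bar>" by (auto simp: max_def)
      then show "norm (of_real (max 0 (x - s) - max 0 (y - s)) * ?f s) \<le> \<bar>x - y\<bar> * growth l m (R\<^sup>2)"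
        unfolding norm_mult norm_of_real using b[OF s] by (intro mult_mono) auto
    qed auto
    also have "\<dots> \<le> R\<^sup>2 * ((\<bar>x - y\<bar> * growth l m (R\<^sup>2)) * m)"
      using mass growth_pos[of l m "R\<^sup>2"] by (intro mult_left_mono) auto
    finally show ?thesis by (simp add: mult_ac)
  qed
qed

definition stab_const :: "real \<Rightarrow> real \<Rightarrow> real \<Rightarrow> real" where
  "stab_const l m R = (let G = growth l m (R\<^sup>2); B = l * G + G + (l + 1) * (R\<^sup>2 * G * m); E = 2 * R * l * G * m + R\<^sup>2 * B
     in G * E + G * m + R * m * (G * E) + R * B)"

text \<open>
  The difference of two solutions satisfies a Volterra equation whose inhomogeneity is the
  difference of two integrals of \<open>s \<mapsto> max 0 (x - s) * g s\<close>, a function with bounded-Lipschitz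
  norm independent of the measures.
\<close>

lemma string_stability:
  assumes \<mu>: "\<mu> \<in> admissible l m" and \<nu>: "\<nu> \<in> admissible l m" and l: "0 < l"
    and z: "norm z \<le> R" "norm w \<le> R" and bl: "bl_close l \<mu> \<nu> d" and d: "0 \<le> d"
  shows "x \<in> {0..l} \<Longrightarrow> norm (string_phi l z \<mu> x - string_phi l w \<nu> x) \<le> stab_const l m R * (norm (z - w) + d)"
    and "norm (string_F l z \<mu> - string_F l w \<nu>) \<le> stab_const l m R * (norm (z - w) + d)"
    and "0 \<le> stab_const l m R"
proof -
  have \<mu>': "\<mu> \<in> nonneg_measures l" and \<nu>': "\<nu> \<in> nonneg_measures l" using \<mu> \<nu> by (simp_all add: admissible_iff)
  interpret M: string_measure "lib_measure l \<mu>" l by (rule string_measure_lib[OF \<mu>' l])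
  interpret N: string_measure "lib_measure l \<nu>" l by (rule string_measure_lib[OF \<nu>' l])
  note cm = cm_integral_nonneg[OF \<mu>' l] cm_integral_nonneg[OF \<nu>' l]
  note mass = admissible_lib(2)[OF \<mu> l] admissible_lib(2)[OF \<nu> l]
  define f g where "f = string_phi l z \<mu>" and "g = string_phi l w \<nu>"
  have fe: "string_eq (lib_measure l \<mu>) l (z\<^sup>2) f" and ge: "string_eq (lib_measure l \<nu>) l (w\<^sup>2) g"
    unfolding f_def g_def by (rule string_phi_eq[OF \<mu>' l] string_phi_eq[OF \<nu>' l])+
  have c: "continuous_on {0..l} f" "continuous_on {0..l} g" using fe ge by (auto simp: string_eq_def)
  define G where "G = growth l m (R\<^sup>2)"
  define B where "B = l * G + G + (l + 1) * (R\<^sup>2 * G * m)"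
  define E where "E = 2 * R * l * G * m + R\<^sup>2 * B"
  have G: "0 < G" by (simp add: G_def growth_pos)
  have R: "0 \<le> R" using z norm_ge_zero order_trans by blast
  have m: "0 \<le> m" using mass(1) measure_nonneg order_trans by blast
  have B: "0 \<le> B" "G \<le> B" "R\<^sup>2 * G * m \<le> B" using G R m l by (auto simp: B_def algebra_simps)
  have E: "0 \<le> E" using G R m l B by (auto simp: E_def)
  have SC: "stab_const l m R = G * E + G * m + R * m * (G * E) + R * B"
    by (simp add: stab_const_def Let_def G_def B_def E_def)
  have fb: "\<And>s. s \<in> {0..l} \<Longrightarrow> norm (f s) \<le> G" and gb: "\<And>s. s \<in> {0..l} \<Longrightarrow> norm (g s) \<le> G"
    unfolding f_def g_def G_def using string_phi_bounds(1)[OF \<mu> l z(1)] string_phi_bounds(1)[OF \<nu> l z(2)] by auto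
  have gl: "norm (g s - g t) \<le> R\<^sup>2 * G * m * \<bar>s - t\<bar>" if "s \<in> {0..l}" "t \<in> {0..l}" for s t
    unfolding g_def G_def using string_phi_bounds(2)[OF \<nu> l z(2)] that by auto
  define \<epsilon> where "\<epsilon> = norm (z - w) + d"
  have \<epsilon>: "0 \<le> \<epsilon>" "norm (z - w) \<le> \<epsilon>" "d \<le> \<epsilon>" using d by (auto simp: \<epsilon>_def)
  have kd: "norm (z\<^sup>2 - w\<^sup>2) \<le> 2 * R * norm (z - w)"
  proof -
    have "norm (z\<^sup>2 - w\<^sup>2) = norm (z + w) * norm (z - w)"
      by (simp add: power2_eq_square square_diff_square_factored norm_mult)
    also have "\<dots> \<le> (2 * R) * norm (z - w)"
      using norm_triangle_ineq[of z w] z by (intro mult_right_mono) auto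
    finally show ?thesis .
  qed
  have kw: "norm (w\<^sup>2) \<le> R\<^sup>2" and kz: "norm (z\<^sup>2) \<le> R\<^sup>2" using z by (simp_all add: norm_power power_mono)
  define K where "K x s = complex_of_real (max 0 (x - s)) * g s" for x s
  have Kb: "norm (K x s) \<le> l * G" if "x \<in> {0..l}" "s \<in> {0..l}" for x s
    unfolding K_def norm_mult norm_of_real using that gb l by (intro mult_mono) auto
  have Kbl: "norm (cm_integral l \<mu> (K x) - cm_integral l \<nu> (K x)) \<le> d * B" if x: "x \<in> {0..l}" for x
  proof (rule bl_closeD[OF bl])
    show "norm (K x s) \<le> B" if "s \<in> {0..l}" for s
      using Kb[OF x that] G m l R by (simp add: B_def add_increasing2)
    fix s t assume s: "s \<in> {0..l}" and t: "t \<in> {0..l}"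
    have "K x s - K x t = of_real (max 0 (x - s) - max 0 (x - t)) * g s + of_real (max 0 (x - t)) * (g s - g t)"
      by (simp add: K_def algebra_simps)
    then have "norm (K x s - K x t) \<le> \<bar>max 0 (x - s) - max 0 (x - t)\<bar> * norm (g s) + \<bar>max 0 (x - t)\<bar> * norm (g s - g t)"
      by (metis norm_triangle_ineq norm_mult norm_of_real)
    also have "\<dots> \<le> \<bar>s - t\<bar> * G + l * (R\<^sup>2 * G * m * \<bar>s - t\<bar>)"
      using x s t gb[OF s] gl[OF s t] l by (intro add_mono mult_mono) (auto simp: max_def)
    also have "\<dots> \<le> B * \<bar>s - t\<bar>"
      using G l m by (simp add: B_def algebra_simps)
    finally show "norm (K x s - K x t) \<le> B * \<bar>s - t\<bar>" .
  qed
  have diff: "norm (f x - g x) \<le> G * (E * \<epsilon>)" if "x \<in> {0..l}" for x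
    unfolding G_def
  proof (rule M.volterra_bound[where \<sigma>=1 and f="\<lambda>x. f x - g x"])
    show "continuous_on {0..l} (\<lambda>x. f x - g x)" by (intro continuous_intros c)
    fix x assume x: "x \<in> {0..l}"
    let ?V = "\<integral>s. of_real (max 0 (1 * (x - s))) * (f s - g s) \<partial>lib_measure l \<mu>"
    have V: "?V = (\<integral>s. of_real (max 0 (x - s)) * f s \<partial>lib_measure l \<mu>) - cm_integral l \<mu> (K x)"
      using M.integrable_kernel[OF c(1), of 1 x] M.integrable_kernel[OF c(2), of 1 x]
      by (simp add: cm K_def right_diff_distrib)
    have "f x - g x = - (z\<^sup>2 * ?V) - ((z\<^sup>2 - w\<^sup>2) * cm_integral l \<mu> (K x)) - w\<^sup>2 * (cm_integral l \<mu> (K x) - cm_integral l \<nu> (K x))"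
      unfolding V using fe ge x by (simp add: string_eq_def cm K_def algebra_simps)
    then have "norm (f x - g x) \<le> norm (z\<^sup>2 * ?V) + norm ((z\<^sup>2 - w\<^sup>2) * cm_integral l \<mu> (K x)) + norm (w\<^sup>2 * (cm_integral l \<mu> (K x) - cm_integral l \<nu> (K x)))"
      by (smt (verit) norm_minus_cancel norm_triangle_ineq4)
    also have "norm (z\<^sup>2 * ?V) \<le> R\<^sup>2 * norm ?V" unfolding norm_mult using kz by (intro mult_right_mono) auto
    also have "norm ((z\<^sup>2 - w\<^sup>2) * cm_integral l \<mu> (K x)) \<le> (2 * R * \<epsilon>) * ((l * G) * m)"
    proof -
      have "norm (cm_integral l \<mu> (K x)) \<le> (l * G) * measure (lib_measure l \<mu>) {0..l}"
        unfolding cm by (rule M.norm_integral_le) (use Kb x in auto)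
      also have "\<dots> \<le> (l * G) * m" using mass G l by (intro mult_left_mono) auto
      finally have "norm (cm_integral l \<mu> (K x)) \<le> (l * G) * m" .
      moreover have "norm (z\<^sup>2 - w\<^sup>2) \<le> 2 * R * \<epsilon>" using kd mult_left_mono[OF \<epsilon>(2), of "2 * R"] R by simp
      ultimately show ?thesis unfolding norm_mult using R \<epsilon> by (intro mult_mono) auto
    qed
    also have "norm (w\<^sup>2 * (cm_integral l \<mu> (K x) - cm_integral l \<nu> (K x))) \<le> R\<^sup>2 * (\<epsilon> * B)"
      unfolding norm_mult using kw Kbl[OF x] mult_right_mono[OF \<epsilon>(3) B(1)] by (intro mult_mono) auto
    finally show "norm (f x - g x) \<le> E * \<epsilon> + R\<^sup>2 * norm ?V" by (simp add: E_def algebra_simps)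
  qed (use mass that E \<epsilon> in auto)
  have SCb: "G * (E * \<epsilon>) \<le> stab_const l m R * \<epsilon>"
    using G E R m B \<epsilon> by (simp add: SC algebra_simps)
  show "norm (string_phi l z \<mu> x - string_phi l w \<nu> x) \<le> stab_const l m R * (norm (z - w) + d)" if "x \<in> {0..l}"
    using diff[OF that] SCb by (simp add: f_def g_def \<epsilon>_def)
  show "0 \<le> stab_const l m R" using G E R m B by (simp add: SC)
  have if': "integrable (lib_measure l \<mu>) f" "integrable (lib_measure l \<mu>) g" by (intro M.integrable_M c)+
  have "string_F l z \<mu> - string_F l w \<nu> = (f l - g l) - \<i> * ((z - w) * cm_integral l \<mu> f) - \<i> * (w * cm_integral l \<mu> (\<lambda>s. f s - g s))
       - \<i> * (w * (cm_integral l \<mu> g - cm_integral l \<nu> g))"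
    using if' by (simp add: string_F_def f_def[symmetric] g_def[symmetric] cm algebra_simps)
  then have "norm (string_F l z \<mu> - string_F l w \<nu>) \<le> norm (f l - g l) + norm (\<i> * ((z - w) * cm_integral l \<mu> f))
      + norm (\<i> * (w * cm_integral l \<mu> (\<lambda>s. f s - g s))) + norm (\<i> * (w * (cm_integral l \<mu> g - cm_integral l \<nu> g)))"
    by (smt (verit) norm_triangle_ineq4)
  also have "norm (f l - g l) \<le> G * (E * \<epsilon>)" using diff l by simp
  also have "norm (\<i> * ((z - w) * cm_integral l \<mu> f)) \<le> \<epsilon> * (G * m)"
  proof -
    have "norm (cm_integral l \<mu> f) \<le> G * measure (lib_measure l \<mu>) {0..l}"
      unfolding cm by (rule M.norm_integral_le) (use fb in auto)
    also have "\<dots> \<le> G * m" using mass G by (intro mult_left_mono) auto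
    finally show ?thesis unfolding norm_mult using \<epsilon> by (simp add: mult_mono)
  qed
  also have "norm (\<i> * (w * cm_integral l \<mu> (\<lambda>s. f s - g s))) \<le> R * ((G * (E * \<epsilon>)) * m)"
  proof -
    have "norm (cm_integral l \<mu> (\<lambda>s. f s - g s)) \<le> (G * (E * \<epsilon>)) * measure (lib_measure l \<mu>) {0..l}"
      unfolding cm by (rule M.norm_integral_le) (use diff in auto)
    also have "\<dots> \<le> (G * (E * \<epsilon>)) * m" using mass G E \<epsilon> by (intro mult_left_mono) auto
    finally show ?thesis unfolding norm_mult using R z by (simp add: mult_mono)
  qed
  also have "norm (\<i> * (w * (cm_integral l \<mu> g - cm_integral l \<nu> g))) \<le> R * (\<epsilon> * B)"
  proof -
    have "norm (cm_integral l \<mu> g - cm_integral l \<nu> g) \<le> d * B"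
    proof (rule bl_closeD[OF bl])
      show "norm (g s) \<le> B" if "s \<in> {0..l}" for s using gb[OF that] B by simp
      fix s t assume st: "s \<in> {0..l}" "t \<in> {0..l}"
      have "R\<^sup>2 * G * m * \<bar>s - t\<bar> \<le> B * \<bar>s - t\<bar>"
        using B(3) by (rule mult_right_mono) simp
      then show "norm (g s - g t) \<le> B * \<bar>s - t\<bar>" using gl[OF st] by linarith
    qed
    also have "\<dots> \<le> \<epsilon> * B" using \<epsilon> B by (intro mult_right_mono) auto
    finally show ?thesis unfolding norm_mult using R z by (simp add: mult_mono)
  qed
  finally show "norm (string_F l z \<mu> - string_F l w \<nu>) \<le> stab_const l m R * (norm (z - w) + d)"
    unfolding SC \<epsilon>_def[symmetric] by (simp add: algebra_simps)
qed

section \<open>Solving for the measure instead of the eigenvalue\<close>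

lemma nonneg_zero: "(\<lambda>A. 0) \<in> nonneg_measures l"
  by (auto simp: nonneg_measures_def complex_measures_def)

lemma cm_integral_sum:
  assumes "finite K" "\<And>k. k \<in> K \<Longrightarrow> \<nu> k \<in> nonneg_measures l" "\<And>k. k \<in> K \<Longrightarrow> 0 \<le> c k" "0 < l"
    and f: "continuous_on {0..l} f"
  shows "(\<lambda>A. \<Sum>k\<in>K. complex_of_real (c k) * \<nu> k A) \<in> nonneg_measures l"
    and "cm_integral l (\<lambda>A. \<Sum>k\<in>K. complex_of_real (c k) * \<nu> k A) f = (\<Sum>k\<in>K. complex_of_real (c k) * cm_integral l (\<nu> k) f)"
proof -
  have "(\<lambda>A. \<Sum>k\<in>K. complex_of_real (c k) * \<nu> k A) \<in> nonneg_measures l \<and>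
    cm_integral l (\<lambda>A. \<Sum>k\<in>K. complex_of_real (c k) * \<nu> k A) f = (\<Sum>k\<in>K. complex_of_real (c k) * cm_integral l (\<nu> k) f)"
    using assms(1-3)
  proof (induction rule: finite_induct)
    case empty
    have "cm_integral l (\<lambda>A. complex_of_real 0 * 0 + complex_of_real 0 * 0) f = 0"
      using cm_integral_mixture[OF nonneg_zero nonneg_zero order_refl order_refl \<open>0 < l\<close> f] by simp
    then show ?case by (simp add: nonneg_zero)
  next
    case (insert k K)
    let ?\<sigma> = "\<lambda>A. \<Sum>k\<in>K. complex_of_real (c k) * \<nu> k A"
    have IH: "?\<sigma> \<in> nonneg_measures l" "cm_integral l ?\<sigma> f = (\<Sum>k\<in>K. complex_of_real (c k) * cm_integral l (\<nu> k) f)"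
      using insert by auto
    have k: "\<nu> k \<in> nonneg_measures l" "0 \<le> c k" using insert by auto
    show ?case
      using nonneg_mixture[OF k(1) IH(1) k(2) zero_le_one] cm_integral_mixture[OF k(1) IH(1) k(2) zero_le_one \<open>0 < l\<close> f] insert(1,2) IH(2)
      by simp
  qed
  then show "(\<lambda>A. \<Sum>k\<in>K. complex_of_real (c k) * \<nu> k A) \<in> nonneg_measures l"
    and "cm_integral l (\<lambda>A. \<Sum>k\<in>K. complex_of_real (c k) * \<nu> k A) f = (\<Sum>k\<in>K. complex_of_real (c k) * cm_integral l (\<nu> k) f)"
    by auto
qed

text \<open>
  A weak* neighbourhood is built from subbasic sets by unions and finite intersections, and the
  claim is clear for subbasic sets.
\<close>

lemma weak_star_eventually:
  fixes N :: "complex \<Rightarrow> real set \<Rightarrow> complex"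
  assumes W: "openin (weak_star_topology l) W" "N 0 \<in> W"
    and N: "0 < r0" "\<And>w. norm w \<le> r0 \<Longrightarrow> N w \<in> complex_measures l"
    and lim: "\<And>f. continuous_on {0..l} f \<Longrightarrow> isCont (\<lambda>w. cm_integral l (N w) f) 0"
  shows "\<exists>r>0. \<forall>w. norm w \<le> r \<longrightarrow> N w \<in> W"
proof -
  have "generate_topology_on {{\<mu> \<in> complex_measures l. cm_integral l \<mu> f \<in> U} | f U. continuous_on {0..l} f \<and> open U} W"
    using W(1) by (simp add: weak_star_topology_def openin_topology_generated_by_iff)
  then show ?thesis using W(2)
  proof (induction rule: generate_topology_on.induct)
    case Empty then show ?case by simp
  next
    case (Int a b)
    then obtain r s where "r > 0" "\<forall>w. norm w \<le> r \<longrightarrow> N w \<in> a" "s > 0" "\<forall>w. norm w \<le> s \<longrightarrow> N w \<in> b" by blast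
    then show ?case by (intro exI[of _ "min r s"]) auto
  next
    case (UN K) then show ?case by blast
  next
    case (Basis s)
    then obtain f U where s: "s = {\<mu> \<in> complex_measures l. cm_integral l \<mu> f \<in> U}" and f: "continuous_on {0..l} f" and U: "open U"
      by blast
    have "cm_integral l (N 0) f \<in> U" using Basis s by simp
    then have "\<forall>\<^sub>F w in nhds 0. cm_integral l (N w) f \<in> U"
      using topological_tendstoD[OF tendsto_at_iff_tendsto_nhds[THEN iffD1, OF lim[OF f, unfolded isCont_def]] U] by simp
    then obtain d where d: "d > 0" "\<And>w. dist w 0 < d \<Longrightarrow> cm_integral l (N w) f \<in> U"
      unfolding eventually_nhds_metric by blast
    show ?case
    proof (intro exI[of _ "min (d/2) r0"] conjI allI impI)
      show "0 < min (d/2) r0" using d N by simp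
      fix w :: complex assume "norm w \<le> min (d/2) r0"
      then show "N w \<in> s" using d N(2) unfolding s by (simp add: dist_norm)
    qed
  qed
qed

text \<open>
  A continuous representation of \<open>w\<close> with nonnegative coefficients in the four directions \<open>\<i> ^ k\<close>.
\<close>

lemma quadrant_sum:
  fixes w :: complex
  shows "(\<Sum>k<4. complex_of_real (max 0 (w \<bullet> \<i> ^ k)) * \<i> ^ k) = w"
proof -
  have "\<i> ^ 2 = -1" "\<i> ^ 3 = - \<i>" by (simp_all add: power3_eq_cube)
  then show ?thesis
    by (simp add: eval_nat_numeral inner_complex_def complex_eq_iff max_def)
qed

lemma norm_add3: "norm (a + b + c :: complex) \<le> norm a + norm b + norm c"
  using norm_triangle_ineq[of a b] norm_triangle_ineq[of "a + b" c] by linarith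

text \<open>
  If the first-order directions fill a neighbourhood of \<open>0\<close>, choose admissible \<open>\<nu>\<^sub>k\<close> and shifts
  \<open>x\<^sub>k\<close> that produce the four directions \<open>\<eta> \<i>\<^sup>k\<close>.  By \<open>quadrant_sum\<close> each small \<open>w\<close> is realised to
  first order by a mixture \<open>N w\<close> of these with the shifted measure, with weights that depend on \<open>w\<close>
  in a Lipschitz way: \<open>F(\<omega>; N w)\<close> is a nonzero multiple of \<open>w + O(|w|\<^sup>2)\<close>.  For \<open>z\<close> near \<open>\<omega>\<close> the function
  \<open>F(z; N w)\<close> of \<open>w\<close> is uniformly close to this, so it vanishes somewhere by Brouwer's theorem.
  The curve \<open>S\<close> admits perturbations that are first order only in the weak* sense, namely motions of
  a mass; for them \<open>v\<close> is the first-order direction.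
\<close>

lemma perturbation_interior:
  fixes S :: "real \<Rightarrow> real set \<Rightarrow> complex" and v \<omega> :: complex
  assumes l: "0 < l" and \<mu>0: "\<mu>0 \<in> admissible l m" and \<omega>: "string_F l \<omega> \<mu>0 = 0" "\<omega> \<noteq> 0"
  defines "\<phi> \<equiv> string_phi l \<omega> \<mu>0"
  assumes \<phi>l: "\<phi> l \<noteq> 0"
    and S: "0 < \<tau>0" "\<And>\<tau>. \<bar>\<tau>\<bar> \<le> \<tau>0 \<Longrightarrow> S \<tau> \<in> admissible l m" "S 0 = \<mu>0"
    and K: "0 \<le> K" "\<And>\<tau> \<tau>'. \<bar>\<tau>\<bar> \<le> \<tau>0 \<Longrightarrow> \<bar>\<tau>'\<bar> \<le> \<tau>0 \<Longrightarrow> bl_close l (S \<tau>) (S \<tau>') (K * \<bar>\<tau> - \<tau>'\<bar>)"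
    and cont: "\<And>f. continuous_on {0..l} f \<Longrightarrow> isCont (\<lambda>\<tau>. cm_integral l (S \<tau>) f) 0"
    and first: "\<And>\<tau>. \<bar>\<tau>\<bar> \<le> \<tau>0 \<Longrightarrow> norm (string_F l \<omega> (S \<tau>) * \<phi> l + \<i> * \<omega> * of_real \<tau> * v) \<le> K * \<tau>\<^sup>2"
    and int: "0 \<in> interior {cm_integral l \<nu> (\<lambda>s. (\<phi> s)\<^sup>2) - cm_integral l \<mu>0 (\<lambda>s. (\<phi> s)\<^sup>2) + of_real x * v | \<nu> x.
        \<nu> \<in> admissible l m \<and> \<bar>x\<bar> \<le> (1::real)}"
    and W: "openin (weak_star_topology l) W" "\<mu>0 \<in> W"
  shows "\<omega> \<in> interior (quasi_eigenvalues_of l (admissible l m \<inter> W))"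
proof -
  let ?D = "{cm_integral l \<nu> (\<lambda>s. (\<phi> s)\<^sup>2) - cm_integral l \<mu>0 (\<lambda>s. (\<phi> s)\<^sup>2) + of_real x * v | \<nu> x.
        \<nu> \<in> admissible l m \<and> \<bar>x\<bar> \<le> (1::real)}"
  obtain \<eta> where \<eta>: "0 < \<eta>" "cball 0 \<eta> \<subseteq> ?D" using int mem_interior_cball by blast
  have "\<exists>\<nu> x. \<nu> \<in> admissible l m \<and> \<bar>x\<bar> \<le> 1 \<and>
      cm_integral l \<nu> (\<lambda>s. (\<phi> s)\<^sup>2) - cm_integral l \<mu>0 (\<lambda>s. (\<phi> s)\<^sup>2) + of_real x * v = of_real \<eta> * \<i> ^ k" for k :: nat
  proof -
    have "of_real \<eta> * \<i> ^ k \<in> cball 0 \<eta>" using \<eta>(1) by (simp add: norm_mult norm_power)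
    then show ?thesis using \<eta>(2) by fastforce
  qed
  then obtain \<nu> x where \<nu>: "\<And>k. \<nu> k \<in> admissible l m" and x: "\<And>k. \<bar>x k\<bar> \<le> (1::real)"
    and dir: "\<And>k. cm_integral l (\<nu> k) (\<lambda>s. (\<phi> s)\<^sup>2) - cm_integral l \<mu>0 (\<lambda>s. (\<phi> s)\<^sup>2) + of_real (x k) * v = of_real \<eta> * \<i> ^ k"
    by metis
  have \<nu>': "\<And>k. \<nu> k \<in> nonneg_measures l" and \<mu>0': "\<mu>0 \<in> nonneg_measures l" using \<nu> \<mu>0 by (auto simp: admissible_iff)
  have m: "0 \<le> m" using admissible_lib(2)[OF \<mu>0 l] measure_nonneg order_trans by blast
  \<comment> \<open>the weights of the four directions\<close>
  define \<rho> where "\<rho> k w = max 0 (w \<bullet> \<i> ^ k) / \<eta>" for k :: nat and w :: complex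
  have cs: "\<bar>w \<bullet> \<i> ^ k\<bar> \<le> norm w" for w k
    using Cauchy_Schwarz_ineq2[of w "\<i> ^ k"] by (simp add: norm_power)
  have \<rho>: "0 \<le> \<rho> k w" "\<rho> k w \<le> norm w / \<eta>" "\<bar>\<rho> k w - \<rho> k w'\<bar> \<le> norm (w - w') / \<eta>" "\<rho> k 0 = 0" for k w w'
  proof -
    show "0 \<le> \<rho> k w" "\<rho> k 0 = 0" using \<eta> by (auto simp: \<rho>_def)
    show "\<rho> k w \<le> norm w / \<eta>" using cs[of w k] \<eta> unfolding \<rho>_def by (intro divide_right_mono) auto
    have "\<bar>max 0 (w \<bullet> \<i> ^ k) - max 0 (w' \<bullet> \<i> ^ k)\<bar> \<le> norm (w - w')"
      using cs[of "w - w'" k] unfolding inner_diff_left by (auto simp: max_def)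
    then show "\<bar>\<rho> k w - \<rho> k w'\<bar> \<le> norm (w - w') / \<eta>"
      using \<eta> unfolding \<rho>_def by (simp add: divide_right_mono flip: diff_divide_distrib)
  qed
  define P where "P w = (\<Sum>k<4. \<rho> k w)" for w
  define \<tau> where "\<tau> w = (\<Sum>k<4. \<rho> k w * x k)" for w
  have sum4: "(\<Sum>k<4::nat. h k) \<le> 4 * B" if "\<And>k. h k \<le> B" for h and B :: real
    using sum_mono[of "{..<4::nat}" h "\<lambda>_. B"] that by simp
  have P: "0 \<le> P w" "P w \<le> 4 * norm w / \<eta>" "\<bar>P w - P w'\<bar> \<le> 4 * norm (w - w') / \<eta>" "P 0 = 0" for w w'
  proof -
    show "0 \<le> P w" "P 0 = 0" unfolding P_def by (auto intro: sum_nonneg simp: \<rho>)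
    show "P w \<le> 4 * norm w / \<eta>" unfolding P_def using sum4[of "\<lambda>k. \<rho> k w" "norm w / \<eta>"] \<rho> by simp
    have "\<bar>P w - P w'\<bar> \<le> (\<Sum>k<4. \<bar>\<rho> k w - \<rho> k w'\<bar>)" unfolding P_def sum_subtractf[symmetric] by (rule sum_abs)
    also have "\<dots> \<le> 4 * (norm (w - w') / \<eta>)" using \<rho> by (intro sum4)
    finally show "\<bar>P w - P w'\<bar> \<le> 4 * norm (w - w') / \<eta>" by simp
  qed
  have \<tau>: "\<bar>\<tau> w - \<tau> w'\<bar> \<le> 4 * norm (w - w') / \<eta>" "\<tau> 0 = 0" for w w'
  proof -
    show "\<tau> 0 = 0" by (simp add: \<tau>_def \<rho>)
    have "\<bar>\<tau> w - \<tau> w'\<bar> = \<bar>\<Sum>k<4. (\<rho> k w - \<rho> k w') * x k\<bar>"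
      by (simp add: \<tau>_def sum_subtractf left_diff_distrib)
    also have "\<dots> \<le> (\<Sum>k<4. \<bar>(\<rho> k w - \<rho> k w') * x k\<bar>)" by (rule sum_abs)
    also have "\<dots> \<le> 4 * (norm (w - w') / \<eta>)"
    proof (rule sum4)
      fix k show "\<bar>(\<rho> k w - \<rho> k w') * x k\<bar> \<le> norm (w - w') / \<eta>"
        unfolding abs_mult using mult_mono[OF \<rho>(3)[of k w w'] x[of k]] \<eta> by simp
    qed
    finally show "\<bar>\<tau> w - \<tau> w'\<bar> \<le> 4 * norm (w - w') / \<eta>" by simp
  qed
  have \<tau>w: "\<bar>\<tau> w\<bar> \<le> 4 * norm w / \<eta>" for w using \<tau>(1)[of w 0] \<tau>(2) by simp
  \<comment> \<open>For such \<open>w\<close> the weights sum to at most \<open>1\<close> and the shift stays within its range.\<close>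
  define r0 where "r0 = min (\<eta> / 4) (\<eta> * \<tau>0 / 4)"
  have r0: "0 < r0" using \<eta> S by (simp add: r0_def)
  have small: "P w \<le> 1" "\<bar>\<tau> w\<bar> \<le> \<tau>0" if "norm w \<le> r0" for w
  proof -
    have "4 * norm w / \<eta> \<le> 1" "4 * norm w / \<eta> \<le> \<tau>0" using that \<eta> by (auto simp: r0_def field_simps)
    then show "P w \<le> 1" "\<bar>\<tau> w\<bar> \<le> \<tau>0" using P(2)[of w] \<tau>w[of w] by auto
  qed
  \<comment> \<open>The whole measure, including the shifted part, is scaled by \<open>1 - P w\<close>, so that \<open>N w\<close> is
    a convex combination of admissible measures.\<close>
  define N where "N w = (\<lambda>A. complex_of_real (1 - P w) * S (\<tau> w) A + complex_of_real 1 * (\<Sum>k<4. complex_of_real (\<rho> k w) * \<nu> k A))" for w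
  have N0: "N 0 = \<mu>0" by (simp add: N_def P \<rho> \<tau> S)
  have N: "N w \<in> admissible l m" and J: "\<And>f. continuous_on {0..l} f \<Longrightarrow> cm_integral l (N w) f = of_real (1 - P w) * cm_integral l (S (\<tau> w)) f + (\<Sum>k<4. of_real (\<rho> k w) * cm_integral l (\<nu> k) f)"
    if w: "norm w \<le> r0" for w
  proof -
    have Sw: "S (\<tau> w) \<in> nonneg_measures l" using S(2)[OF small(2)[OF w]] by (simp add: admissible_iff)
    have P1: "0 \<le> 1 - P w" using small(1)[OF w] by simp
    note sm = cm_integral_sum[of "{..<4::nat}" \<nu> l "\<lambda>k. \<rho> k w", OF _ \<nu>' \<rho>(1) l]
    have sn: "(\<lambda>A. \<Sum>k<4. complex_of_real (\<rho> k w) * \<nu> k A) \<in> nonneg_measures l"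
      using sm(1)[of "\<lambda>_. 0"] by simp
    have Nn: "N w \<in> nonneg_measures l" unfolding N_def by (rule nonneg_mixture[OF Sw sn P1]) simp
    have "Re (N w {0..l}) = (1 - P w) * Re (S (\<tau> w) {0..l}) + (\<Sum>k<4. \<rho> k w * Re (\<nu> k {0..l}))" by (simp add: N_def)
    also have "\<dots> \<le> (1 - P w) * m + (\<Sum>k<4. \<rho> k w * m)"
      using \<nu> S(2)[OF small(2)[OF w]] P1 \<rho>(1) by (intro add_mono mult_left_mono sum_mono) (auto simp: admissible_iff)
    also have "\<dots> = m" unfolding sum_distrib_right[symmetric] P_def[symmetric] by (simp add: algebra_simps)
    finally show "N w \<in> admissible l m" using Nn by (simp add: admissible_iff)
    fix f :: "real \<Rightarrow> complex" assume f: "continuous_on {0..l} f"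
    show "cm_integral l (N w) f = of_real (1 - P w) * cm_integral l (S (\<tau> w)) f + (\<Sum>k<4. of_real (\<rho> k w) * cm_integral l (\<nu> k) f)"
      unfolding N_def cm_integral_mixture[OF Sw sn P1 zero_le_one l f] sm(2)[OF _ f, simplified] by simp
  qed
  define L where "L = (4 * K + 8 * m) / \<eta>"
  have L: "0 \<le> L" using K m \<eta> by (simp add: L_def)
  have cm_le: "norm (cm_integral l \<mu> f) \<le> B * m"
    if "\<mu> \<in> admissible l m" "\<And>s. s \<in> {0..l} \<Longrightarrow> norm (f s) \<le> B" for \<mu> f B
  proof -
    interpret string_measure "lib_measure l \<mu>" l by (rule admissible_lib[OF that(1) l])
    have B: "0 \<le> B" using order_trans[OF norm_ge_zero that(2)[of 0]] l by simp
    have "norm (cm_integral l \<mu> f) \<le> B * measure (lib_measure l \<mu>) {0..l}"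
      using that(1) l norm_integral_le[OF that(2)] by (simp add: cm_integral_nonneg admissible_iff)
    also have "\<dots> \<le> B * m" using B admissible_lib(2)[OF that(1) l] by (rule mult_left_mono[rotated])
    finally show ?thesis .
  qed
  have blN: "bl_close l (N w) (N w') (L * norm (w - w'))" if w: "norm w \<le> r0" and w': "norm w' \<le> r0" for w w'
    unfolding bl_close_def
  proof (intro allI impI, elim conjE)
    fix f :: "real \<Rightarrow> complex" and B :: real
    assume fb: "\<forall>s\<in>{0..l}. norm (f s) \<le> B" and fl: "\<forall>s\<in>{0..l}. \<forall>t\<in>{0..l}. norm (f s - f t) \<le> B * \<bar>s - t\<bar>"
    have B: "0 \<le> B" using order_trans[OF norm_ge_zero fb[rule_format, of 0]] l by simp
    have f: "continuous_on {0..l} f"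
      by (rule lipschitz_on_continuous_on[where L=B]) (use fl B in \<open>auto simp: lipschitz_on_def dist_norm dist_real_def\<close>)
    let ?S = "cm_integral l (S (\<tau> w)) f" and ?S' = "cm_integral l (S (\<tau> w')) f"
    have "cm_integral l (N w) f - cm_integral l (N w') f
        = of_real (1 - P w) * (?S - ?S') + of_real (P w' - P w) * ?S' + (\<Sum>k<4. of_real (\<rho> k w - \<rho> k w') * cm_integral l (\<nu> k) f)"
      unfolding J[OF w f] J[OF w' f] by (simp add: algebra_simps sum_subtractf)
    then have "norm (cm_integral l (N w) f - cm_integral l (N w') f)
        \<le> norm (of_real (1 - P w) * (?S - ?S')) + norm (of_real (P w' - P w) * ?S') + norm (\<Sum>k<4. of_real (\<rho> k w - \<rho> k w') * cm_integral l (\<nu> k) f)"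
      by (simp only: norm_add3)
    also have "norm (of_real (1 - P w) * (?S - ?S')) \<le> 1 * ((K * (4 * norm (w - w') / \<eta>)) * B)"
      unfolding norm_mult norm_of_real
    proof (rule mult_mono)
      show "\<bar>1 - P w\<bar> \<le> 1" using P(1)[of w] small(1)[OF w] by simp
      have "norm (?S - ?S') \<le> (K * \<bar>\<tau> w - \<tau> w'\<bar>) * B"
        using bl_closeD[OF K(2)[OF small(2)[OF w] small(2)[OF w']]] fb fl by blast
      also have "\<dots> \<le> (K * (4 * norm (w - w') / \<eta>)) * B" using \<tau>(1) K B by (intro mult_right_mono mult_left_mono) auto
      finally show "norm (?S - ?S') \<le> (K * (4 * norm (w - w') / \<eta>)) * B" .
    qed auto
    also have "norm (of_real (P w' - P w) * ?S') \<le> (4 * norm (w - w') / \<eta>) * (B * m)"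
      unfolding norm_mult norm_of_real using P(3)[of w' w] cm_le[OF S(2)[OF small(2)[OF w']], of f B] fb B m \<eta>
      by (intro mult_mono) (auto simp: norm_minus_commute)
    also have "norm (\<Sum>k<4. of_real (\<rho> k w - \<rho> k w') * cm_integral l (\<nu> k) f) \<le> 4 * ((norm (w - w') / \<eta>) * (B * m))"
    proof (rule order_trans[OF norm_sum sum4])
      fix k
      show "norm (of_real (\<rho> k w - \<rho> k w') * cm_integral l (\<nu> k) f) \<le> (norm (w - w') / \<eta>) * (B * m)"
        unfolding norm_mult norm_of_real using \<rho>(3)[of k w w'] cm_le[OF \<nu>, of f B k] fb B m \<eta>
        by (intro mult_mono) auto
    qed
    finally show "norm (cm_integral l (N w) f - cm_integral l (N w') f) \<le> L * norm (w - w') * B"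
      using \<eta> by (simp add: L_def field_simps)
  qed
  define R where "R = norm \<omega> + 1"
  define C where "C = stab_const l m R"
  define G where "G = growth l m (R\<^sup>2)"
  define B2 where "B2 = G * G + 2 * G * (R\<^sup>2 * G * m)"
  have \<omega>R: "norm \<omega> \<le> R" "0 \<le> R" by (simp_all add: R_def)
  note stab = string_stability[OF _ _ l, where R=R and m=m, folded C_def]
  have C: "0 \<le> C" using stab(3)[OF \<mu>0 \<mu>0 \<omega>R(1) \<omega>R(1), of 0] by (simp add: bl_close_def)
  have G: "0 < G" by (simp add: G_def growth_pos)
  define T where "T = 4 * K / \<eta>"
  have T: "0 \<le> T" using K \<eta> by (simp add: T_def)
  define C3 where "C3 = (C * L) * (C * T) + (C * T) * (C * L) + K * (4 / \<eta>)\<^sup>2 + norm \<omega> * (4 / \<eta> * (2 * (2 * G * (C * (L + T)) * m) + T * B2))"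
  have C3: "0 \<le> C3" using C L T K G m \<eta> by (auto simp: C3_def B2_def intro!: add_nonneg_nonneg mult_nonneg_nonneg)
  \<comment> \<open>Green's identity is applied to \<open>S (\<tau> w)\<close> and \<open>N w\<close>, which are close in total variation;
    the effect of the shift itself is known from \<open>first\<close>.\<close>
  have approx: "norm (string_F l \<omega> (N w) * \<phi> l + \<i> * \<omega> * w) \<le> C3 * (norm w)\<^sup>2" if w: "norm w \<le> r0" for w
  proof -
    let ?S = "S (\<tau> w)"
    define \<phi>w where "\<phi>w = string_phi l \<omega> (N w)"
    define \<phi>S where "\<phi>S = string_phi l \<omega> ?S"
    have Sadm: "?S \<in> admissible l m" by (rule S(2)[OF small(2)[OF w]])
    have S': "?S \<in> nonneg_measures l" and N': "N w \<in> nonneg_measures l" using Sadm N[OF w] by (auto simp: admissible_iff)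
    have blw: "bl_close l (N w) \<mu>0 (L * norm w)" using blN[OF w, of 0] r0 by (simp add: N0)
    have blS: "bl_close l ?S \<mu>0 (T * norm w)"
    proof -
      have b: "bl_close l ?S (S 0) (K * \<bar>\<tau> w - 0\<bar>)" using small(2)[OF w] S(1) by (intro K(2)) auto
      have le: "K * \<bar>\<tau> w - 0\<bar> \<le> T * norm w" using mult_left_mono[OF \<tau>w[of w] K(1)] by (simp add: T_def mult_ac)
      show ?thesis unfolding bl_close_def
      proof (intro allI impI)
        fix f :: "real \<Rightarrow> complex" and B :: real assume h: "(\<forall>s\<in>{0..l}. norm (f s) \<le> B) \<and> (\<forall>s\<in>{0..l}. \<forall>t\<in>{0..l}. norm (f s - f t) \<le> B * \<bar>s - t\<bar>)"
        then have B: "0 \<le> B" using order_trans[OF norm_ge_zero, of "f 0" B] l by simp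
        have "norm (cm_integral l ?S f - cm_integral l \<mu>0 f) \<le> K * \<bar>\<tau> w - 0\<bar> * B"
          using b h unfolding bl_close_def S(3) by blast
        also have "\<dots> \<le> T * norm w * B" using le B by (rule mult_right_mono)
        finally show "norm (cm_integral l ?S f - cm_integral l \<mu>0 f) \<le> T * norm w * B" .
      qed
    qed
    have dw: "norm (\<phi>w s - \<phi> s) \<le> C * L * norm w" if "s \<in> {0..l}" for s
      using stab(1)[OF N[OF w] \<mu>0 \<omega>R(1) \<omega>R(1) blw _ that] L by (simp add: \<phi>w_def \<phi>_def mult.assoc)
    have dS: "norm (\<phi>S s - \<phi> s) \<le> C * T * norm w" if "s \<in> {0..l}" for s
      using stab(1)[OF Sadm \<mu>0 \<omega>R(1) \<omega>R(1) blS _ that] T by (simp add: \<phi>S_def \<phi>_def mult.assoc)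
    have Fw: "norm (string_F l \<omega> (N w)) \<le> C * L * norm w"
      using stab(2)[OF N[OF w] \<mu>0 \<omega>R(1) \<omega>R(1) blw] L \<omega>(1) by (simp add: mult.assoc)
    have FS: "norm (string_F l \<omega> ?S) \<le> C * T * norm w"
      using stab(2)[OF Sadm \<mu>0 \<omega>R(1) \<omega>R(1) blS] T \<omega>(1) by (simp add: mult.assoc)
    have gb: "norm (\<phi> s) \<le> G" "norm (\<phi>S s) \<le> G" if "s \<in> {0..l}" for s
      using string_phi_bounds(1)[OF \<mu>0 l \<omega>R(1) that] string_phi_bounds(1)[OF Sadm l \<omega>R(1) that] by (simp_all add: \<phi>_def \<phi>S_def G_def)
    have cS: "continuous_on {0..l} \<phi>S" and cw: "continuous_on {0..l} \<phi>w" and c0: "continuous_on {0..l} \<phi>"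
      unfolding \<phi>S_def \<phi>w_def \<phi>_def by (rule continuous_on_string_phi[OF S' l] continuous_on_string_phi[OF N' l] continuous_on_string_phi[OF \<mu>0' l])+
    let ?g = "\<lambda>s. \<phi>S s * \<phi>w s" and ?h = "\<lambda>s. (\<phi> s)\<^sup>2"
    have cg: "continuous_on {0..l} ?g" and ch: "continuous_on {0..l} ?h" by (intro continuous_intros cS cw c0)+
    have dg: "norm (?g s - ?h s) \<le> 2 * G * (C * (L + T) * norm w)" if s: "s \<in> {0..l}" for s
    proof -
      have "?g s - ?h s = \<phi>S s * (\<phi>w s - \<phi> s) + (\<phi>S s - \<phi> s) * \<phi> s" by (simp add: power2_eq_square algebra_simps)
      then have "norm (?g s - ?h s) \<le> norm (\<phi>S s) * norm (\<phi>w s - \<phi> s) + norm (\<phi>S s - \<phi> s) * norm (\<phi> s)"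
        by (metis norm_triangle_ineq norm_mult)
      also have "\<dots> \<le> G * (C * L * norm w) + (C * T * norm w) * G"
        using gb[OF s] dw[OF s] dS[OF s] G C T by (intro add_mono mult_mono) auto
      also have "\<dots> \<le> 2 * G * (C * (L + T) * norm w)" using G C L T by (simp add: algebra_simps)
      finally show ?thesis .
    qed
    have dint: "norm (cm_integral l \<mu> ?g - cm_integral l \<mu> ?h) \<le> 2 * G * (C * (L + T)) * m * norm w" if \<mu>: "\<mu> \<in> admissible l m" for \<mu>
    proof -
      interpret string_measure "lib_measure l \<mu>" l by (rule admissible_lib[OF \<mu> l])
      have "cm_integral l \<mu> ?g - cm_integral l \<mu> ?h = cm_integral l \<mu> (\<lambda>s. ?g s - ?h s)"
        using \<mu> l integrable_M[OF cg] integrable_M[OF ch] by (simp add: cm_integral_nonneg admissible_iff)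
      then show ?thesis using cm_le[OF \<mu> dg] by (simp add: mult_ac)
    qed
    have dh: "norm (cm_integral l ?S ?h - cm_integral l \<mu>0 ?h) \<le> T * norm w * B2"
    proof (rule bl_closeD[OF blS])
      have B2: "G * G \<le> B2" "2 * G * (R\<^sup>2 * G * m) \<le> B2" using G m by (auto simp: B2_def)
      show "norm (?h s) \<le> B2" if "s \<in> {0..l}" for s
        unfolding power2_eq_square norm_mult using gb(1)[OF that] G B2(1) mult_mono[OF gb(1)[OF that] gb(1)[OF that]] by simp
      fix s t assume s: "s \<in> {0..l}" and t: "t \<in> {0..l}"
      have "norm (?h s - ?h t) = norm (\<phi> s + \<phi> t) * norm (\<phi> s - \<phi> t)"
        by (simp add: power2_eq_square square_diff_square_factored norm_mult)
      also have "\<dots> \<le> (2 * G) * (R\<^sup>2 * G * m * \<bar>s - t\<bar>)"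
        using gb(1)[OF s] gb(1)[OF t] norm_triangle_ineq[of "\<phi> s" "\<phi> t"] string_phi_bounds(2)[OF \<mu>0 l \<omega>R(1) s t] G
        by (intro mult_mono) (auto simp: \<phi>_def G_def)
      also have "\<dots> \<le> B2 * \<bar>s - t\<bar>" using mult_right_mono[OF B2(2), of "\<bar>s - t\<bar>"] by (simp add: mult.assoc)
      finally show "norm (?h s - ?h t) \<le> B2 * \<bar>s - t\<bar>" .
    qed
    have diff: "string_F l \<omega> (N w) * \<phi>S l - string_F l \<omega> ?S * \<phi>w l
        = - \<i> * \<omega> * (cm_integral l (N w) ?g - cm_integral l ?S ?g)"
      unfolding \<phi>S_def \<phi>w_def by (rule string_F_difference[OF S' N' l])
    have Jg: "cm_integral l (N w) ?g - cm_integral l ?S ?g = (\<Sum>k<4. of_real (\<rho> k w) * (cm_integral l (\<nu> k) ?g - cm_integral l ?S ?g))"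
    proof -
      have "of_real (P w) * cm_integral l ?S ?g = (\<Sum>k<4. of_real (\<rho> k w) * cm_integral l ?S ?g)"
        by (simp only: P_def of_real_sum sum_distrib_right)
      then show ?thesis unfolding J[OF w cg] by (simp add: left_diff_distrib right_diff_distrib sum_subtractf)
    qed
    have lin: "of_real (\<tau> w) * v + (\<Sum>k<4. of_real (\<rho> k w) * (cm_integral l (\<nu> k) ?h - cm_integral l \<mu>0 ?h)) = w"
    proof -
      have "of_real (\<tau> w) * v + (\<Sum>k<4. of_real (\<rho> k w) * (cm_integral l (\<nu> k) ?h - cm_integral l \<mu>0 ?h))
          = (\<Sum>k<4. of_real (\<rho> k w) * (cm_integral l (\<nu> k) ?h - cm_integral l \<mu>0 ?h + of_real (x k) * v))"
        unfolding \<tau>_def of_real_sum sum_distrib_right sum.distrib[symmetric]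
        by (intro sum.cong refl) (simp add: algebra_simps)
      also have "\<dots> = (\<Sum>k<4. complex_of_real (max 0 (w \<bullet> \<i> ^ k)) * \<i> ^ k)"
        unfolding dir using \<eta> by (intro sum.cong) (auto simp: \<rho>_def)
      finally show ?thesis unfolding quadrant_sum .
    qed
    define Q where "Q = (\<Sum>k<4. of_real (\<rho> k w) * ((cm_integral l (\<nu> k) ?g - cm_integral l (\<nu> k) ?h) - (cm_integral l ?S ?g - cm_integral l ?S ?h) - (cm_integral l ?S ?h - cm_integral l \<mu>0 ?h)))"
    have Q: "(\<Sum>k<4. of_real (\<rho> k w) * (cm_integral l (\<nu> k) ?g - cm_integral l ?S ?g)) = Q + (w - of_real (\<tau> w) * v)"
    proof -
      have "(\<Sum>k<4. of_real (\<rho> k w) * (cm_integral l (\<nu> k) ?g - cm_integral l ?S ?g))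
          = Q + (\<Sum>k<4. of_real (\<rho> k w) * (cm_integral l (\<nu> k) ?h - cm_integral l \<mu>0 ?h))"
        unfolding Q_def sum.distrib[symmetric] by (intro sum.cong refl) (simp add: algebra_simps)
      then show ?thesis by (subst (2) lin[symmetric]) simp
    qed
    have split: "string_F l \<omega> (N w) * \<phi> l + \<i> * \<omega> * w
        = string_F l \<omega> (N w) * (\<phi> l - \<phi>S l) + string_F l \<omega> ?S * (\<phi>w l - \<phi> l) + (string_F l \<omega> ?S * \<phi> l + \<i> * \<omega> * of_real (\<tau> w) * v) - \<i> * \<omega> * Q"
    proof -
      have "string_F l \<omega> (N w) * \<phi>S l = string_F l \<omega> ?S * \<phi>w l - \<i> * \<omega> * (Q + (w - of_real (\<tau> w) * v))"
        using diff unfolding Jg Q by (simp add: algebra_simps)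
      then show ?thesis by (simp add: algebra_simps)
    qed
    have 1: "norm (string_F l \<omega> (N w) * (\<phi> l - \<phi>S l)) \<le> (C * L * norm w) * (C * T * norm w)"
      unfolding norm_mult using Fw dS[of l] l C L by (intro mult_mono) (auto simp: norm_minus_commute)
    have 2: "norm (string_F l \<omega> ?S * (\<phi>w l - \<phi> l)) \<le> (C * T * norm w) * (C * L * norm w)"
      unfolding norm_mult using FS dw[of l] l C T by (intro mult_mono) auto
    have 3: "norm (string_F l \<omega> ?S * \<phi> l + \<i> * \<omega> * of_real (\<tau> w) * v) \<le> K * (4 * norm w / \<eta>)\<^sup>2"
    proof -
      have "(\<tau> w)\<^sup>2 \<le> (4 * norm w / \<eta>)\<^sup>2" using \<tau>w[of w] by (rule power2_le_iff_abs_le[THEN iffD2, rotated]) (use \<eta> in auto)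
      then show ?thesis using first[OF small(2)[OF w]] mult_left_mono[of "(\<tau> w)\<^sup>2" _ K] K(1) by fastforce
    qed
    have 4: "norm (\<i> * \<omega> * Q) \<le> norm \<omega> * (4 * ((norm w / \<eta>) * ((2 * (2 * G * (C * (L + T)) * m) + T * B2) * norm w)))"
    proof -
      have "norm Q \<le> 4 * ((norm w / \<eta>) * ((2 * (2 * G * (C * (L + T)) * m) + T * B2) * norm w))"
        unfolding Q_def
      proof (rule order_trans[OF norm_sum sum4])
        fix k
        let ?a = "cm_integral l (\<nu> k) ?g - cm_integral l (\<nu> k) ?h" and ?b = "cm_integral l ?S ?g - cm_integral l ?S ?h" and ?c = "cm_integral l ?S ?h - cm_integral l \<mu>0 ?h"
        have "norm (?a - ?b - ?c) \<le> norm ?a + norm ?b + norm ?c"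
          using norm_triangle_ineq4[of ?a ?b] norm_triangle_ineq4[of "?a - ?b" ?c] by linarith
        also have "\<dots> \<le> (2 * (2 * G * (C * (L + T)) * m) + T * B2) * norm w"
          using dint[OF \<nu>[of k]] dint[OF Sadm] dh by (simp add: algebra_simps)
        finally show "norm (of_real (\<rho> k w) * (?a - ?b - ?c)) \<le> (norm w / \<eta>) * ((2 * (2 * G * (C * (L + T)) * m) + T * B2) * norm w)"
          unfolding norm_mult norm_of_real using \<rho>(1,2)[of k w] \<eta> by (intro mult_mono) auto
      qed
      then show ?thesis unfolding norm_mult norm_ii mult_1 by (rule mult_left_mono) simp
    qed
    have "norm (string_F l \<omega> (N w) * \<phi> l + \<i> * \<omega> * w) \<le> norm (string_F l \<omega> (N w) * (\<phi> l - \<phi>S l)) + norm (string_F l \<omega> ?S * (\<phi>w l - \<phi> l))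
       + norm (string_F l \<omega> ?S * \<phi> l + \<i> * \<omega> * of_real (\<tau> w) * v) + norm (\<i> * \<omega> * Q)"
      unfolding split by (intro order_trans[OF norm_triangle_ineq4] add_mono order_trans[OF norm_triangle_ineq] order_refl)
    also have "\<dots> \<le> C3 * (norm w)\<^sup>2"
      using 1 2 3 4 \<eta> by (simp add: C3_def power2_eq_square algebra_simps)
    finally show ?thesis .
  qed
  have contJ: "isCont (\<lambda>w. cm_integral l (N w) f) 0" if f: "continuous_on {0..l} f" for f
  proof -
    have c\<rho>: "isCont (\<lambda>w. \<rho> k w) 0" for k unfolding \<rho>_def using \<eta> by (intro continuous_intros) auto
    have cP: "isCont P 0" and c\<tau>: "isCont \<tau> 0" unfolding P_def \<tau>_def by (intro continuous_intros c\<rho>)+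
    have "isCont (\<lambda>w. cm_integral l (S (\<tau> w)) f) 0"
      by (rule isCont_o2[OF c\<tau>]) (simp add: \<tau> cont[OF f])
    then have c: "isCont (\<lambda>w. of_real (1 - P w) * cm_integral l (S (\<tau> w)) f + (\<Sum>k<4. of_real (\<rho> k w) * cm_integral l (\<nu> k) f)) 0"
      by (intro continuous_intros c\<rho> cP)
    have "\<forall>\<^sub>F w in nhds 0. norm (w :: complex) \<le> r0"
      using r0 unfolding eventually_nhds_metric by (auto intro!: exI[of _ r0])
    then have "\<forall>\<^sub>F w in nhds 0. cm_integral l (N w) f = of_real (1 - P w) * cm_integral l (S (\<tau> w)) f + (\<Sum>k<4. of_real (\<rho> k w) * cm_integral l (\<nu> k) f)"
      by eventually_elim (rule J[OF _ f])
    from isCont_cong[OF this] c show ?thesis by blast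
  qed
  obtain r1 where r1: "0 < r1" "\<And>w. norm w \<le> r1 \<Longrightarrow> N w \<in> W"
    using weak_star_eventually[of l W N r0, OF W(1) _ r0 _ contJ] W(2) N N0 by (auto simp: admissible_def)
  define a where "a = norm \<omega>"
  have a: "0 < a" using \<omega> by (simp add: a_def)
  define r where "r = min (min r0 r1) (a / (2 * (C3 + 1)))"
  have r: "0 < r" "r \<le> r0" "r \<le> r1" "C3 * r \<le> a / 2"
  proof -
    show r0': "0 < r" "r \<le> r0" "r \<le> r1" using r0 r1 a C3 by (auto simp: r_def)
    have "r \<le> a / (2 * (C3 + 1))" by (simp add: r_def)
    then have "(C3 + 1) * r \<le> a / 2" using C3 by (simp add: field_simps)
    then show "C3 * r \<le> a / 2" using r0' by (simp add: algebra_simps)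
  qed
  define \<delta> where "\<delta> = min 1 (r * a / (2 * (C * norm (\<phi> l) + 1)))"
  have den: "0 < 2 * (C * norm (\<phi> l) + 1)" using C by (simp add: add_nonneg_pos)
  have \<delta>: "0 < \<delta>" "\<delta> \<le> 1" "C * \<delta> * norm (\<phi> l) \<le> r * a / 2"
  proof -
    show d: "0 < \<delta>" "\<delta> \<le> 1" using r a den by (auto simp: \<delta>_def)
    have "\<delta> \<le> r * a / (2 * (C * norm (\<phi> l) + 1))" by (simp add: \<delta>_def)
    then have "\<delta> * (2 * (C * norm (\<phi> l) + 1)) \<le> r * a" using den by (simp add: pos_le_divide_eq)
    then show "C * \<delta> * norm (\<phi> l) \<le> r * a / 2" using d by (simp add: algebra_simps)
  qed
  have "ball \<omega> \<delta> \<subseteq> quasi_eigenvalues_of l (admissible l m \<inter> W)"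
  proof
    fix z assume "z \<in> ball \<omega> \<delta>"
    then have z: "norm (z - \<omega>) < \<delta>" by (simp add: dist_norm norm_minus_commute)
    then have zR: "norm z \<le> R" using \<delta>(2) norm_triangle_ineq2[of z \<omega>] by (simp add: R_def)
    have F_lip: "norm (string_F l z (N w) - string_F l z' (N w')) \<le> C * (norm (z - z') + L * norm (w - w'))"
      if "norm w \<le> r0" "norm w' \<le> r0" "norm z' \<le> R" for w w' z'
      using stab(2)[OF N[OF that(1)] N[OF that(2)] zR that(3) blN[OF that(1,2)]] L by simp
    define H where "H w = w - string_F l z (N w) * \<phi> l * (\<i> / \<omega>)" for w
    \<comment> \<open>A fixed point of \<open>H\<close> is a zero of \<open>F(z; N w)\<close>.\<close>
    have contH: "continuous_on (cball 0 r) H"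
    proof -
      have "continuous_on (cball 0 r) (\<lambda>w. string_F l z (N w))"
      proof (rule lipschitz_on_continuous_on[where L="C * L"], rule lipschitz_onI)
        fix w w' :: complex assume "w \<in> cball 0 r" "w' \<in> cball 0 r"
        then show "dist (string_F l z (N w)) (string_F l z (N w')) \<le> C * L * dist w w'"
          using F_lip[of w w' z] zR r by (simp add: dist_norm mult.assoc)
      qed (use C L in auto)
      then show ?thesis unfolding H_def by (intro continuous_intros)
    qed
    have unit: "norm (X * (\<i> / \<omega>)) = norm X / a" for X by (simp add: norm_mult norm_divide a_def)
    have mapsH: "H \<in> cball 0 r \<rightarrow> cball 0 r"
    proof
        fix w :: complex assume "w \<in> cball 0 r"
        then have w: "norm w \<le> r" by simp
        then have w0: "norm w \<le> r0" using r by simp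
        have "H w = - ((string_F l \<omega> (N w) * \<phi> l + \<i> * \<omega> * w) * (\<i> / \<omega>)) - (string_F l z (N w) - string_F l \<omega> (N w)) * \<phi> l * (\<i> / \<omega>)"
          using \<omega>(2) by (simp add: H_def field_simps)
        then have "norm (H w) \<le> norm ((string_F l \<omega> (N w) * \<phi> l + \<i> * \<omega> * w) * (\<i> / \<omega>)) + norm ((string_F l z (N w) - string_F l \<omega> (N w)) * \<phi> l * (\<i> / \<omega>))"
          by (metis norm_triangle_ineq4 norm_minus_cancel)
        also have "norm ((string_F l \<omega> (N w) * \<phi> l + \<i> * \<omega> * w) * (\<i> / \<omega>)) \<le> r / 2"
        proof -
          have "norm (string_F l \<omega> (N w) * \<phi> l + \<i> * \<omega> * w) \<le> C3 * (r * r)"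
            using approx[OF w0] mult_left_mono[OF mult_mono[OF w w] C3] r(1) by (simp add: power2_eq_square)
          also have "\<dots> \<le> a / 2 * r" using mult_right_mono[OF r(4), of r] r(1) by (simp add: mult.assoc)
          finally show ?thesis using a unfolding unit by (simp add: pos_divide_le_eq mult_ac)
        qed
        also have "norm ((string_F l z (N w) - string_F l \<omega> (N w)) * \<phi> l * (\<i> / \<omega>)) \<le> r / 2"
        proof -
          have "norm (string_F l z (N w) - string_F l \<omega> (N w)) \<le> C * \<delta>"
            using F_lip[OF w0 w0 \<omega>R(1)] mult_left_mono[OF less_imp_le[OF z] C] by simp
          then have "norm (string_F l z (N w) - string_F l \<omega> (N w)) * norm (\<phi> l) \<le> r * a / 2"
            using \<delta>(3) mult_right_mono[of _ "C * \<delta>" "norm (\<phi> l)"] by fastforce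
          then have "norm ((string_F l z (N w) - string_F l \<omega> (N w)) * \<phi> l) \<le> r * a / 2" by (simp add: norm_mult)
          then show ?thesis using a unfolding unit by (simp add: pos_divide_le_eq mult_ac)
        qed
        finally show "H w \<in> cball 0 r" by simp
    qed
    obtain w where w: "norm w \<le> r" "H w = w"
      using brouwer_ball[OF r(1) contH mapsH] by (metis mem_cball_0)
    then have "string_F l z (N w) = 0" using \<phi>l \<omega>(2) by (simp add: H_def)
    moreover have "N w \<in> admissible l m \<inter> W" using N r1(2) w r by simp
    ultimately show "z \<in> quasi_eigenvalues_of l (admissible l m \<inter> W)"
      by (auto simp: quasi_eigenvalues_of_def quasi_eigenvalues_def)
  qed
  then show ?thesis using \<delta>(1) mem_interior by blast
qed

section \<open>Squares on a line and one-sided derivatives\<close>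

lemma inner_eq_Re: "z \<bullet> p = Re (z * cnj p)"
  by (simp add: inner_complex_def)

text \<open>
  For a moving point \<open>u\<close> with velocity \<open>q\<close>: at a point whose square lies on the line and moves along
  it, positive angular momentum forces \<open>c > 0\<close>, and the hyperbola branch curves away from its tangent
  in such a way that linear motion goes strictly inside the region \<open>Re (\<zeta>\<^sup>2 * cnj p) < c\<close>.
\<close>

lemma tangential:
  fixes u q p :: complex
  assumes "norm p = 1" "0 \<le> c" "Re (u\<^sup>2 * cnj p) = c" "Re (u * q * cnj p) = 0" "0 < Im (cnj u * q)"
  shows "0 < c" "Re (q\<^sup>2 * cnj p) < 0"
proof -
  have pp: "p * cnj p = 1" using assms(1) by (simp add: complex_norm_square[symmetric])
  define t r where "t = Im (u * q * cnj p)" and "r = Im (u\<^sup>2 * cnj p)"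
  have t: "u * q * cnj p = \<i> * of_real t" using assms(4) by (simp add: complex_eq_iff t_def)
  have P: "u\<^sup>2 * cnj p = of_real c + \<i> * of_real r" using assms(3) by (simp add: complex_eq_iff r_def)
  have "(u * q * cnj p) * cnj (u\<^sup>2 * cnj p) = (u * cnj u) * (p * cnj p) * (cnj u * q)"
    by (simp add: power2_eq_square algebra_simps)
  also have "\<dots> = of_real ((norm u)\<^sup>2) * (cnj u * q)" by (simp only: pp complex_norm_square[symmetric, of u] mult_1_right)
  finally have "(\<i> * t) * cnj (c + \<i> * r) = of_real ((norm u)\<^sup>2) * (cnj u * q)" unfolding t P .
  from arg_cong[OF this, of Im] have tc: "t * c = (norm u)\<^sup>2 * Im (cnj u * q)" by simp
  have "u \<noteq> 0" using assms(5) by auto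
  then have tc0: "0 < t * c" unfolding tc using assms(5) by simp
  then show c: "0 < c" using assms(2) by (cases "c = 0") auto
  have "(u\<^sup>2 * cnj p) * (q\<^sup>2 * cnj p) = (u * q * cnj p)\<^sup>2" by (simp add: power2_eq_square algebra_simps)
  then have e: "(c + \<i> * r) * (q\<^sup>2 * cnj p) = - of_real (t\<^sup>2)" unfolding P t by (simp add: power_mult_distrib)
  let ?x = "Re (q\<^sup>2 * cnj p)" and ?y = "Im (q\<^sup>2 * cnj p)"
  have "c * ?x - r * ?y = - (t\<^sup>2)" "c * ?y + r * ?x = 0"
    using arg_cong[OF e, of Re] arg_cong[OF e, of Im] by (auto simp: power2_eq_square)
  then have "?x * (c\<^sup>2 + r\<^sup>2) = - (t\<^sup>2) * c" by algebra
  moreover have "0 < t\<^sup>2 * c" using tc0 c by (cases "t = 0") auto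
  moreover have "0 < c\<^sup>2 + r\<^sup>2" using c by (simp add: add_pos_nonneg)
  ultimately show "?x < 0" by (smt (verit) mult_nonneg_nonneg minus_mult_left)
qed

text \<open>
  Here \<open>c + \<i> r\<close> is \<open>u\<^sup>2 * cnj p\<close> and \<open>e + \<i> f\<close> is \<open>v / u\<close>; the hypotheses are those of \<open>chord\<close>.
\<close>

lemma chord_real:
  fixes c e f r :: real
  assumes "0 \<le> c" "0 < f" "c * e - r * f < c" "c = c * (e\<^sup>2 - f\<^sup>2) - 2 * r * e * f"
  shows "e \<le> 0" "r * (e\<^sup>2 - f\<^sup>2) + 2 * c * e * f < r" "c = 0 \<Longrightarrow> 0 < r"
    "c = 0 \<Longrightarrow> r * (e\<^sup>2 - f\<^sup>2) + 2 * c * e * f < 0"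
proof -
  have id: "2 * e * (c * e - r * f) = c * (e\<^sup>2 + f\<^sup>2 + 1)" using assms(4) by algebra
  show e: "e \<le> 0"
  proof (rule ccontr)
    assume "\<not> e \<le> 0"
    then have "2 * e * (c * e - r * f) < 2 * e * c" using assms(3) by simp
    then have "c * ((e - 1)\<^sup>2 + f\<^sup>2) < 0" unfolding id by (simp add: power2_eq_square algebra_simps)
    then show False using assms(1) by (smt (verit) mult_nonneg_nonneg zero_le_power2)
  qed
  show r: "0 < r" if "c = 0" using assms(2,3) that by (simp add: zero_less_mult_iff)
  show "r * (e\<^sup>2 - f\<^sup>2) + 2 * c * e * f < 0" if c: "c = 0"
  proof -
    have "e = 0" using assms(2,4) r c by simp
    then show ?thesis using c r assms(2) by simp
  qed
  show "r * (e\<^sup>2 - f\<^sup>2) + 2 * c * e * f < r"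
  proof (cases "c = 0")
    case True
    then have "e = 0" using assms(2,4) r by simp
    then show ?thesis using True r assms(2) by (simp add: add_pos_pos algebra_simps less_trans[of _ 0])
  next
    case False
    have "e \<noteq> 0" 
    proof
      assume "e = 0"
      then have "c * (1 + f\<^sup>2) = 0" using assms(4) by (simp add: algebra_simps)
      then show False using False by (simp add: add_pos_nonneg power2_eq_square add_nonneg_eq_0_iff)
    qed
    then have "e * f < 0" using e assms(2) by (simp add: mult_neg_pos)
    moreover have "0 < r\<^sup>2 + c\<^sup>2" using False by (simp add: add_nonneg_pos)
    ultimately have "2 * e * f * (r\<^sup>2 + c\<^sup>2) < 0" by (simp add: mult_neg_pos)
    moreover have "c * (r * (e\<^sup>2 - f\<^sup>2) + 2 * c * e * f - r) = 2 * e * f * (r\<^sup>2 + c\<^sup>2)" using assms(4) by algebra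
    ultimately have "c * (r * (e\<^sup>2 - f\<^sup>2) + 2 * c * e * f - r) < 0" by simp
    then have "r * (e\<^sup>2 - f\<^sup>2) + 2 * c * e * f - r < 0" using assms(1) by (smt (verit) mult_nonneg_nonneg)
    then show ?thesis by simp
  qed
qed

lemma rotation_coords:
  fixes u v p :: complex
  assumes "u \<noteq> 0"
  obtains e f where "Re (cnj u * v) = e * (norm u)\<^sup>2" "Im (cnj u * v) = f * (norm u)\<^sup>2"
    "Re (v\<^sup>2 * cnj p) = Re (u\<^sup>2 * cnj p) * (e\<^sup>2 - f\<^sup>2) - 2 * Im (u\<^sup>2 * cnj p) * e * f"
    "Im (v\<^sup>2 * cnj p) = Im (u\<^sup>2 * cnj p) * (e\<^sup>2 - f\<^sup>2) + 2 * Re (u\<^sup>2 * cnj p) * e * f"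
    "Re (u * v * cnj p) = Re (u\<^sup>2 * cnj p) * e - Im (u\<^sup>2 * cnj p) * f"
proof -
  define h where "h = v / u"
  have v: "v = u * h" using assms by (simp add: h_def)
  let ?P = "u\<^sup>2 * cnj p"
  have 1: "cnj u * v = of_real ((norm u)\<^sup>2) * h" unfolding v complex_norm_square by (simp add: algebra_simps)
  have 2: "v\<^sup>2 * cnj p = ?P * h\<^sup>2" "u * v * cnj p = ?P * h" unfolding v by (simp_all add: power2_eq_square algebra_simps)
  show ?thesis
    by (rule that[of "Re h" "Im h"]; (subst 1 | subst 2)) (simp_all add: power2_eq_square algebra_simps)
qed

text \<open>
  Two points of the hyperbola whose midpoint lies strictly between the branches are on different
  branches (for \<open>c = 0\<close>: on different asymptotes), so passing from \<open>u\<close> to \<open>v\<close> counterclockwise is a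
  rotation by at least a right angle.  The square \<open>\<zeta>\<^sup>2\<close> goes around the origin and returns to the line
  below its starting point.
\<close>

lemma chord:
  fixes u v p :: complex
  assumes "0 \<le> c" "Re (u\<^sup>2 * cnj p) = c" "Re (v\<^sup>2 * cnj p) = c" "0 < Im (cnj u * v)"
    "Re (((u + v) / 2)\<^sup>2 * cnj p) < c"
  shows "Re (cnj u * v) \<le> 0" "Im (v\<^sup>2 * cnj p) < Im (u\<^sup>2 * cnj p)" "c = 0 \<Longrightarrow> 0 < Im (u\<^sup>2 * cnj p)"
    "c = 0 \<Longrightarrow> Im (v\<^sup>2 * cnj p) < 0"
proof -
  have u: "u \<noteq> 0" using assms(4) by auto
  obtain e f where ef: "Re (cnj u * v) = e * (norm u)\<^sup>2" "Im (cnj u * v) = f * (norm u)\<^sup>2"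
    "Re (v\<^sup>2 * cnj p) = Re (u\<^sup>2 * cnj p) * (e\<^sup>2 - f\<^sup>2) - 2 * Im (u\<^sup>2 * cnj p) * e * f"
    "Im (v\<^sup>2 * cnj p) = Im (u\<^sup>2 * cnj p) * (e\<^sup>2 - f\<^sup>2) + 2 * Re (u\<^sup>2 * cnj p) * e * f"
    "Re (u * v * cnj p) = Re (u\<^sup>2 * cnj p) * e - Im (u\<^sup>2 * cnj p) * f"
    using rotation_coords[OF u] by blast
  have n: "0 < (norm u)\<^sup>2" using u by simp
  have f: "0 < f" using assms(4) n unfolding ef by (simp add: zero_less_mult_iff)
  have "((u + v) / 2)\<^sup>2 * cnj p = (u\<^sup>2 * cnj p + v\<^sup>2 * cnj p + 2 * (u * v * cnj p)) / 4"
    by (simp add: power2_eq_square field_simps)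
  moreover have "Re ((a + b + 2 * d) / 4) = (Re a + Re b + 2 * Re d) / 4" for a b d :: complex by simp
  ultimately have "Re (((u + v) / 2)\<^sup>2 * cnj p) = (c + c + 2 * Re (u * v * cnj p)) / 4"
    by (simp only: assms(2,3))
  then have X: "c * e - Im (u\<^sup>2 * cnj p) * f < c" using assms(5) ef(5) unfolding assms(2) by simp
  note cr = chord_real[OF assms(1) f X ef(3)[unfolded assms(2,3)]]
  show "Re (cnj u * v) \<le> 0" unfolding ef using cr(1) n by (simp add: mult_nonpos_nonneg)
  show "Im (v\<^sup>2 * cnj p) < Im (u\<^sup>2 * cnj p)" unfolding ef(4) assms(2) by (rule cr(2))
  show "c = 0 \<Longrightarrow> 0 < Im (u\<^sup>2 * cnj p)" by (rule cr(3))
  show "c = 0 \<Longrightarrow> Im (v\<^sup>2 * cnj p) < 0" unfolding ef(4) assms(2) by (rule cr(4))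
qed

text \<open>
  In contrast to \<open>chord\<close>, a rotation by less than a right angle stays on the branch, and the square
  moves up the line.
\<close>

lemma rotate_forward:
  fixes u v p :: complex
  assumes "0 < c" "Re (u\<^sup>2 * cnj p) = c" "Re (v\<^sup>2 * cnj p) = c" "0 < Im (cnj u * v)" "0 < Re (cnj u * v)"
  shows "Im (u\<^sup>2 * cnj p) < Im (v\<^sup>2 * cnj p)"
proof -
  have u: "u \<noteq> 0" using assms(4) by auto
  obtain e f where ef: "Re (cnj u * v) = e * (norm u)\<^sup>2" "Im (cnj u * v) = f * (norm u)\<^sup>2"
    "Re (v\<^sup>2 * cnj p) = Re (u\<^sup>2 * cnj p) * (e\<^sup>2 - f\<^sup>2) - 2 * Im (u\<^sup>2 * cnj p) * e * f"
    "Im (v\<^sup>2 * cnj p) = Im (u\<^sup>2 * cnj p) * (e\<^sup>2 - f\<^sup>2) + 2 * Re (u\<^sup>2 * cnj p) * e * f"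
    using rotation_coords[OF u] by metis
  have n: "0 < (norm u)\<^sup>2" using u by simp
  have f: "0 < f" "0 < e" using assms(4,5) n unfolding ef by (simp_all add: zero_less_mult_iff)
  define r where "r = Im (u\<^sup>2 * cnj p)"
  have c: "c = c * (e\<^sup>2 - f\<^sup>2) - 2 * r * e * f" using ef(3) unfolding assms(2,3) r_def .
  have "c * (r * (e\<^sup>2 - f\<^sup>2) + 2 * c * e * f - r) = 2 * e * f * (r\<^sup>2 + c\<^sup>2)" using c by algebra
  moreover have "0 < 2 * e * f * (r\<^sup>2 + c\<^sup>2)" using f assms(1) by (simp add: add_nonneg_pos)
  ultimately have "0 < r * (e\<^sup>2 - f\<^sup>2) + 2 * c * e * f - r" using assms(1) by (metis zero_less_mult_pos)
  then show ?thesis unfolding ef(4) assms(2) r_def by simp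
qed

context string_measure begin

lemma measure_split:
  assumes "0 \<le> x" "x \<le> y" "y \<le> l"
  shows "measure M {0..y} = measure M {0..x} + measure M {x<..y}"
proof -
  have "{0..y} = {0..x} \<union> {x<..y}" using assms by auto
  moreover have "{0..x} \<in> sets M" "{x<..y} \<in> sets M" using assms by (auto intro!: borel_in_sets)
  ultimately show ?thesis using finite_measure_Union[of "{0..x}" "{x<..y}"] by (auto simp: disjoint_iff)
qed

lemma null_AE:
  assumes "A \<in> sets M" "measure M A = 0" shows "AE s in M. s \<notin> A"
  using assms by (intro AE_not_in) (auto simp: null_sets_def emeasure_eq_measure)

lemma measure_right_small:
  assumes x: "0 \<le> x" "x < l" and e: "0 < \<epsilon>"
  obtains d where "0 < d" "x + d \<le> l" "measure M {x<..<x + d} < \<epsilon>"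
proof -
  define D where "D n = (l - x) / real (Suc n)" for n
  have D: "0 < D n" "D n \<le> l - x" for n
    using x divide_left_mono[of 1 "real (Suc n)" "l - x"] by (auto simp: D_def)
  have Dmono: "D m \<le> D n" if "n \<le> m" for n m
    using that x unfolding D_def by (intro divide_left_mono) auto
  have D0: "D \<longlonglongrightarrow> 0" unfolding D_def by (rule lim_const_over_n[THEN LIMSEQ_Suc])
  have "(\<lambda>n. measure M {x<..<x + D n}) \<longlonglongrightarrow> measure M (\<Inter>n. {x<..<x + D n})"
  proof (rule finite_Lim_measure_decseq)
    show "range (\<lambda>n. {x<..<x + D n}) \<subseteq> sets M" using x D(2) by (auto intro!: borel_in_sets) (smt (verit) D(2))
    show "decseq (\<lambda>n. {x<..<x + D n})" using Dmono by (auto simp: decseq_def) (smt (verit) Dmono)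
  qed
  moreover have "(\<Inter>n. {x<..<x + D n}) = {}"
  proof (rule ccontr)
    assume "(\<Inter>n. {x<..<x + D n}) \<noteq> {}"
    then obtain y where "y \<in> (\<Inter>n. {x<..<x + D n})" by blast
    then have y: "\<And>n. x < y \<and> y < x + D n" by auto
    then have "\<forall>\<^sub>F n in sequentially. D n < y - x" using order_tendstoD(2)[OF D0, of "y - x"] y by simp
    then obtain n where "D n < y - x" using eventually_happens'[OF sequentially_bot] by blast
    then show False using y[of n] by simp
  qed
  ultimately have "(\<lambda>n. measure M {x<..<x + D n}) \<longlonglongrightarrow> 0" by simp
  then have "\<forall>\<^sub>F n in sequentially. measure M {x<..<x + D n} < \<epsilon>" using e by (rule order_tendstoD(2))
  then obtain n where "measure M {x<..<x + D n} < \<epsilon>" using eventually_happens'[OF sequentially_bot] by blast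
  then show ?thesis using that[of "D n"] D[of n] by simp
qed

lemma string_eq_right_derivative:
  assumes f: "string_eq M l \<kappa> f" and x: "0 \<le> x" "x < l"
  shows "(f has_vector_derivative (- \<kappa> * integral_upto M f x)) (at x within {x..l})"
proof -
  have c: "continuous_on {0..l} f" using f by (simp add: string_eq_def)
  have b: "norm (f s) \<le> growth l (measure M {0..l}) (norm \<kappa>)" if "s \<in> {0..l}" for s
    by (rule string_eq_bound[OF f order_refl order_refl that])
  define B where "B = norm \<kappa> * growth l (measure M {0..l}) (norm \<kappa>)"
  have B: "0 \<le> B" using growth_pos[of l "measure M {0..l}" "norm \<kappa>"] by (simp add: B_def)
  show ?thesis unfolding has_vector_derivative_def
  \<comment> \<open>The error is governed by the mass of \<open>{x<..<y}\<close>, which tends to \<open>0\<close> even if there is an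
    atom at \<open>x\<close>.\<close>
  proof (rule has_derivativeI_sandwich[where e="l - x" and H="\<lambda>y. B * measure M {x<..<y}"])
    show "0 < l - x" using x by simp
    show "bounded_linear (\<lambda>h. h *\<^sub>R (- \<kappa> * integral_upto M f x))" by (rule bounded_linear_scaleR_left)
    fix y assume y: "y \<in> {x..l}" "y \<noteq> x" "dist y x < l - x"
    have i: "{x<..<y} \<in> sets M" using x y by (intro borel_in_sets) auto
    have "norm (\<integral>s. indicator {x<..<y} s * (of_real (y - s) * f s) \<partial>M)
        \<le> (\<integral>s. norm (indicator {x<..<y} s * (of_real (y - s) * f s)) \<partial>M)" by (rule integral_norm_bound)
    also have "\<dots> \<le> (\<integral>s. ((y - x) * growth l (measure M {0..l}) (norm \<kappa>)) * indicator {x<..<y} s \<partial>M)"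
    proof (rule integral_mono)
      have "continuous_on {0..l} (\<lambda>s. of_real (y - s) * f s)" by (intro continuous_intros c)
      then show "integrable M (\<lambda>s. norm (indicator {x<..<y} s * (of_real (y - s) * f s)))"
        by (intro integrable_norm integrable_M_indicator) auto
      show "integrable M (\<lambda>s. ((y - x) * growth l (measure M {0..l}) (norm \<kappa>)) * indicator {x<..<y} s)"
        using i by (intro integrable_mult_right integrable_real_indicator) (auto simp: emeasure_eq_measure)
      fix s assume s: "s \<in> space M"
      show "norm (indicator {x<..<y} s * (of_real (y - s) * f s)) \<le> ((y - x) * growth l (measure M {0..l}) (norm \<kappa>)) * indicator {x<..<y} s"
        using b[of s] s y x by (auto simp: indicator_def norm_mult space_M simp flip: of_real_diff intro!: mult_mono)
    qed
    also have "\<dots> = (y - x) * growth l (measure M {0..l}) (norm \<kappa>) * measure M {x<..<y}"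
      using i sets.sets_into_space[OF i] by (simp add: Int_absorb2)
    finally have I: "norm (\<integral>s. indicator {x<..<y} s * (of_real (y - s) * f s) \<partial>M) \<le> (y - x) * growth l (measure M {0..l}) (norm \<kappa>) * measure M {x<..<y}" .
    have "f y - f x - (y - x) *\<^sub>R (- \<kappa> * integral_upto M f x) = - \<kappa> * (\<integral>s. indicator {x<..<y} s * (of_real (y - s) * f s) \<partial>M)"
      using string_eq_propagate_right[OF f x(1), of y] y by (simp add: scaleR_conv_of_real algebra_simps)
    then have "norm (f y - f x - (y - x) *\<^sub>R (- \<kappa> * integral_upto M f x)) \<le> norm \<kappa> * ((y - x) * growth l (measure M {0..l}) (norm \<kappa>) * measure M {x<..<y})"
      using mult_left_mono[OF I, of "norm \<kappa>"] by (simp add: norm_mult)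
    then show "norm (f y - f x - (y - x) *\<^sub>R (- \<kappa> * integral_upto M f x)) / norm (y - x) \<le> B * measure M {x<..<y}"
      using y x by (simp add: B_def field_simps)
  next
    show "((\<lambda>y. B * measure M {x<..<y}) \<longlongrightarrow> 0) (at x within {x..l})"
    proof (rule tendsto_mult_right_zero, rule tendstoI)
      fix e :: real assume "0 < e"
      then obtain d where d: "0 < d" "x + d \<le> l" "measure M {x<..<x + d} < e" by (rule measure_right_small[OF x])
      have "dist (measure M {x<..<y}) 0 < e" if "y \<in> {x..l}" "dist y x < d" for y
      proof -
        have "measure M {x<..<y} \<le> measure M {x<..<x + d}"
          using that d x by (intro finite_measure_mono borel_in_sets) (auto simp: dist_real_def)
        then show ?thesis using d(3) by simp
      qed
      then show "\<forall>\<^sub>F y in at x within {x..l}. dist (measure M {x<..<y}) 0 < e"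
        using d(1) unfolding eventually_at by (intro exI[of _ d]) auto
    qed
  qed
qed

end

section \<open>Rotation of a resonant mode\<close>

locale resonance = string_measure M l for M l +
  fixes \<omega> :: complex and \<phi> :: "real \<Rightarrow> complex"
  assumes phi_eq: "string_eq M l (\<omega>\<^sup>2) \<phi>"
    and outgoing: "\<phi> l = \<i> * \<omega> * (\<integral>s. \<phi> s \<partial>M)"
    and Re_pos: "0 < Re \<omega>"
begin

lemma cont_phi: "continuous_on {0..l} \<phi>"
  using phi_eq by (simp add: string_eq_def)

definition q :: "real \<Rightarrow> complex" where
  "q x = - (\<omega>\<^sup>2) * integral_upto M \<phi> x"

definition energy :: "real \<Rightarrow> real" where
  "energy x = (\<integral>s. indicator {0..x} s * (norm (\<phi> s))\<^sup>2 \<partial>M)"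

lemma omega_nonzero: "\<omega> \<noteq> 0" using Re_pos by auto

lemma phi_start: "\<phi> 0 = 1"
proof -
  have "(\<integral>s. of_real (max 0 (0 - s)) * \<phi> s \<partial>M) = (\<integral>s. 0 \<partial>M)"
    by (intro Bochner_Integration.integral_cong) (auto simp: space_M)
  then show ?thesis using phi_eq l_pos by (simp add: string_eq_def)
qed

lemma q_end: "q l = \<i> * \<omega> * \<phi> l"
proof -
  have "\<i> * \<omega> * (\<i> * \<omega> * X) = (\<i> * \<i>) * \<omega>\<^sup>2 * X" for X by (simp only: power2_eq_square mult_ac)
  then show ?thesis by (simp add: q_def integral_upto_full outgoing)
qed

text \<open>
  If the value at \<open>l\<close> vanishes, so does the outgoing derivative, and the solution vanishes
  identically when it is continued from \<open>l\<close> to the left.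
\<close>

lemma phi_end_nonzero: "\<phi> l \<noteq> 0"
proof
  assume 0: "\<phi> l = 0"
  have I: "integral_upto M \<phi> l = 0" using 0 outgoing omega_nonzero by (simp add: integral_upto_full)
  define J where "J = integral_upto M (\<lambda>s. of_real s * \<phi> s) l"
  have J: "1 + \<omega>\<^sup>2 * J = 0" using string_eq_at_end[OF phi_eq, of l] 0 I l_pos by (simp add: J_def)
  have "norm (\<phi> 0) \<le> growth l (measure M {0..l}) (norm (\<omega>\<^sup>2)) * 0"
  proof (rule volterra_bound[where \<sigma>="-1"])
    fix x assume x: "x \<in> {0..l}"
    have "(\<integral>s. of_real (max 0 (x - s)) * \<phi> s \<partial>M) = (\<integral>s. of_real x * \<phi> s - of_real s * \<phi> s + of_real (max 0 (-1 * (x - s))) * \<phi> s \<partial>M)"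
      by (intro Bochner_Integration.integral_cong) (auto simp: max_def algebra_simps)
    also have "\<dots> = of_real x * (\<integral>s. \<phi> s \<partial>M) - (\<integral>s. of_real s * \<phi> s \<partial>M) + (\<integral>s. of_real (max 0 (-1 * (x - s))) * \<phi> s \<partial>M)"
      using integrable_M[OF cont_phi] integrable_M[of "\<lambda>s. of_real s * \<phi> s"] integrable_kernel[OF cont_phi, of "-1" x]
      by (simp add: cont_phi continuous_intros)
    also have "\<dots> = of_real x * 0 - J + (\<integral>s. of_real (max 0 (-1 * (x - s))) * \<phi> s \<partial>M)"
      using I by (simp only: integral_upto_full J_def)
    finally have K: "(\<integral>s. of_real (max 0 (x - s)) * \<phi> s \<partial>M) = of_real x * 0 - J + (\<integral>s. of_real (max 0 (-1 * (x - s))) * \<phi> s \<partial>M)" .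
    have "\<phi> x = 1 - \<omega>\<^sup>2 * (\<integral>s. of_real (max 0 (x - s)) * \<phi> s \<partial>M)" using phi_eq x by (simp add: string_eq_def)
    also have "\<dots> = (1 + \<omega>\<^sup>2 * J) - \<omega>\<^sup>2 * (\<integral>s. of_real (max 0 (-1 * (x - s))) * \<phi> s \<partial>M)"
      unfolding K by (simp only: ring_distribs) simp
    finally show "norm (\<phi> x) \<le> 0 + norm (\<omega>\<^sup>2) * norm (\<integral>s. of_real (max 0 (-1 * (x - s))) * \<phi> s \<partial>M)"
      unfolding J by (simp add: norm_mult)
  qed (use cont_phi l_pos in auto)
  then show False by (simp add: phi_start)
qed

text \<open>
  The Wronskian of \<open>\<phi>\<close> and its conjugate, which solves the equation with \<open>cnj (\<omega>\<^sup>2)\<close>.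
\<close>

lemma angular_momentum:
  assumes x: "x \<in> {0..l}"
  shows "Im (cnj (\<phi> x) * q x) = - Im (\<omega>\<^sup>2) * energy x"
proof -
  have c: "string_eq M l (cnj (\<omega>\<^sup>2)) (\<lambda>x. cnj (\<phi> x))"
    unfolding string_eq_def
  proof (intro conjI ballI)
    show "continuous_on {0..l} (\<lambda>x. cnj (\<phi> x))" by (intro continuous_intros cont_phi)
    fix x assume "x \<in> {0..l}"
    then have "\<phi> x = 1 - \<omega>\<^sup>2 * (\<integral>s. of_real (max 0 (x - s)) * \<phi> s \<partial>M)" using phi_eq by (simp add: string_eq_def)
    then have "cnj (\<phi> x) = 1 - cnj (\<omega>\<^sup>2) * cnj (\<integral>s. of_real (max 0 (x - s)) * \<phi> s \<partial>M)"
      by (metis complex_cnj_diff complex_cnj_mult complex_cnj_one)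
    also have "cnj (\<integral>s. of_real (max 0 (x - s)) * \<phi> s \<partial>M) = (\<integral>s. of_real (max 0 (x - s)) * cnj (\<phi> s) \<partial>M)"
    proof -
      have "cnj (\<integral>s. of_real (max 0 (x - s)) * \<phi> s \<partial>M) = (\<integral>s. cnj (of_real (max 0 (x - s)) * \<phi> s) \<partial>M)"
        by (rule Bochner_Integration.integral_cnj[symmetric])
      also have "\<dots> = (\<integral>s. of_real (max 0 (x - s)) * cnj (\<phi> s) \<partial>M)"
        by (rule Bochner_Integration.integral_cong[OF refl]) simp
      finally show ?thesis .
    qed
    finally show "cnj (\<phi> x) = 1 - cnj (\<omega>\<^sup>2) * (\<integral>s. of_real (max 0 (x - s)) * cnj (\<phi> s) \<partial>M)" .
  qed
  have E: "integral_upto M (\<lambda>s. \<phi> s * cnj (\<phi> s)) x = of_real (energy x)"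
  proof -
    have "integral_upto M (\<lambda>s. \<phi> s * cnj (\<phi> s)) x = (\<integral>s. complex_of_real (indicator {0..x} s * (norm (\<phi> s))\<^sup>2) \<partial>M)"
      unfolding integral_upto_def
      by (intro Bochner_Integration.integral_cong refl) (simp add: complex_norm_square[symmetric] indicator_def)
    then show ?thesis by (simp only: integral_complex_of_real energy_def)
  qed
  have conj: "integral_upto M (\<lambda>s. cnj (\<phi> s)) x = cnj (integral_upto M \<phi> x)"
  proof -
    have "integral_upto M (\<lambda>s. cnj (\<phi> s)) x = (\<integral>s. cnj (indicator {0..x} s * \<phi> s) \<partial>M)"
      unfolding integral_upto_def
      by (rule Bochner_Integration.integral_cong[OF refl]) (simp add: indicator_def)
    also have "\<dots> = cnj (integral_upto M \<phi> x)" unfolding integral_upto_def by (rule Bochner_Integration.integral_cnj)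
    finally show ?thesis .
  qed
  have "\<phi> x * (cnj (\<omega>\<^sup>2) * cnj (integral_upto M \<phi> x)) - \<omega>\<^sup>2 * integral_upto M \<phi> x * cnj (\<phi> x)
      = (cnj (\<omega>\<^sup>2) - \<omega>\<^sup>2) * of_real (energy x)"
    using wronskian[OF string_measure_axioms string_measure_axioms phi_eq c x]
    unfolding E conj by (simp add: left_diff_distrib)
  then have "cnj (\<phi> x) * q x - cnj (cnj (\<phi> x) * q x) = (cnj (\<omega>\<^sup>2) - \<omega>\<^sup>2) * of_real (energy x)"
    by (simp add: q_def algebra_simps)
  moreover have "Im X = - Im k * E" if "X - cnj X = (cnj k - k) * of_real E" for X k :: complex and E :: real
    using arg_cong[OF that, of Im] by simp
  ultimately show ?thesis by blast
qed

lemma integrable_energy: "integrable M (\<lambda>s. indicator {0..x} s * (norm (\<phi> s))\<^sup>2)"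
proof -
  have "integrable M (\<lambda>s. norm (indicator {0..x} s * (\<phi> s)\<^sup>2))"
    by (intro integrable_norm integrable_M_indicator continuous_intros cont_phi) auto
  then show ?thesis
    by (rule Bochner_Integration.integrable_cong[THEN iffD1, rotated 2]) (auto simp: indicator_def norm_power)
qed

lemma energy_nonneg: "0 \<le> energy x"
  unfolding energy_def by (intro integral_nonneg_AE AE_I2) auto

text \<open>
  The outgoing condition makes the angular momentum at \<open>l\<close> equal to \<open>Re \<omega> * (norm (\<phi> l))\<^sup>2\<close>.
\<close>

lemma energy_end: "0 < - Im (\<omega>\<^sup>2) * energy l"
proof -
  have "cnj (\<phi> l) * q l = \<i> * \<omega> * of_real ((norm (\<phi> l))\<^sup>2)"
    unfolding q_end complex_norm_square[of "\<phi> l"] by (simp add: mult_ac)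
  then have "0 < Im (cnj (\<phi> l) * q l)" using Re_pos phi_end_nonzero by simp
  moreover have "l \<in> {0..l}" using l_pos by simp
  ultimately show ?thesis using angular_momentum by (simp only:)
qed

lemma Im_sq_neg: "Im (\<omega>\<^sup>2) < 0"
  using energy_end energy_nonneg[of l] by (smt (verit) mult_nonneg_nonneg mult_minus_left)

lemma energy_end_pos: "0 < energy l"
  using energy_end energy_nonneg[of l] by (smt (verit) mult_eq_0_iff)

lemma mass_pos: "0 < measure M {0..l}"
proof (rule ccontr)
  assume "\<not> 0 < measure M {0..l}"
  then have "measure M (space M) = 0" by (simp add: space_M zero_less_measure_iff)
  then have "AE s in M. s \<notin> space M" by (intro null_AE) auto
  then have "AE s in M. indicator {0..l} s * (norm (\<phi> s))\<^sup>2 = 0" by (rule AE_mp) (auto intro!: AE_I2)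
  then have "energy l = 0" unfolding energy_def by (rule integral_eq_zero_AE)
  then show False using energy_end_pos by simp
qed

text \<open>
  The left end of the support of \<open>M\<close>.
\<close>

definition a0 :: real where "a0 = Inf {x \<in> {0..l}. 0 < measure M {0..x}}"

lemma a0_range: "a0 \<in> {0..l}"
proof -
  have "l \<in> {x \<in> {0..l}. 0 < measure M {0..x}}" using mass_pos l_pos by simp
  then show ?thesis unfolding a0_def
    by (auto intro!: cInf_greatest cInf_lower bdd_belowI[of _ 0])
qed

lemma measure_upto_mono: "x \<le> y \<Longrightarrow> y \<le> l \<Longrightarrow> measure M {0..x} \<le> measure M {0..y}"
  by (intro finite_measure_mono borel_in_sets) auto

lemma measure_upto_pos:
  assumes "a0 < x" "x \<le> l" shows "0 < measure M {0..x}"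
proof -
  have "l \<in> {x \<in> {0..l}. 0 < measure M {0..x}}" using mass_pos l_pos by simp
  then obtain y where "y \<in> {x \<in> {0..l}. 0 < measure M {0..x}}" "y < x"
    using cInf_lessD[of "{x \<in> {0..l}. 0 < measure M {0..x}}" x] assms(1) unfolding a0_def by blast
  then show ?thesis using measure_upto_mono[of y x] assms by auto
qed

lemma measure_upto_pos_ge:
  assumes "0 \<le> x" "x \<le> l" "0 < measure M {0..x}" shows "a0 \<le> x"
  unfolding a0_def using assms by (intro cInf_lower bdd_belowI[of _ 0]) auto

lemma null_before: "AE s in M. a0 \<le> s"
proof -
  define e where "e n = 1 / real (Suc n)" for n
  have e: "0 < e n" "n \<le> k \<Longrightarrow> e k \<le> e n" for n k
    unfolding e_def by (auto intro!: divide_left_mono)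
  have "measure M {0..<a0} = 0"
  proof -
    have "(\<lambda>n. measure M {0..a0 - e n}) \<longlonglongrightarrow> measure M (\<Union>n. {0..a0 - e n})"
    proof (rule finite_Lim_measure_incseq)
      show "range (\<lambda>n. {0..a0 - e n}) \<subseteq> sets M"
      proof safe
        fix n
        show "{0..a0 - e n} \<in> sets M" using a0_range e(1)[of n] by (intro borel_in_sets) auto
      qed
      show "incseq (\<lambda>n. {0..a0 - e n})"
        by (auto simp: incseq_def intro!: e(2) order_trans[OF _ diff_left_mono])
    qed
    moreover have "(\<Union>n. {0..a0 - e n}) = {0..<a0}"
    proof (intro set_eqI iffI)
      fix x assume "x \<in> (\<Union>n. {0..a0 - e n})"
      then obtain n where n: "0 \<le> x" "x \<le> a0 - e n" by auto
      then show "x \<in> {0..<a0}" using n e(1)[of n] by auto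
    next
      fix x assume x: "x \<in> {0..<a0}"
      then obtain n where "e n < a0 - x" using nat_approx_posE[of "a0 - x"] unfolding e_def by auto
      then have "x \<in> {0..a0 - e n}" using x by auto
      then show "x \<in> (\<Union>n. {0..a0 - e n})" by blast
    qed
    moreover have "measure M {0..a0 - e n} = 0" for n
    proof (rule ccontr)
      assume h: "measure M {0..a0 - e n} \<noteq> 0"
      then have "0 \<le> a0 - e n" by (cases "0 \<le> a0 - e n") auto
      then have "a0 \<le> a0 - e n"
        using h a0_range e(1)[of n] by (intro measure_upto_pos_ge) (auto simp: zero_less_measure_iff)
      then show False using e(1)[of n] by linarith
    qed
    ultimately have "(\<lambda>n::nat. 0) \<longlonglongrightarrow> measure M {0..<a0}" by simp
    then show ?thesis by (simp add: LIMSEQ_const_iff)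
  qed
  then have "AE s in M. s \<notin> {0..<a0}" using a0_range by (intro null_AE borel_in_sets) auto
  then show ?thesis by (rule AE_mp) (auto intro!: AE_I2 simp: space_M)
qed

lemma phi_before: "0 \<le> x \<Longrightarrow> x \<le> a0 \<Longrightarrow> \<phi> x = 1"
proof -
  assume x: "0 \<le> x" "x \<le> a0"
  have "AE s in M. of_real (max 0 (x - s)) * \<phi> s = 0"
    using null_before by eventually_elim (use x in \<open>auto simp: max_def\<close>)
  then have "(\<integral>s. of_real (max 0 (x - s)) * \<phi> s \<partial>M) = 0" by (rule integral_eq_zero_AE)
  then show "\<phi> x = 1" using phi_eq x a0_range by (simp add: string_eq_def)
qed

lemma phi_a0 [simp]: "\<phi> a0 = 1" using a0_range by (intro phi_before) auto

lemma phi_near: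
  assumes "x \<in> {0..l}" "0 < \<epsilon>"
  obtains d where "0 < d" "\<And>y. y \<in> {0..l} \<Longrightarrow> \<bar>y - x\<bar> < d \<Longrightarrow> norm (\<phi> y - \<phi> x) < \<epsilon>"
  using cont_phi assms unfolding continuous_on_iff by (metis dist_norm real_norm_def)

text \<open>
  Near the first mass the solution is close to \<open>1\<close>, so a positive mass has positive energy.
\<close>

lemma energy_pos:
  assumes x: "0 \<le> x" "x \<le> l" "0 < measure M {0..x}"
  shows "0 < energy x"
proof -
  obtain d where d: "0 < d" "\<And>y. y \<in> {0..l} \<Longrightarrow> \<bar>y - a0\<bar> < d \<Longrightarrow> norm (\<phi> y - \<phi> a0) < 1 / 2"
    using phi_near[OF a0_range, of "1/2"] by auto
  have ax: "a0 \<le> x" by (rule measure_upto_pos_ge[OF x])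
  define y where "y = min x (a0 + d / 2)"
  have y: "0 \<le> y" "y \<le> x" "y \<le> a0 + d / 2" "0 < measure M {0..y}"
    using x d ax a0_range measure_upto_pos[of "a0 + d / 2"] by (auto simp: y_def min_def)
  have "(\<integral>s. (1 / 4 :: real) * indicator {0..y} s \<partial>M) \<le> energy x"
    unfolding energy_def
  proof (rule integral_mono)
    show "integrable M (\<lambda>s. (1 / 4 :: real) * indicator {0..y} s)"
      using x y by (intro integrable_mult_right integrable_real_indicator borel_in_sets) (auto simp: emeasure_eq_measure)
    show "integrable M (\<lambda>s. indicator {0..x} s * (norm (\<phi> s))\<^sup>2)" by (rule integrable_energy)
    fix s assume s: "s \<in> space M"
    have "1 / 2 \<le> norm (\<phi> s)" if "s \<le> y"
    proof (cases "s \<le> a0")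
      case True then show ?thesis using phi_before[of s] s by (simp add: space_M)
    next
      case False
      then have "norm (\<phi> s - 1) < 1 / 2" using d(2)[of s] s that y d(1) by (simp add: space_M)
      then show ?thesis using norm_triangle_ineq3[of "\<phi> s" 1] by simp
    qed
    then have "s \<le> y \<Longrightarrow> (1 / 2)\<^sup>2 \<le> (norm (\<phi> s))\<^sup>2" by (intro power_mono) auto
    then show "(1 / 4 :: real) * indicator {0..y} s \<le> indicator {0..x} s * (norm (\<phi> s))\<^sup>2"
      using y by (auto simp: indicator_def power2_eq_square)
  qed
  moreover have "(\<integral>s. (1 / 4 :: real) * indicator {0..y} s \<partial>M) = 1 / 4 * measure M {0..y}"
    using x y by (simp add: space_M Int_absorb2)
  ultimately show ?thesis using y by simp
qed

lemma momentum_pos: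
  assumes "0 \<le> x" "x \<le> l" "0 < measure M {0..x}"
  shows "0 < Im (cnj (\<phi> x) * q x)"
  using angular_momentum[of x] energy_pos[OF assms] Im_sq_neg assms by (simp add: mult_neg_pos)

lemma phi_nonzero:
  assumes "x \<in> {0..l}" shows "\<phi> x \<noteq> 0"
proof (cases "x \<le> a0")
  case True then show ?thesis using phi_before[of x] assms by simp
next
  case False
  then show ?thesis using momentum_pos[of x] measure_upto_pos[of x] assms by auto
qed

lemma phi_gap:
  assumes "0 \<le> x" "x \<le> y" "y \<le> b" "b \<le> l" "measure M {x<..<b} = 0"
  shows "\<phi> y = \<phi> x + of_real (y - x) * q x"
  using string_eq_affine_gap[OF phi_eq assms(1,2) _ assms(5,3,4)] assms by (simp add: q_def)

lemma q_jump:
  assumes "0 \<le> x" "x < y" "y \<le> l" "measure M {x<..<y} = 0"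
  shows "q y = q x - \<omega>\<^sup>2 * of_real (measure M {y}) * \<phi> y"
  using integral_upto_jump[OF cont_phi assms(1) less_imp_le[OF assms(2)] assms(3,4,2)] by (simp add: q_def algebra_simps)

lemma right_deriv_phi: "0 \<le> x \<Longrightarrow> x < l \<Longrightarrow> (\<phi> has_vector_derivative q x) (at x within {x..l})"
  using string_eq_right_derivative[OF phi_eq] by (simp add: q_def)

end

section \<open>The contact set of an extremal mode\<close>

lemma Re_quadratic:
  assumes "z = u - complex_of_real s * v + complex_of_real t * w"
  shows "Re z = Re u - s * Re v + t * Re w"
  using assms by simp

text \<open>
  Here \<open>p\<close> is the outer normal supplied by the first-order condition, and \<open>Re (\<zeta> * cnj p)\<close> is the real
  inner product of \<open>\<zeta>\<close> and \<open>p\<close>.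
\<close>

locale extremal = resonance M l \<omega> \<phi> for M l \<omega> \<phi> +
  fixes p :: complex and c :: real
  assumes norm_p: "norm p = 1" and c_nonneg: "0 \<le> c"
    and g_le: "\<And>x. x \<in> {0..l} \<Longrightarrow> Re ((\<phi> x)\<^sup>2 * cnj p) \<le> c"
    and g_AE: "AE x in M. Re ((\<phi> x)\<^sup>2 * cnj p) = c"
begin

definition Z :: "real set" where
  "Z = {x \<in> {0..l}. Re ((\<phi> x)\<^sup>2 * cnj p) = c}"

lemma cont_g: "continuous_on {0..l} (\<lambda>x. Re ((\<phi> x)\<^sup>2 * cnj p))"
  by (intro continuous_intros cont_phi)

lemma closed_Z: "closed Z"
proof -
  have "Z = {0..l} \<inter> (\<lambda>x. Re ((\<phi> x)\<^sup>2 * cnj p)) -` {c}" by (auto simp: Z_def)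
  then show ?thesis using continuous_closed_preimage[OF cont_g, of "{c}"] by simp
qed

lemma null_off_Z:
  assumes "A \<in> sets borel" "A \<subseteq> {0..l}" "A \<inter> Z = {}" shows "measure M A = 0"
proof -
  have sub: "\<And>s. Re ((\<phi> s)\<^sup>2 * cnj p) = c \<Longrightarrow> s \<notin> A" using assms(2,3) unfolding Z_def by blast
  have "AE s in M. s \<notin> A" using g_AE by eventually_elim (rule sub)
  moreover have "A \<in> sets M" using assms by (intro borel_in_sets)
  moreover have "{s \<in> space M. \<not> s \<notin> A} = A" using assms(2) by (auto simp: space_M)
  ultimately have "emeasure M A = 0" using AE_iff_measurable[of A M "\<lambda>s. s \<notin> A"] by simp
  then show ?thesis by (simp add: measure_def)
qed

lemma atom_in_Z: "x \<in> {0..l} \<Longrightarrow> 0 < measure M {x} \<Longrightarrow> x \<in> Z"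
  using null_off_Z[of "{x}"] by fastforce

lemma a0_in_Z: "a0 \<in> Z"
proof (rule ccontr)
  assume "a0 \<notin> Z"
  then have "a0 \<in> - Z" "open (- Z)" using closed_Z by auto
  then obtain d where d: "0 < d" "ball a0 d \<subseteq> - Z" by (meson open_contains_ball)
  define y where "y = min l (a0 + d / 2)"
  have y: "a0 \<le> y" "y \<le> l" "y < a0 + d" using a0_range d by (auto simp: y_def)
  have pos: "0 < measure M {0..y}"
  proof (cases "a0 < y")
    case True then show ?thesis using measure_upto_pos y by blast
  next
    case False
    then have "y = l" using d y by (auto simp: y_def min_def split: if_splits)
    then show ?thesis using mass_pos by simp
  qed
  have "measure M {0..y} = measure M {a0..y}"
  proof (rule measure_eq_AE)
    show "AE s in M. (s \<in> {0..y}) = (s \<in> {a0..y})"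
      using null_before by eventually_elim (use a0_range in auto)
  qed (use a0_range y in \<open>auto intro!: borel_in_sets\<close>)
  also have "\<dots> = 0"
  proof (rule null_off_Z)
    have "{a0..y} \<subseteq> ball a0 d" using y by (auto simp: dist_real_def)
    then show "{a0..y} \<inter> Z = {}" using d by blast
  qed (use a0_range y in auto)
  finally show False using pos by simp
qed

lemma c_eq: "c = Re p"
  using a0_in_Z by (simp add: Z_def)

lemma right_derivative_g:
  assumes "0 \<le> x" "x < l"
  shows "((\<lambda>y. Re ((\<phi> y)\<^sup>2 * cnj p)) has_real_derivative 2 * Re (\<phi> x * q x * cnj p)) (at x within {x..l})"
proof -
  note d = right_deriv_phi[OF assms]
  have "((\<lambda>y. \<phi> y * \<phi> y * cnj p) has_vector_derivative (\<phi> x * q x + q x * \<phi> x) * cnj p) (at x within {x..l})"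
    by (rule derivative_eq_intros d refl)+
  then have "((\<lambda>y. Re (\<phi> y * \<phi> y * cnj p)) has_vector_derivative Re ((\<phi> x * q x + q x * \<phi> x) * cnj p)) (at x within {x..l})"
    by (rule bounded_linear.has_vector_derivative[OF bounded_linear_Re])
  then show ?thesis
    by (simp add: has_real_derivative_iff_has_vector_derivative power2_eq_square algebra_simps)
qed

lemma right_slope_nonpos:
  assumes x: "x \<in> Z" "x < l"
  shows "Re (\<phi> x * q x * cnj p) \<le> 0"
proof (rule ccontr)
  assume "\<not> ?thesis"
  then have "0 < 2 * Re (\<phi> x * q x * cnj p)" by simp
  moreover have x0: "0 \<le> x" using x by (simp add: Z_def)
  ultimately obtain d where d: "0 < d" "\<And>h. 0 < h \<Longrightarrow> x + h \<in> {x..l} \<Longrightarrow> h < d \<Longrightarrow> Re ((\<phi> x)\<^sup>2 * cnj p) < Re ((\<phi> (x + h))\<^sup>2 * cnj p)"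
    using has_real_derivative_pos_inc_right[OF right_derivative_g[OF x0 x(2)]] by blast
  define h where "h = min (d / 2) (l - x)"
  have "0 < h" "h < d" "x + h \<in> {x..l}" using d x by (auto simp: h_def)
  then have "c < Re ((\<phi> (x + h))\<^sup>2 * cnj p)" using d(2)[of h] x by (simp add: Z_def)
  then show False using g_le[of "x + h"] \<open>x + h \<in> {x..l}\<close> x0 by simp
qed

lemma right_slope_zero:
  assumes x: "x \<in> Z" "x < y" "{x..y} \<subseteq> Z"
  shows "Re (\<phi> x * q x * cnj p) = 0"
proof (rule antisym)
  have y: "y \<in> Z" using x by auto
  then have "x < l" "0 \<le> x" using x by (auto simp: Z_def)
  then show "Re (\<phi> x * q x * cnj p) \<le> 0" using right_slope_nonpos x by blast
  show "0 \<le> Re (\<phi> x * q x * cnj p)"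
  proof (rule ccontr)
    assume "\<not> ?thesis"
    then have "2 * Re (\<phi> x * q x * cnj p) < 0" by simp
    then obtain d where d: "0 < d" "\<And>h. 0 < h \<Longrightarrow> x + h \<in> {x..l} \<Longrightarrow> h < d \<Longrightarrow> Re ((\<phi> (x + h))\<^sup>2 * cnj p) < Re ((\<phi> x)\<^sup>2 * cnj p)"
      using has_real_derivative_neg_dec_right[OF right_derivative_g[OF \<open>0 \<le> x\<close> \<open>x < l\<close>]] by blast
    define h where "h = min (d / 2) (y - x)"
    have h: "0 < h" "h < d" "x + h \<in> {x..y}" using d x by (auto simp: h_def)
    then have "x + h \<in> Z" using x by blast
    moreover have "x + h \<in> {x..l}" using h y by (auto simp: Z_def)
    ultimately show False using d(2)[OF h(1) _ h(2)] x(1) by (simp add: Z_def)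
  qed
qed

text \<open>
  A nonpositive function that vanishes at \<open>x\<close> cannot decrease towards \<open>x\<close>.  On the segment it is
  a quadratic polynomial that also vanishes at \<open>b\<close>; with a negative slope at \<open>x\<close> it would be
  positive at the midpoint.
\<close>

lemma left_slope_nonneg:
  assumes bx: "b \<in> Z" "x \<in> Z" "b < x" and aff: "\<And>y. b \<le> y \<Longrightarrow> y \<le> x \<Longrightarrow> \<phi> y = \<phi> x - of_real (x - y) * d"
  shows "0 \<le> Re (\<phi> x * d * cnj p)"
proof (rule ccontr)
  assume neg: "\<not> ?thesis"
  define R S where "R = Re (\<phi> x * d * cnj p)" and "S = Re (d\<^sup>2 * cnj p)"
  have neg: "R < 0" using neg by (simp add: R_def)
  have ex: "Re ((\<phi> y)\<^sup>2 * cnj p) = c - 2 * (x - y) * R + (x - y)\<^sup>2 * S" if y: "b \<le> y" "y \<le> x" for y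
  proof -
    have "(\<phi> y)\<^sup>2 * cnj p = (\<phi> x)\<^sup>2 * cnj p - of_real (2 * (x - y)) * (\<phi> x * d * cnj p) + of_real ((x - y)\<^sup>2) * (d\<^sup>2 * cnj p)"
      unfolding aff[OF y] by (simp add: power2_eq_square algebra_simps)
    from Re_quadratic[OF this] show ?thesis using bx unfolding R_def S_def Z_def by simp
  qed
  let ?h = "x - b"
  have "Re ((\<phi> b)\<^sup>2 * cnj p) = c" using bx(1) unfolding Z_def by blast
  then have "- 2 * ?h * R + ?h\<^sup>2 * S = 0" using ex[OF order_refl less_imp_le[OF bx(3)]] by linarith
  then have "?h * (?h * S - 2 * R) = 0" by algebra
  then have S: "?h * S = 2 * R" using bx by (simp only: mult_eq_0_iff) auto
  have "Re ((\<phi> (x - ?h / 2))\<^sup>2 * cnj p) = c - ?h * R + (?h / 2)\<^sup>2 * S"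
    using ex[of "x - ?h / 2"] bx by (simp add: field_simps)
  also have "(?h / 2)\<^sup>2 * S = ?h / 4 * (?h * S)" by (simp add: power2_eq_square)
  also have "c - ?h * R + ?h / 4 * (?h * S) = c - ?h / 2 * R" unfolding S by simp
  finally have "c < Re ((\<phi> (x - ?h / 2))\<^sup>2 * cnj p)" using bx neg by (simp add: mult_pos_neg)
  moreover have "x - ?h / 2 \<in> {0..l}" using bx by (auto simp: Z_def field_simps)
  ultimately show False using g_le[of "x - ?h / 2"] by simp
qed

text \<open>
  At a contact point without mass the function \<open>g\<close> has slope zero, so \<open>tangential\<close> makes its second
  derivative along the preceding segment negative, and \<open>g\<close> cannot vanish at the other end \<open>b\<close>.
\<close>

lemma no_touch:
  assumes b: "b \<in> Z" "x \<in> Z" "b < x" "x < l" "a0 \<le> b" and null: "measure M {b<..<x} = 0" "measure M {x} = 0"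
  shows False
proof -
  have b0: "0 \<le> b" "x \<le> l" using b by (auto simp: Z_def)
  have qx: "q x = q b" using q_jump[of b x] b b0 null by simp
  have aff: "\<phi> y = \<phi> x - of_real (x - y) * q x" if "b \<le> y" "y \<le> x" for y
  proof -
    have e: "\<phi> y = \<phi> b + of_real (y - b) * q b" "\<phi> x = \<phi> b + of_real (x - b) * q b"
      by (rule phi_gap[OF b0(1) that b0(2) null(1)] phi_gap[OF b0(1) less_imp_le[OF b(3)] order_refl b0(2) null(1)])+
    show ?thesis unfolding qx e by (simp add: algebra_simps)
  qed
  have "0 \<le> Re (\<phi> x * q x * cnj p)" by (rule left_slope_nonneg[OF b(1-3) aff])
  then have R: "Re (\<phi> x * q x * cnj p) = 0" using right_slope_nonpos[OF b(2,4)] by simp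
  have W: "0 < Im (cnj (\<phi> x) * q x)" using b b0 measure_upto_pos[of x] by (intro momentum_pos) auto
  have S: "Re ((q x)\<^sup>2 * cnj p) < 0"
    using tangential(2)[OF norm_p c_nonneg _ R W] b by (simp add: Z_def)
  have "(\<phi> b)\<^sup>2 * cnj p = (\<phi> x)\<^sup>2 * cnj p - of_real (2 * (x - b)) * (\<phi> x * q x * cnj p) + of_real ((x - b)\<^sup>2) * ((q x)\<^sup>2 * cnj p)"
    unfolding aff[OF order_refl less_imp_le[OF b(3)]] by (simp add: power2_eq_square algebra_simps)
  from Re_quadratic[OF this] have "Re ((\<phi> b)\<^sup>2 * cnj p) = Re ((\<phi> x)\<^sup>2 * cnj p) + (x - b)\<^sup>2 * Re ((q x)\<^sup>2 * cnj p)"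
    unfolding R by simp
  then have "(x - b)\<^sup>2 * Re ((q x)\<^sup>2 * cnj p) = 0" using b by (simp add: Z_def)
  then show False using S b by simp
qed

text \<open>
  A gap cannot begin to the left of all mass, since every interval beyond \<open>a0\<close> has met some.
\<close>

lemma measure_gap_start:
  assumes "a0 \<le> b" "b < y" "y \<le> l" "measure M {b<..<y} = 0"
  shows "0 < measure M {0..b}"
proof -
  define mid where "mid = (b + y) / 2"
  have mid: "b < mid" "mid < y" using assms by (auto simp: mid_def)
  have "measure M {b<..mid} \<le> measure M {b<..<y}"
    using mid assms a0_range by (intro finite_measure_mono borel_in_sets) auto
  then have "measure M {b<..mid} = 0" using assms(4) by (simp add: measure_le_0_iff)
  then show ?thesis
    using measure_split[of b mid] measure_upto_pos[of mid] mid assms a0_range by simp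
qed

lemma gap_chord:
  assumes b: "a0 \<le> b" "b < y" "b \<in> Z" "y \<in> Z" and gap: "{b<..<y} \<inter> Z = {}"
  shows "\<phi> y = \<phi> b + of_real (y - b) * q b" "0 < Im (cnj (\<phi> b) * \<phi> y)"
    "Re (((\<phi> b + \<phi> y) / 2)\<^sup>2 * cnj p) < c"
proof -
  have r: "0 \<le> b" "y \<le> l" using b by (auto simp: Z_def)
  have null: "measure M {b<..<y} = 0" using gap r by (intro null_off_Z) auto
  have aff: "\<phi> t = \<phi> b + of_real (t - b) * q b" if "b \<le> t" "t \<le> y" for t
    by (rule phi_gap[OF r(1) that r(2) null])
  show e: "\<phi> y = \<phi> b + of_real (y - b) * q b" by (rule aff) (use b in auto)
  have "0 < Im (cnj (\<phi> b) * q b)"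
    using measure_gap_start[OF b(1,2) r(2) null] r b by (intro momentum_pos) auto
  then have "0 < (y - b) * Im (cnj (\<phi> b) * q b)" using b by simp
  moreover have "Im (cnj (\<phi> b) * \<phi> y) = (y - b) * Im (cnj (\<phi> b) * q b)"
    unfolding e by (simp add: algebra_simps)
  ultimately show "0 < Im (cnj (\<phi> b) * \<phi> y)" by simp
  let ?t = "(b + y) / 2"
  have t: "?t \<in> {b<..<y}" using b by simp
  then have "?t \<notin> Z" using gap by blast
  moreover have "?t \<in> {0..l}" using t r by auto
  ultimately have "Re ((\<phi> ?t)\<^sup>2 * cnj p) < c" using g_le[of ?t] unfolding Z_def by auto
  moreover have "\<phi> ?t = (\<phi> b + \<phi> y) / 2"
    using aff[of ?t] b unfolding e by (simp add: field_simps)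
  ultimately show "Re (((\<phi> b + \<phi> y) / 2)\<^sup>2 * cnj p) < c" by simp
qed

lemma Z_value: "x \<in> Z \<Longrightarrow> Re ((\<phi> x)\<^sup>2 * cnj p) = c"
  by (simp add: Z_def)

lemma gap_left:
  assumes "a \<in> Z" "a \<le> w" "w \<notin> Z" 
  obtains b where "b \<in> Z" "a \<le> b" "b < w" "{b<..w} \<inter> Z = {}"
proof -
  let ?S = "Z \<inter> {a..w}"
  have ne: "?S \<noteq> {}" "bdd_above ?S" "closed ?S" using assms closed_Z by (auto intro: closed_Int)
  have "Sup ?S \<in> ?S" by (rule closed_contains_Sup[OF ne])
  moreover have "{Sup ?S<..w} \<inter> Z = {}"
  proof (rule ccontr)
    assume "\<not> ?thesis"
    then obtain y where y: "Sup ?S < y" "y \<le> w" "y \<in> Z" by auto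
    then have "y \<in> ?S" using \<open>Sup ?S \<in> ?S\<close> by auto
    then show False using cSup_upper[OF _ ne(2)] y(1) by fastforce
  qed
  moreover have "Sup ?S \<noteq> w" using calculation(1) assms by auto
  ultimately show ?thesis by (intro that[of "Sup ?S"]) auto
qed

lemma gap_right:
  assumes "a \<in> Z" "w \<le> a" "w \<notin> Z" 
  obtains b where "b \<in> Z" "b \<le> a" "w < b" "{w..<b} \<inter> Z = {}"
proof -
  let ?S = "Z \<inter> {w..a}"
  have ne: "?S \<noteq> {}" "bdd_below ?S" "closed ?S" using assms closed_Z by (auto intro: closed_Int)
  have "Inf ?S \<in> ?S" by (rule closed_contains_Inf[OF ne])
  moreover have "{w..<Inf ?S} \<inter> Z = {}"
  proof (rule ccontr)
    assume "\<not> ?thesis"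
    then obtain y where y: "y < Inf ?S" "w \<le> y" "y \<in> Z" by auto
    then have "y \<in> ?S" using \<open>Inf ?S \<in> ?S\<close> by auto
    then show False using cInf_lower[OF _ ne(2)] y(1) by fastforce
  qed
  moreover have "Inf ?S \<noteq> w" using calculation(1) assms by auto
  ultimately show ?thesis by (intro that[of "Inf ?S"]) auto
qed

lemma close_phi:
  obtains \<delta> where "0 < \<delta>" "\<And>x y. x \<in> {0..l} \<Longrightarrow> y \<in> {0..l} \<Longrightarrow> \<bar>x - y\<bar> < \<delta> \<Longrightarrow> 0 < Re (cnj (\<phi> x) * \<phi> y)"
proof -
  have "continuous_on {0..l} (\<lambda>x. norm (\<phi> x))" by (intro continuous_intros cont_phi)
  then obtain x0 where x0: "x0 \<in> {0..l}" "\<And>x. x \<in> {0..l} \<Longrightarrow> norm (\<phi> x0) \<le> norm (\<phi> x)"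
    using continuous_attains_inf[of "{0..l}" "\<lambda>x. norm (\<phi> x)"] l_pos by auto
  have pos: "0 < norm (\<phi> x0)" using phi_nonzero[OF x0(1)] by simp
  have "uniformly_continuous_on {0..l} \<phi>" using cont_phi by (intro compact_uniformly_continuous) auto
  then obtain \<delta> where \<delta>: "0 < \<delta>" "\<And>x y. x \<in> {0..l} \<Longrightarrow> y \<in> {0..l} \<Longrightarrow> dist x y < \<delta> \<Longrightarrow> dist (\<phi> x) (\<phi> y) < norm (\<phi> x0)"
    using pos unfolding uniformly_continuous_on_def by metis
  show ?thesis
  proof (rule that[OF \<delta>(1)])
    fix x y assume xy: "x \<in> {0..l}" "y \<in> {0..l}" "\<bar>x - y\<bar> < \<delta>"
    have "norm (\<phi> x - \<phi> y) < norm (\<phi> x)" using \<delta>(2)[OF xy(1,2)] xy(3) x0(2)[OF xy(1)] by (simp add: dist_norm)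
    then have "(norm (\<phi> x - \<phi> y))\<^sup>2 < (norm (\<phi> x))\<^sup>2" by (intro power_strict_mono) auto
    moreover have "(norm (\<phi> x - \<phi> y))\<^sup>2 = (norm (\<phi> x))\<^sup>2 + (norm (\<phi> y))\<^sup>2 - 2 * Re (cnj (\<phi> x) * \<phi> y)"
      unfolding cmod_power2 by (simp add: power2_eq_square algebra_simps)
    ultimately have "(norm (\<phi> y))\<^sup>2 < 2 * Re (cnj (\<phi> x) * \<phi> y)" by linarith
    then show "0 < Re (cnj (\<phi> x) * \<phi> y)" by (smt (verit) zero_le_power2)
  qed
qed

text \<open>
  A gap between close contact points would be a chord that rotates \<open>\<phi>\<close> by less than a right angle,
  against \<open>chord\<close>.
\<close>

lemma close_points_fill:
  assumes \<delta>: "\<And>x y. x \<in> {0..l} \<Longrightarrow> y \<in> {0..l} \<Longrightarrow> \<bar>x - y\<bar> < \<delta> \<Longrightarrow> 0 < Re (cnj (\<phi> x) * \<phi> y)"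
    and x: "a0 \<le> x" "x \<in> Z" "y \<in> Z" "x < y" "y - x < \<delta>"
  shows "{x..y} \<subseteq> Z"
proof (rule ccontr)
  assume "\<not> ?thesis"
  then obtain w where "w \<in> {x..y}" and "w \<notin> Z" by blast
  then have w: "x \<le> w" "w \<le> y" "w \<notin> Z" by auto
  obtain b where b: "b \<in> Z" "x \<le> b" "b < w" "{b<..w} \<inter> Z = {}" using gap_left[OF x(2) w(1,3)] .
  obtain b' where b': "b' \<in> Z" "b' \<le> y" "w < b'" "{w..<b'} \<inter> Z = {}" using gap_right[OF x(3) w(2,3)] .
  have "{b<..<b'} \<subseteq> {b<..w} \<union> {w..<b'}" by auto
  then have gap: "{b<..<b'} \<inter> Z = {}" using b b' by blast
  have ab: "a0 \<le> b" "b < b'" using x b b' by auto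
  note gc = gap_chord[OF ab b(1) b'(1) gap]
  have "Re (cnj (\<phi> b) * \<phi> b') \<le> 0"
    by (rule chord(1)[OF c_nonneg Z_value[OF b(1)] Z_value[OF b'(1)] gc(2,3)])
  moreover have "0 < Re (cnj (\<phi> b) * \<phi> b')"
    using b b' x by (intro \<delta>) (auto simp: Z_def)
  ultimately show False by simp
qed

end

section \<open>Arcs of contact points\<close>

lemma near_diagonal_neg:
  fixes f :: "real \<Rightarrow> real \<Rightarrow> real"
  assumes "continuous_on ({0..l} \<times> {0..l}) (\<lambda>(s, y). f s y)" "x \<in> {0..l}" "f x x < 0"
  obtains d where "0 < d" "\<And>s y. s \<in> {0..l} \<Longrightarrow> y \<in> {0..l} \<Longrightarrow> \<bar>s - x\<bar> < d \<Longrightarrow> \<bar>y - x\<bar> < d \<Longrightarrow> f s y < f x x / 2"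
proof -
  have "0 < - f x x / 2" using assms(3) by simp
  then obtain \<delta> where \<delta>: "0 < \<delta>" "\<And>s y. s \<in> {0..l} \<Longrightarrow> y \<in> {0..l} \<Longrightarrow> dist (s, y) (x, x) < \<delta> \<Longrightarrow> dist (f s y) (f x x) < - f x x / 2"
    using assms(1,2) unfolding continuous_on_iff by (metis (no_types, lifting) SigmaI case_prod_conv)
  show ?thesis
  proof (rule that[of "\<delta> / 2"])
    fix s y assume h: "s \<in> {0..l}" "y \<in> {0..l}" "\<bar>s - x\<bar> < \<delta> / 2" "\<bar>y - x\<bar> < \<delta> / 2"
    have "dist (s, y) (x, x) \<le> \<bar>s - x\<bar> + \<bar>y - x\<bar>"
      unfolding dist_Pair_Pair using sqrt_sum_squares_le_sum[of "\<bar>s - x\<bar>" "\<bar>y - x\<bar>"] by (simp add: dist_real_def)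
    then have "\<bar>f s y - f x x\<bar> < - f x x / 2" using \<delta>(2)[OF h(1,2)] h by (simp add: dist_real_def)
    then show "f s y < f x x / 2" by linarith
  qed (use \<delta> in simp)
qed

lemma Re_of_real_mult: "Re (complex_of_real s * z) = s * Re z" by simp

lemma Im_of_real_mult: "Im (complex_of_real s * z) = s * Im z" by simp

lemma Re_double: "- Re (2 * z) = - 2 * Re z" by simp

context resonance begin

text \<open>
  If \<open>\<phi>\<close> has already met mass, this is the sign of the derivative of the angle.  Otherwise
  \<open>x = a0\<close> carries no atom, and \<open>Im (\<phi> y)\<close> is an integral of \<open>Im (- (\<omega>\<^sup>2) * \<phi> s)\<close>, which is positive
  near \<open>a0\<close>, against the mass between \<open>a0\<close> and \<open>y\<close>.
\<close>

lemma momentum_forward: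
  assumes x: "a0 \<le> x" "x < l"
  obtains d where "0 < d" "\<And>y. x < y \<Longrightarrow> y < x + d \<Longrightarrow> y \<le> l \<Longrightarrow> 0 < Im (cnj (\<phi> x) * \<phi> y)"
proof (cases "0 < measure M {0..x}")
  case True
  have x0: "0 \<le> x" using x a0_range by simp
  have "((\<lambda>y. cnj (\<phi> x) * \<phi> y) has_vector_derivative cnj (\<phi> x) * q x) (at x within {x..l})"
    by (rule has_vector_derivative_mult_right[OF right_deriv_phi[OF x0 x(2)]])
  then have "((\<lambda>y. Im (cnj (\<phi> x) * \<phi> y)) has_real_derivative Im (cnj (\<phi> x) * q x)) (at x within {x..l})"
    unfolding has_real_derivative_iff_has_vector_derivative
    by (rule bounded_linear.has_vector_derivative[OF bounded_linear_Im])
  from has_real_derivative_pos_inc_right[OF this] momentum_pos[OF x0 _ True] x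
  obtain d where d: "0 < d" "\<And>h. 0 < h \<Longrightarrow> x + h \<in> {x..l} \<Longrightarrow> h < d \<Longrightarrow> Im (cnj (\<phi> x) * \<phi> x) < Im (cnj (\<phi> x) * \<phi> (x + h))"
    by auto
  show ?thesis
  proof (rule that[OF d(1)])
    fix y assume "x < y" "y < x + d" "y \<le> l"
    then show "0 < Im (cnj (\<phi> x) * \<phi> y)" using d(2)[of "y - x"] by (simp add: mult.commute)
  qed
next
  case False
  then have xa: "x = a0" using measure_upto_pos[of x] x by force
  define A where "A = - Im (\<omega>\<^sup>2)"
  have A: "0 < A" using Im_sq_neg by (simp add: A_def)
  define B where "B = norm (\<omega>\<^sup>2)"
  have B: "0 < B" using omega_nonzero by (simp add: B_def)
  obtain d where d: "0 < d" "\<And>y. y \<in> {0..l} \<Longrightarrow> \<bar>y - a0\<bar> < d \<Longrightarrow> norm (\<phi> y - \<phi> a0) < A / (2 * B)"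
    using phi_near[OF a0_range, of "A / (2 * B)"] A B by auto
  show ?thesis
  proof (rule that[OF d(1)])
    fix y assume y: "x < y" "y < x + d" "y \<le> l"
    have y0: "y \<in> {0..l}" using y xa a0_range by auto
    define w where "w = (a0 + y) / 2"
    have w: "a0 < w" "w < y" using y xa by (auto simp: w_def)
    have int: "integrable M (\<lambda>s. of_real (max 0 (y - s)) * (- (\<omega>\<^sup>2) * \<phi> s))"
      using integrable_kernel[of "\<lambda>s. - (\<omega>\<^sup>2) * \<phi> s" 1 y] cont_phi by (simp add: continuous_intros)
    have "\<phi> y = 1 + (\<integral>s. of_real (max 0 (y - s)) * (- (\<omega>\<^sup>2) * \<phi> s) \<partial>M)"
    proof -
      have "(\<integral>s. of_real (max 0 (y - s)) * (- (\<omega>\<^sup>2) * \<phi> s) \<partial>M) = (\<integral>s. - (\<omega>\<^sup>2) * (of_real (max 0 (y - s)) * \<phi> s) \<partial>M)"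
        by (intro Bochner_Integration.integral_cong) auto
      also have "\<dots> = - (\<omega>\<^sup>2) * (\<integral>s. of_real (max 0 (y - s)) * \<phi> s \<partial>M)" by (rule integral_mult_right_zero)
      finally show ?thesis using phi_eq y0 by (simp add: string_eq_def)
    qed
    then have "Im (\<phi> y) = Im (\<integral>s. of_real (max 0 (y - s)) * (- (\<omega>\<^sup>2) * \<phi> s) \<partial>M)" by simp
    also have "\<dots> = (\<integral>s. Im (of_real (max 0 (y - s)) * (- (\<omega>\<^sup>2) * \<phi> s)) \<partial>M)"
      by (rule Bochner_Integration.integral_Im[OF int, symmetric])
    also have "\<dots> \<ge> (\<integral>s. ((y - w) * (A / 2)) * indicator {0..w} s \<partial>M)"
    proof (rule integral_mono_AE)
      show "integrable M (\<lambda>s. ((y - w) * (A / 2)) * indicator {0..w} s)"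
        using w y0 a0_range by (intro integrable_mult_right integrable_real_indicator borel_in_sets) (auto simp: emeasure_eq_measure)
      show "integrable M (\<lambda>s. Im (of_real (max 0 (y - s)) * (- (\<omega>\<^sup>2) * \<phi> s)))" by (rule integrable_Im[OF int])
      show "AE s in M. ((y - w) * (A / 2)) * indicator {0..w} s \<le> Im (of_real (max 0 (y - s)) * (- (\<omega>\<^sup>2) * \<phi> s))"
        using null_before AE_space
      proof eventually_elim
        case (elim s)
        show ?case
        proof (cases "s < y")
          case True
          have "norm (\<phi> s - 1) < A / (2 * B)" using d(2)[of s] elim True y xa by (simp add: space_M)
          then have "norm (\<omega>\<^sup>2 * (\<phi> s - 1)) \<le> A / 2"
            unfolding norm_mult B_def[symmetric] using B by (simp add: field_simps)
          then have "\<bar>Im (\<omega>\<^sup>2 * (\<phi> s - 1))\<bar> \<le> A / 2" using abs_Im_le_cmod order_trans by blast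
          moreover have "Im (- (\<omega>\<^sup>2) * \<phi> s) = A - Im (\<omega>\<^sup>2 * (\<phi> s - 1))" by (simp add: A_def algebra_simps)
          ultimately have ge: "A / 2 \<le> Im (- (\<omega>\<^sup>2) * \<phi> s)" by linarith
          have e: "Im (of_real (max 0 (y - s)) * (- (\<omega>\<^sup>2) * \<phi> s)) = (y - s) * Im (- (\<omega>\<^sup>2) * \<phi> s)"
            using True unfolding Im_of_real_mult by simp
          show ?thesis
          proof (cases "s \<le> w")
            case True
            have "(y - w) * (A / 2) \<le> (y - s) * Im (- (\<omega>\<^sup>2) * \<phi> s)" using ge True w A by (intro mult_mono) auto
            then show ?thesis unfolding e using True elim by (simp add: indicator_def space_M)
          next
            case False
            have "0 \<le> (y - s) * Im (- (\<omega>\<^sup>2) * \<phi> s)" using ge True A by (intro mult_nonneg_nonneg) auto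
            then show ?thesis unfolding e using False by (simp add: indicator_def)
          qed
        next
          case False then show ?thesis using w by (simp add: indicator_def max_def)
        qed
      qed
    qed
    also have "(\<integral>s. ((y - w) * (A / 2)) * indicator {0..w} s \<partial>M) = (y - w) * (A / 2) * measure M {0..w}"
      using w y0 a0_range by (simp add: space_M Int_absorb2)
    finally have "(y - w) * (A / 2) * measure M {0..w} \<le> Im (\<phi> y)" .
    moreover have "0 < (y - w) * (A / 2) * measure M {0..w}"
      using measure_upto_pos[of w] w A y0 by simp
    ultimately show "0 < Im (cnj (\<phi> x) * \<phi> y)" by (simp add: xa)
  qed
qed

text \<open>
  If all mass sits at \<open>l\<close>, then \<open>\<phi>\<close> is constant and \<open>\<omega>\<close> is purely imaginary.
\<close>

lemma a0_less: "a0 < l"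
proof (rule ccontr)
  assume "\<not> ?thesis"
  then have "a0 = l" using a0_range by simp
  then have one: "\<phi> s = 1" if "s \<in> {0..l}" for s using phi_before that by simp
  have "(\<integral>s. \<phi> s \<partial>M) = (\<integral>s. 1 \<partial>M)" by (intro Bochner_Integration.integral_cong) (auto simp: one space_M)
  then have "(\<integral>s. \<phi> s \<partial>M) = of_real (measure M {0..l})" by (simp add: space_M scaleR_conv_of_real)
  then have "1 = \<i> * \<omega> * of_real (measure M {0..l})" using outgoing one[of l] l_pos by simp
  from arg_cong[OF this, of Im] arg_cong[OF this, of Re] show False using Re_pos mass_pos by simp
qed

end

context extremal begin

lemma slope_tangential:
  assumes "x \<in> Z" "0 < measure M {0..x}" "Re (\<phi> x * q x * cnj p) = 0"
  shows "0 < c" "Re ((q x)\<^sup>2 * cnj p) < 0"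
proof -
  have "0 < Im (cnj (\<phi> x) * q x)" using assms by (intro momentum_pos) (auto simp: Z_def)
  note t = tangential[OF norm_p c_nonneg Z_value[OF assms(1)] assms(3) this]
  show "0 < c" "Re ((q x)\<^sup>2 * cnj p) < 0" by (rule t)+
qed

text \<open>
  Second-order expansion of \<open>g\<close> at \<open>x\<close>: the linear term vanishes along an arc, the quadratic term of the
  motion along the tangent is negative by \<open>tangential\<close>, and the masses met after \<open>x\<close> contribute with the
  sign of \<open>- Re (\<omega>\<^sup>2 * (\<phi> x)\<^sup>2 * cnj p)\<close>.  So \<open>g\<close> would be negative right after \<open>x\<close>.
\<close>

lemma arc_step:
  assumes x: "a0 \<le> x" "x < y0" "{x..y0} \<subseteq> Z" "0 < measure M {0..x}" and h: "0 < Re (\<omega>\<^sup>2 * (\<phi> x)\<^sup>2 * cnj p)"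
  shows False
proof -
  have xZ: "x \<in> Z" "y0 \<in> Z" using x by auto
  have r: "0 \<le> x" "y0 \<le> l" "x \<in> {0..l}" using xZ by (auto simp: Z_def)
  have R: "Re (\<phi> x * q x * cnj p) = 0" by (rule right_slope_zero[OF xZ(1) x(2,3)])
  have S: "Re ((q x)\<^sup>2 * cnj p) < 0" by (rule slope_tangential(2)[OF xZ(1) x(4) R])
  \<comment> \<open>The deviation \<open>e\<close> from the tangent line changes the square by \<open>e * K y\<close>.\<close>
  define K where "K y = - (\<omega>\<^sup>2) * (\<phi> y + \<phi> x + of_real (y - x) * q x) * cnj p" for y
  have cK: "continuous_on ({0..l} \<times> {0..l}) (\<lambda>(s, y). Re (\<phi> s * K y))"
    unfolding K_def split_beta
    by (intro continuous_intros continuous_on_compose2[OF cont_phi]) auto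
  have "\<phi> x * K x = - (2 * (\<omega>\<^sup>2 * (\<phi> x)\<^sup>2 * cnj p))" by (simp add: K_def power2_eq_square algebra_simps)
  then have "Re (\<phi> x * K x) = - 2 * Re (\<omega>\<^sup>2 * (\<phi> x)\<^sup>2 * cnj p)" by (simp only: uminus_complex.sel Re_double)
  then have neg: "Re (\<phi> x * K x) < 0" using h by linarith
  obtain d where d: "0 < d" "\<And>s y. s \<in> {0..l} \<Longrightarrow> y \<in> {0..l} \<Longrightarrow> \<bar>s - x\<bar> < d \<Longrightarrow> \<bar>y - x\<bar> < d \<Longrightarrow> Re (\<phi> s * K y) < Re (\<phi> x * K x) / 2"
    using near_diagonal_neg[OF cK r(3) neg] by blast
  define y where "y = min y0 (x + d / 2)"
  have y: "x < y" "y \<le> y0" "y < x + d" "y \<in> Z" "y \<le> l" using x d r by (auto simp: y_def min_def)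
  have c: "continuous_on {0..l} (\<lambda>s. of_real (y - s) * \<phi> s)" by (intro continuous_intros cont_phi)
  have int: "integrable M (\<lambda>s. (indicator {x<..<y} s * (of_real (y - s) * \<phi> s)) * K y)"
    by (intro integrable_mult_left integrable_M_indicator c) simp
  define e where "e = (\<integral>s. indicator {x<..<y} s * (of_real (y - s) * \<phi> s) \<partial>M)"
  have phy: "\<phi> y = \<phi> x + of_real (y - x) * q x - \<omega>\<^sup>2 * e"
    using string_eq_propagate_right[OF phi_eq r(1) less_imp_le[OF y(1)] y(5)] by (simp add: q_def e_def)
  have "(\<phi> y)\<^sup>2 * cnj p = (\<phi> x)\<^sup>2 * cnj p - of_real (- 2 * (y - x)) * (\<phi> x * q x * cnj p) + of_real ((y - x)\<^sup>2) * ((q x)\<^sup>2 * cnj p) + e * K y"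
    unfolding K_def by (simp add: phy power2_eq_square algebra_simps)
  then have "Re ((\<phi> y)\<^sup>2 * cnj p) = Re ((\<phi> x)\<^sup>2 * cnj p) + (y - x)\<^sup>2 * Re ((q x)\<^sup>2 * cnj p) + Re (e * K y)"
    using R by (simp only: plus_complex.sel(1) minus_complex.sel(1) Re_quadratic[OF refl]) simp
  then have "Re (e * K y) = - ((y - x)\<^sup>2 * Re ((q x)\<^sup>2 * cnj p))"
    unfolding Z_value[OF y(4)] Z_value[OF xZ(1)] by simp
  moreover have "(y - x)\<^sup>2 * Re ((q x)\<^sup>2 * cnj p) < 0" using S y by (intro mult_pos_neg) auto
  ultimately have "0 < Re (e * K y)" by simp
  moreover have "Re (e * K y) \<le> 0"
  proof -
    have "e * K y = (\<integral>s. (indicator {x<..<y} s * (of_real (y - s) * \<phi> s)) * K y \<partial>M)"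
      unfolding e_def by (rule integral_mult_left_zero[symmetric])
    then have "Re (e * K y) = Re (\<integral>s. (indicator {x<..<y} s * (of_real (y - s) * \<phi> s)) * K y \<partial>M)"
      by (rule arg_cong)
    also have "\<dots> = (\<integral>s. Re ((indicator {x<..<y} s * (of_real (y - s) * \<phi> s)) * K y) \<partial>M)"
      by (rule Bochner_Integration.integral_Re[OF int, symmetric])
    also have "\<dots> \<le> (\<integral>s. 0 \<partial>M)"
    proof (rule integral_mono)
      show "integrable M (\<lambda>s. Re ((indicator {x<..<y} s * (of_real (y - s) * \<phi> s)) * K y))" by (rule integrable_Re[OF int])
      fix s assume s: "s \<in> space M"
      show "Re ((indicator {x<..<y} s * (of_real (y - s) * \<phi> s)) * K y) \<le> 0"
      proof (cases "s \<in> {x<..<y}")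
        case True
        have "Re (\<phi> s * K y) \<le> 0" using d(2)[of s y] True y r neg by auto
        then have "(y - s) * Re (\<phi> s * K y) \<le> 0" using True by (intro mult_nonneg_nonpos) auto
        moreover have "Re (of_real (y - s) * (\<phi> s * K y)) = (y - s) * Re (\<phi> s * K y)" by (rule Re_of_real_mult)
        ultimately show ?thesis using True by (simp only: indicator_simps mult.assoc mult_1_left)
      qed simp
    qed simp
    finally show ?thesis by simp
  qed
  ultimately show False by simp
qed

end


context string_measure begin

definition atoms :: "real set" where "atoms = {x \<in> {0..l}. 0 < measure M {x}}"

end

context extremal begin

text \<open>
  Right after \<open>a0\<close> the derivative of \<open>\<phi>\<^sup>2\<close> is close to a positive multiple of \<open>- (\<omega>\<^sup>2)\<close>, and along an
  arc it is orthogonal to \<open>p\<close>.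
\<close>

lemma arc_from_a0:
  assumes y0: "a0 < y0" "{a0..y0} \<subseteq> Z"
  shows "0 \<le> Re (\<omega>\<^sup>2 * (\<phi> a0)\<^sup>2 * cnj p)"
proof (rule ccontr)
  assume "\<not> ?thesis"
  then have neg: "Re (\<omega>\<^sup>2 * \<phi> a0 * \<phi> a0 * cnj p) < 0" by (simp add: power2_eq_square)
  have cf: "continuous_on ({0..l} \<times> {0..l}) (\<lambda>(s, y). Re (\<omega>\<^sup>2 * \<phi> s * \<phi> y * cnj p))"
    unfolding split_beta by (intro continuous_intros continuous_on_compose2[OF cont_phi]) auto
  define k where "k = - Re (\<omega>\<^sup>2 * \<phi> a0 * \<phi> a0 * cnj p) / 2"
  have k: "0 < k" using neg unfolding k_def by linarith
  obtain d where d: "0 < d" "\<And>s y. s \<in> {0..l} \<Longrightarrow> y \<in> {0..l} \<Longrightarrow> \<bar>s - a0\<bar> < d \<Longrightarrow> \<bar>y - a0\<bar> < d \<Longrightarrow>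
      Re (\<omega>\<^sup>2 * \<phi> s * \<phi> y * cnj p) < Re (\<omega>\<^sup>2 * \<phi> a0 * \<phi> a0 * cnj p) / 2"
    using near_diagonal_neg[OF cf a0_range neg] by blast
  define y where "y = min ((a0 + y0) / 2) (a0 + d / 2)"
  have y: "a0 < y" "y < y0" "y < a0 + d" using y0 d by (auto simp: y_def min_def)
  have "y0 \<in> Z" using y0 by auto
  then have yl: "y \<in> {0..l}" using y a0_range by (auto simp: Z_def)
  have "{y..y0} \<subseteq> {a0..y0}" "y \<in> {a0..y0}" using y by auto
  then have "Re (\<phi> y * q y * cnj p) = 0" using y0 y(2) by (intro right_slope_zero) auto
  moreover have "0 < Re (\<phi> y * q y * cnj p)"
  proof -
    have int: "integrable M (\<lambda>s. (indicator {0..y} s * \<phi> s) * (- (\<omega>\<^sup>2 * \<phi> y * cnj p)))"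
      by (intro integrable_mult_left integrable_upto cont_phi)
    have "\<phi> y * q y * cnj p = integral_upto M \<phi> y * (- (\<omega>\<^sup>2 * \<phi> y * cnj p))" by (simp add: q_def algebra_simps)
    also have "\<dots> = (\<integral>s. (indicator {0..y} s * \<phi> s) * (- (\<omega>\<^sup>2 * \<phi> y * cnj p)) \<partial>M)"
      unfolding integral_upto_def by (rule integral_mult_left_zero[symmetric])
    finally have "Re (\<phi> y * q y * cnj p) = Re (\<integral>s. (indicator {0..y} s * \<phi> s) * (- (\<omega>\<^sup>2 * \<phi> y * cnj p)) \<partial>M)"
      by (rule arg_cong)
    also have "\<dots> = (\<integral>s. Re ((indicator {0..y} s * \<phi> s) * (- (\<omega>\<^sup>2 * \<phi> y * cnj p))) \<partial>M)"
      by (rule Bochner_Integration.integral_Re[OF int, symmetric])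
    also have "\<dots> \<ge> (\<integral>s. k * indicator {0..y} s \<partial>M)"
    proof (rule integral_mono_AE)
      show "integrable M (\<lambda>s. k * indicator {0..y} s)"
        using yl by (intro integrable_mult_right integrable_real_indicator borel_in_sets) (auto simp: emeasure_eq_measure)
      show "integrable M (\<lambda>s. Re ((indicator {0..y} s * \<phi> s) * (- (\<omega>\<^sup>2 * \<phi> y * cnj p))))" by (rule integrable_Re[OF int])
      show "AE s in M. k * indicator {0..y} s \<le> Re ((indicator {0..y} s * \<phi> s) * (- (\<omega>\<^sup>2 * \<phi> y * cnj p)))"
        using null_before AE_space
      proof eventually_elim
        case (elim s)
        show ?case
        proof (cases "s \<le> y")
          case True
          have "s \<in> {0..l}" "\<bar>s - a0\<bar> < d" "\<bar>y - a0\<bar> < d" using elim True y by (auto simp: space_M)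
          then have less: "Re (\<omega>\<^sup>2 * \<phi> s * \<phi> y * cnj p) < - k"
            using d(2)[of s y] yl unfolding k_def by linarith
          have "(1 * \<phi> s) * (- (\<omega>\<^sup>2 * \<phi> y * cnj p)) = - (\<omega>\<^sup>2 * \<phi> s * \<phi> y * cnj p)" by (simp add: mult_ac)
          then have e: "Re ((1 * \<phi> s) * (- (\<omega>\<^sup>2 * \<phi> y * cnj p))) = - Re (\<omega>\<^sup>2 * \<phi> s * \<phi> y * cnj p)" by (simp only: uminus_complex.sel)
          have i: "indicator {0..y} s = (1::complex)" "indicator {0..y} s = (1::real)"
            using True elim by (auto simp: space_M)
          show ?thesis unfolding i e using less by linarith
        qed (simp add: indicator_def)
      qed
    qed
    also have "(\<integral>s. k * indicator {0..y} s \<partial>M) = k * measure M {0..y}" using yl by (simp add: space_M Int_absorb2)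
    finally have "k * measure M {0..y} \<le> Re (\<phi> y * q y * cnj p)" .
    moreover have "0 < k * measure M {0..y}" using k measure_upto_pos[of y] y yl by simp
    ultimately show ?thesis by linarith
  qed
  ultimately show False by simp
qed

text \<open>
  Let \<open>x1\<close> be the first point where an arc starts.  There \<open>Re (\<omega>\<^sup>2 * (\<phi> x1)\<^sup>2 * cnj p)\<close> is nonnegative: for
  \<open>x1 = a0\<close> by \<open>arc_from_a0\<close>; otherwise a gap precedes \<open>x1\<close>, so by \<open>no_touch\<close> there is an atom at \<open>x1\<close>, and
  the atom turns a nonnegative slope of \<open>g\<close> into the slope zero.  Since \<open>\<phi>\<close> turns counterclockwise on
  one branch, the quantity is positive at later points of the arc, which \<open>arc_step\<close> excludes.
\<close>

lemma no_arc:
  assumes arc: "a0 \<le> x" "x < y" "{x..y} \<subseteq> Z"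
  shows False
proof -
  obtain \<delta> where \<delta>: "0 < \<delta>" and close: "\<And>x y. x \<in> {0..l} \<Longrightarrow> y \<in> {0..l} \<Longrightarrow> \<bar>x - y\<bar> < \<delta> \<Longrightarrow> 0 < Re (cnj (\<phi> x) * \<phi> y)"
    using close_phi by blast
  note fill = close_points_fill[OF close]
  define P where "P = {x. a0 \<le> x \<and> (\<exists>y>x. {x..y} \<subseteq> Z)}"
  have P: "P \<noteq> {}" "bdd_below P" "P \<subseteq> Z" using arc by (auto simp: P_def bdd_below_def)
  define x1 where "x1 = Inf P"
  have "x1 \<in> closure P" unfolding x1_def by (rule closure_contains_Inf[OF P(1,2)])
  then have x1Z: "x1 \<in> Z" using closure_minimal[OF P(3) closed_Z] by blast
  have x1a: "a0 \<le> x1" unfolding x1_def using P(1) by (intro cInf_greatest) (auto simp: P_def)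
  have "x1 \<in> P"
  proof -
    obtain x2 where x2: "x2 \<in> P" "x2 < x1 + \<delta>" using cInf_lessD[OF P(1), of "x1 + \<delta>"] \<delta> unfolding x1_def by auto
    have "x1 \<le> x2" unfolding x1_def by (rule cInf_lower[OF x2(1) P(2)])
    show ?thesis
    proof (cases "x1 = x2")
      case True then show ?thesis using x2 by simp
    next
      case False
      then have "{x1..x2} \<subseteq> Z" using \<open>x1 \<le> x2\<close> x2 P(3) x1Z x1a by (intro fill) auto
      then show ?thesis using False \<open>x1 \<le> x2\<close> x1a by (auto simp: P_def intro!: exI[of _ x2])
    qed
  qed
  then obtain y1 where y1: "x1 < y1" "{x1..y1} \<subseteq> Z" by (auto simp: P_def)
  then have y1Z: "y1 \<in> Z" by auto
  have r: "0 \<le> x1" "x1 < l" "y1 \<le> l" "x1 \<in> {0..l}" using x1Z y1Z y1 by (auto simp: Z_def)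
  have h1: "0 \<le> Re (\<omega>\<^sup>2 * (\<phi> x1)\<^sup>2 * cnj p)"
  proof (cases "x1 = a0")
    case True then show ?thesis using arc_from_a0 y1 by simp
  next
    case False
    then have ax: "a0 < x1" using x1a by simp
    define e where "e = min \<delta> (x1 - a0)"
    have e: "0 < e" "e \<le> \<delta>" "a0 \<le> x1 - e" using \<delta> ax by (auto simp: e_def)
    \<comment> \<open>Otherwise \<open>close_points_fill\<close> would start the arc earlier.\<close>
    have isolated: "z \<notin> Z" if "x1 - \<delta> < z" "z < x1" "a0 \<le> z" for z
    proof
      assume "z \<in> Z"
      then have "{z..x1} \<subseteq> Z" using that x1Z by (intro fill) auto
      then have "z \<in> P" using that by (auto simp: P_def)
      then show False using cInf_lower[OF _ P(2), of z] that unfolding x1_def by simp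
    qed
    define w where "w = x1 - e / 2"
    have wZ: "w \<notin> Z" using isolated[of w] e unfolding w_def by auto
    obtain b where b: "b \<in> Z" "a0 \<le> b" "b < w" "{b<..w} \<inter> Z = {}"
      using gap_left[OF a0_in_Z _ wZ] e unfolding w_def by auto
    have bx: "b < x1" using b e by (simp add: w_def)
    have gap: "{b<..<x1} \<inter> Z = {}"
    proof (rule ccontr)
      assume "\<not> ?thesis"
      then obtain z where z: "b < z" "z < x1" "z \<in> Z" by auto
      show False
      proof (cases "z \<le> w")
        case True then show ?thesis using b z by auto
      next
        case False then show ?thesis using isolated[of z] z e b unfolding w_def by auto
      qed
    qed
    have b0: "0 \<le> b" using b(1) by (simp add: Z_def)
    have null: "measure M {b<..<x1} = 0" using gap b0 r by (intro null_off_Z) auto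
    show ?thesis
    proof (cases "measure M {x1} = 0")
      case True
      show ?thesis using no_touch[OF b(1) x1Z bx r(2) b(2) null True] ..
    next
      case False
      then have mpos: "0 < measure M {x1}" by (simp add: zero_less_measure_iff)
      have "0 \<le> Re (\<phi> x1 * q b * cnj p)"
      proof (rule left_slope_nonneg[OF b(1) x1Z bx])
        fix y assume y: "b \<le> y" "y \<le> x1"
        have e: "\<phi> y = \<phi> b + of_real (y - b) * q b" "\<phi> x1 = \<phi> b + of_real (x1 - b) * q b"
          by (rule phi_gap[OF b0 y less_imp_le[OF r(2)] null] phi_gap[OF b0 less_imp_le[OF bx] order_refl less_imp_le[OF r(2)] null])+
        show "\<phi> y = \<phi> x1 - of_real (x1 - y) * q b" unfolding e by (simp add: algebra_simps)
      qed
      moreover have "Re (\<phi> x1 * q x1 * cnj p) = 0" by (rule right_slope_zero[OF x1Z y1])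
      moreover have "\<phi> x1 * q x1 * cnj p = \<phi> x1 * q b * cnj p - of_real (measure M {x1}) * (\<omega>\<^sup>2 * (\<phi> x1)\<^sup>2 * cnj p)"
        unfolding q_jump[OF b0 bx less_imp_le[OF r(2)] null] by (simp add: power2_eq_square algebra_simps)
      ultimately have "0 \<le> measure M {x1} * Re (\<omega>\<^sup>2 * (\<phi> x1)\<^sup>2 * cnj p)"
        by (simp only: minus_complex.sel Re_of_real_mult)
      then show ?thesis using mpos by (simp only: zero_le_mult_iff) auto
    qed
  qed
  obtain d where d: "0 < d" "\<And>y. x1 < y \<Longrightarrow> y < x1 + d \<Longrightarrow> y \<le> l \<Longrightarrow> 0 < Im (cnj (\<phi> x1) * \<phi> y)"
    using momentum_forward[OF x1a r(2)] by blast
  define y where "y = min ((x1 + y1) / 2) (x1 + min d \<delta> / 2)"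
  have y: "x1 < y" "y < y1" "y < x1 + d" "y < x1 + \<delta>" using y1 d \<delta> by (auto simp: y_def min_def)
  have yZ: "y \<in> Z" "{y..y1} \<subseteq> Z" using y1 y by auto
  have ay: "a0 < y" "y \<le> l" "0 \<le> y" "y \<in> {0..l}" using y x1a r by auto
  have mpos: "0 < measure M {0..y}" using measure_upto_pos ay by blast
  have c: "0 < c" by (rule slope_tangential(1)[OF yZ(1) mpos right_slope_zero[OF yZ(1) y(2) yZ(2)]])
  have "0 < Im (cnj (\<phi> x1) * \<phi> y)" using d(2) y ay by auto
  moreover have "0 < Re (cnj (\<phi> x1) * \<phi> y)" using close[OF r(4) ay(4)] y by auto
  ultimately have rot: "Im ((\<phi> x1)\<^sup>2 * cnj p) < Im ((\<phi> y)\<^sup>2 * cnj p)"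
    by (rule rotate_forward[OF c Z_value[OF x1Z] Z_value[OF yZ(1)]])
  \<comment> \<open>Along the line the square moves in the direction \<open>\<i> * p\<close>, and \<open>Re (\<omega>\<^sup>2 * \<i>) = - Im (\<omega>\<^sup>2)\<close> is positive.\<close>
  have "Re (\<omega>\<^sup>2 * (\<phi> y)\<^sup>2 * cnj p) - Re (\<omega>\<^sup>2 * (\<phi> x1)\<^sup>2 * cnj p) = - Im (\<omega>\<^sup>2) * (Im ((\<phi> y)\<^sup>2 * cnj p) - Im ((\<phi> x1)\<^sup>2 * cnj p))"
  proof -
    have "Re (k * a) - Re (k * b) = - Im k * (Im a - Im b)" if "Re a = Re b" for k a b :: complex
      using that by (simp add: algebra_simps)
    from this[of "(\<phi> y)\<^sup>2 * cnj p" "(\<phi> x1)\<^sup>2 * cnj p" "\<omega>\<^sup>2"] show ?thesis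
      unfolding Z_value[OF x1Z] Z_value[OF yZ(1)] by (simp only: mult.assoc)
  qed
  moreover have "0 < - Im (\<omega>\<^sup>2) * (Im ((\<phi> y)\<^sup>2 * cnj p) - Im ((\<phi> x1)\<^sup>2 * cnj p))"
    using rot Im_sq_neg by (intro mult_pos_pos) auto
  ultimately have "0 < Re (\<omega>\<^sup>2 * (\<phi> y)\<^sup>2 * cnj p)" using h1 by linarith
  then show False using arc_step[OF _ y(2) yZ(2) mpos] ay by auto
qed

text \<open>
  An infinite set of contact points contains two close ones, hence an arc.
\<close>

lemma finite_Z: "finite (Z \<inter> {a0..l})"
proof (rule ccontr)
  assume inf: "infinite (Z \<inter> {a0..l})"
  obtain \<delta> where \<delta>: "0 < \<delta>" and close: "\<And>x y. x \<in> {0..l} \<Longrightarrow> y \<in> {0..l} \<Longrightarrow> \<bar>x - y\<bar> < \<delta> \<Longrightarrow> 0 < Re (cnj (\<phi> x) * \<phi> y)"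
    using close_phi by blast
  have "compact {a0..l}" by simp
  then obtain x where x: "x islimpt (Z \<inter> {a0..l})"
    using inf unfolding compact_eq_Bolzano_Weierstrass by (meson Int_lower2)
  then obtain y where y: "y \<in> Z \<inter> {a0..l}" "y \<noteq> x" "dist y x < \<delta> / 2"
    using \<delta> unfolding islimpt_approachable by (metis half_gt_zero)
  then obtain z where z: "z \<in> Z \<inter> {a0..l}" "z \<noteq> x" "dist z x < dist y x"
    using x unfolding islimpt_approachable by (metis zero_less_dist_iff)
  have ne: "y \<noteq> z" using z by auto
  have "dist y z < \<delta>" using y z dist_triangle2[of y z x] by simp
  then have d: "\<bar>y - z\<bar> < \<delta>" by (simp add: dist_real_def)
  define u v where "u = min y z" and "v = max y z"
  have uv: "a0 \<le> u" "u \<in> Z" "v \<in> Z" "u < v" "v - u < \<delta>" using y z ne d by (auto simp: u_def v_def min_def max_def)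
  show False using no_arc[OF uv(1,4) close_points_fill[OF close uv]] by simp
qed

lemma atoms_subset: "atoms \<subseteq> Z \<inter> {a0..l}"
proof
  fix x assume "x \<in> atoms"
  then have x: "x \<in> {0..l}" "0 < measure M {x}" by (auto simp: atoms_def)
  have "measure M {x} \<le> measure M {0..x}" using x by (intro finite_measure_mono borel_in_sets) auto
  then have "a0 \<le> x" using x by (intro measure_upto_pos_ge) auto
  then show "x \<in> Z \<inter> {a0..l}" using x atom_in_Z by auto
qed

lemma finite_atoms: "finite atoms"
  using finite_subset[OF atoms_subset finite_Z] .

lemma measure_atoms:
  assumes "B \<in> sets M" shows "measure M B = (\<Sum>x\<in>atoms \<inter> B. measure M {x})"
proof -
  let ?F = "Z \<inter> {a0..l}"
  have F: "?F \<subseteq> {0..l}" by (auto simp: Z_def)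
  have fin: "finite (?F \<inter> B)" using finite_Z by auto
  have ae: "AE s in M. s \<in> ?F"
    using null_before g_AE AE_space by eventually_elim (auto simp: Z_def space_M)
  have sets: "?F \<inter> B \<in> sets M"
  proof (rule borel_in_sets)
    show "?F \<inter> B \<in> sets borel" using fin by (intro borel_closed finite_imp_closed)
    show "?F \<inter> B \<subseteq> {0..l}" using F by auto
  qed
  have "measure M B = measure M (?F \<inter> B)"
    by (rule measure_eq_AE) (use ae assms sets in auto)
  also have "\<dots> = (\<Sum>x\<in>?F \<inter> B. measure M {x})"
    using F by (intro finite_measure_eq_sum_singleton fin borel_in_sets) auto
  also have "\<dots> = (\<Sum>x\<in>atoms \<inter> B. measure M {x})"
  proof (rule sum.mono_neutral_right[OF fin])
    show "atoms \<inter> B \<subseteq> ?F \<inter> B" using atoms_subset by auto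
    show "\<forall>i\<in>?F \<inter> B - atoms \<inter> B. measure M {i} = 0"
      using F by (auto simp: atoms_def zero_less_measure_iff)
  qed
  finally show ?thesis .
qed

lemma null_between_atoms:
  assumes "A \<in> sets borel" "A \<subseteq> {0..l}" "A \<inter> atoms = {}" shows "measure M A = 0"
  using measure_atoms[of A] borel_in_sets[OF assms(1,2)] assms(3) by (simp add: Int_commute)

text \<open>
  The contact set is finite beyond \<open>a0\<close>, so there is no mass in a right neighbourhood of \<open>a0\<close>,
  whereas every such neighbourhood together with \<open>a0\<close> has positive mass.
\<close>

lemma a0_atom: "a0 \<in> atoms"
proof -
  have "finite (Z \<inter> {a0..l} - {a0})" using finite_Z by simp
  then obtain y where y: "a0 < y" "y \<le> l" "{a0<..<y} \<inter> Z = {}"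
  proof (cases "Z \<inter> {a0..l} - {a0} = {}")
    case True
    show ?thesis by (rule that[of l]) (use True a0_less in auto)
  next
    case False
    let ?y = "Min (Z \<inter> {a0..l} - {a0})"
    have fin: "finite (Z \<inter> {a0..l} - {a0})" using finite_Z by simp
    have "?y \<in> Z \<inter> {a0..l} - {a0}" using Min_in[OF fin False] .
    moreover have "{a0<..<?y} \<inter> Z = {}"
    proof (rule ccontr)
      assume "\<not> ?thesis"
      then obtain z where z: "a0 < z" "z < ?y" "z \<in> Z" by auto
      then have "z \<in> Z \<inter> {a0..l} - {a0}" using \<open>?y \<in> _\<close> by auto
      then show False using Min_le[OF fin, of z] z by simp
    qed
    ultimately show ?thesis by (intro that[of ?y]) auto
  qed
  have "measure M {a0<..<y} = 0" using y a0_range by (intro null_off_Z) auto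
  then have "0 < measure M {0..a0}" using measure_gap_start[of a0 y] y by simp
  also have "measure M {0..a0} = measure M {a0}"
  proof (rule measure_eq_AE)
    show "AE x in M. (x \<in> {0..a0}) = (x \<in> {a0})" using null_before by eventually_elim (use a0_range in auto)
  qed (use a0_range in \<open>auto intro!: borel_in_sets\<close>)
  finally show ?thesis using a0_range by (simp add: atoms_def)
qed

lemma atom_ge_a0: "x \<in> atoms \<Longrightarrow> a0 \<le> x"
  using atoms_subset by auto

text \<open>
  A contact point without mass inside the string would touch the line, against \<open>no_touch\<close>.
\<close>

lemma Z_before_end: "Z \<inter> {a0..<l} \<subseteq> atoms"
proof
  fix x assume x: "x \<in> Z \<inter> {a0..<l}"
  show "x \<in> atoms"
  proof (rule ccontr)
    assume na: "x \<notin> atoms"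
    then have ax: "a0 < x" using x a0_atom by (cases "x = a0") auto
    let ?S = "Z \<inter> {a0..<x}"
    have fin: "finite ?S" by (rule finite_subset[OF _ finite_Z]) (use x in auto)
    have ne: "?S \<noteq> {}" using a0_in_Z ax by auto
    let ?b = "Max ?S"
    have b: "?b \<in> ?S" by (rule Max_in[OF fin ne])
    have gap: "{?b<..<x} \<inter> Z = {}"
    proof (rule ccontr)
      assume "\<not> ?thesis"
      then obtain z where z: "?b < z" "z < x" "z \<in> Z" by auto
      then have "z \<in> ?S" using b by auto
      then show False using Max_ge[OF fin, of z] z by simp
    qed
    have "measure M {?b<..<x} = 0" using gap b x by (intro null_off_Z) (auto simp: Z_def)
    moreover have "measure M {x} = 0" using na x by (auto simp: atoms_def Z_def zero_less_measure_iff)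
    ultimately show False using no_touch[of ?b x] b x by auto
  qed
qed

lemma consecutive_atoms:
  assumes "x \<in> atoms" "y \<in> atoms" "x < y" "{x<..<y} \<inter> atoms = {}"
  shows "Im ((\<phi> y)\<^sup>2 * cnj p) < Im ((\<phi> x)\<^sup>2 * cnj p)"
    "c = 0 \<Longrightarrow> 0 < Im ((\<phi> x)\<^sup>2 * cnj p)" "c = 0 \<Longrightarrow> Im ((\<phi> y)\<^sup>2 * cnj p) < 0"
proof -
  have Z: "x \<in> Z" "y \<in> Z" "a0 \<le> x" "y \<le> l" using assms atoms_subset by auto
  have gap: "{x<..<y} \<inter> Z = {}" using Z_before_end assms(4) Z by fastforce
  note gc = gap_chord[OF Z(3) assms(3) Z(1,2) gap]
  note ch = chord[OF c_nonneg Z_value[OF Z(1)] Z_value[OF Z(2)] gc(2,3)]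
  show "Im ((\<phi> y)\<^sup>2 * cnj p) < Im ((\<phi> x)\<^sup>2 * cnj p)"
    "c = 0 \<Longrightarrow> 0 < Im ((\<phi> x)\<^sup>2 * cnj p)" "c = 0 \<Longrightarrow> Im ((\<phi> y)\<^sup>2 * cnj p) < 0"
    by (rule ch(2) ch(3) ch(4); assumption)+
qed

lemma affine_between:
  assumes "0 \<le> x" "x \<le> y" "y \<le> b" "b \<le> l" "{x<..<b} \<inter> atoms = {}"
  shows "\<phi> y = \<phi> x + of_real (y - x) * q x"
  using assms by (intro phi_gap[of x y b] null_between_atoms) auto

end

section \<open>First-order necessary conditions\<close>

text \<open>
  If the interior is empty, the set lies on a line through \<open>0\<close>; otherwise \<open>0\<close> is separated from the
  interior, whose closure contains the set.
\<close>

lemma convex_separation: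
  fixes D :: "complex set"
  assumes "convex D" "0 \<in> D" "0 \<notin> interior D"
  obtains p where "norm p = 1" "\<And>d. d \<in> D \<Longrightarrow> Re (d * cnj p) \<le> 0"
proof -
  obtain a where a: "a \<noteq> 0" "\<And>d. d \<in> D \<Longrightarrow> 0 \<le> a \<bullet> d"
  proof (cases "interior D = {}")
    case True
    obtain a b where ab: "a \<noteq> 0" "D \<subseteq> {x. a \<bullet> x = b}" by (rule empty_interior_subset_hyperplane[OF assms(1) True])
    then have "b = 0" using assms(2) by auto
    then show ?thesis using ab by (intro that[of a]) auto
  next
    case False
    obtain a where a: "a \<noteq> 0" "\<And>x. x \<in> interior D \<Longrightarrow> 0 \<le> a \<bullet> x"
      using separating_hyperplane_set_0[OF convex_interior[OF assms(1)] assms(3)] by blast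
    have "closure (interior D) \<subseteq> {x. 0 \<le> a \<bullet> x}"
    proof (rule closure_minimal)
      show "interior D \<subseteq> {x. 0 \<le> a \<bullet> x}" using a(2) by blast
      show "closed {x. 0 \<le> a \<bullet> x}" by (rule closed_halfspace_ge)
    qed
    then have "0 \<le> a \<bullet> d" if "d \<in> D" for d
      using that closure_subset convex_closure_interior[OF assms(1) False] by blast
    then show ?thesis using a that by blast
  qed
  show ?thesis
  proof (rule that[of "- a / of_real (norm a)"])
    show "norm (- a / of_real (norm a)) = 1" using a by (simp add: norm_divide)
    fix d assume "d \<in> D"
    then have "0 \<le> d \<bullet> a" using a(2) inner_commute[of d a] by metis
    then have "0 \<le> Re (d * cnj a) / norm a" by (simp only: inner_eq_Re) (simp add: divide_nonneg_nonneg)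
    moreover have "Re (d * cnj (- a / of_real (norm a))) = - (Re (d * cnj a) / norm a)"
      by (simp add: add_divide_distrib diff_divide_distrib)
    ultimately show "Re (d * cnj (- a / of_real (norm a))) \<le> 0" by linarith
  qed
qed

lemma admissible_mixture:
  assumes "\<mu> \<in> admissible l m" "\<nu> \<in> admissible l m" "0 \<le> s" "0 \<le> t" "s + t = 1"
  shows "(\<lambda>A. complex_of_real s * \<mu> A + complex_of_real t * \<nu> A) \<in> admissible l m"
proof -
  have "s * Re (\<mu> {0..l}) + t * Re (\<nu> {0..l}) \<le> s * m + t * m"
    using assms by (intro add_mono mult_left_mono) (auto simp: admissible_iff)
  also have "\<dots> = m" using assms(5) by (simp flip: distrib_right)
  finally show ?thesis using assms nonneg_mixture by (simp add: admissible_iff)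
qed

text \<open>
  The directions form a convex set containing \<open>0\<close>.  It is no neighbourhood of \<open>0\<close>, since \<open>\<omega>\<close> is a
  boundary point, so it lies in a half-plane; and it contains both \<open>v\<close> and \<open>- v\<close>.
\<close>

lemma first_order_condition:
  fixes S :: "real \<Rightarrow> real set \<Rightarrow> complex" and v \<omega> :: complex
  assumes l: "0 < l" and \<mu>0: "\<mu>0 \<in> admissible l m" and \<omega>: "string_F l \<omega> \<mu>0 = 0" "\<omega> \<noteq> 0"
    and \<phi>l: "string_phi l \<omega> \<mu>0 l \<noteq> 0"
    and S: "0 < \<tau>0" "\<And>\<tau>. \<bar>\<tau>\<bar> \<le> \<tau>0 \<Longrightarrow> S \<tau> \<in> admissible l m" "S 0 = \<mu>0"
    and K: "0 \<le> K" "\<And>\<tau> \<tau>'. \<bar>\<tau>\<bar> \<le> \<tau>0 \<Longrightarrow> \<bar>\<tau>'\<bar> \<le> \<tau>0 \<Longrightarrow> bl_close l (S \<tau>) (S \<tau>') (K * \<bar>\<tau> - \<tau>'\<bar>)"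
    and cont: "\<And>f. continuous_on {0..l} f \<Longrightarrow> isCont (\<lambda>\<tau>. cm_integral l (S \<tau>) f) 0"
    and first: "\<And>\<tau>. \<bar>\<tau>\<bar> \<le> \<tau>0 \<Longrightarrow> norm (string_F l \<omega> (S \<tau>) * string_phi l \<omega> \<mu>0 l + \<i> * \<omega> * of_real \<tau> * v) \<le> K * \<tau>\<^sup>2"
    and bd: "weak_star_local_boundary_point l m \<mu>0 \<omega>"
  obtains p where "norm p = 1"
    "\<And>\<nu>. \<nu> \<in> admissible l m \<Longrightarrow> Re (cm_integral l \<nu> (\<lambda>s. (string_phi l \<omega> \<mu>0 s)\<^sup>2) * cnj p)
        \<le> Re (cm_integral l \<mu>0 (\<lambda>s. (string_phi l \<omega> \<mu>0 s)\<^sup>2) * cnj p)"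
    "Re (v * cnj p) = 0"
proof -
  define h where "h s = (string_phi l \<omega> \<mu>0 s)\<^sup>2" for s
  have \<mu>0': "\<mu>0 \<in> nonneg_measures l" using \<mu>0 by (simp add: admissible_iff)
  have ch: "continuous_on {0..l} h" unfolding h_def by (intro continuous_intros continuous_on_string_phi[OF \<mu>0' l])
  define D where "D = {cm_integral l \<nu> h - cm_integral l \<mu>0 h + of_real x * v | \<nu> x. \<nu> \<in> admissible l m \<and> \<bar>x\<bar> \<le> (1::real)}"
  have DI: "cm_integral l \<nu> h - cm_integral l \<mu>0 h + of_real x * v \<in> D" if "\<nu> \<in> admissible l m" "\<bar>x\<bar> \<le> 1" for \<nu> x
    unfolding D_def using that by blast
  have "0 \<notin> interior D"
  proof
    assume "0 \<in> interior D"
    moreover obtain W where W: "openin (weak_star_topology l) W" "\<mu>0 \<in> W" "\<omega> \<in> frontier (quasi_eigenvalues_of l (admissible l m \<inter> W))"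
      using bd unfolding weak_star_local_boundary_point_def by blast
    ultimately have "\<omega> \<in> interior (quasi_eigenvalues_of l (admissible l m \<inter> W))"
      using perturbation_interior[OF l \<mu>0 \<omega> \<phi>l S K cont first] unfolding D_def h_def by blast
    then show False using W(3) by (simp add: frontier_def)
  qed
  moreover have "0 \<in> D" using DI[OF \<mu>0, of 0] by simp
  moreover have "convex D"
  proof (rule convexI)
    fix d e :: complex and s t :: real assume "d \<in> D" "e \<in> D" and st: "0 \<le> s" "0 \<le> t" "s + t = 1"
    then obtain \<nu> x \<nu>' x' where d: "d = cm_integral l \<nu> h - cm_integral l \<mu>0 h + of_real x * v" "\<nu> \<in> admissible l m" "\<bar>x\<bar> \<le> 1"
      and e: "e = cm_integral l \<nu>' h - cm_integral l \<mu>0 h + of_real x' * v" "\<nu>' \<in> admissible l m" "\<bar>x'\<bar> \<le> 1"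
      unfolding D_def by blast
    let ?\<nu> = "\<lambda>A. complex_of_real s * \<nu> A + complex_of_real t * \<nu>' A"
    have n: "\<nu> \<in> nonneg_measures l" "\<nu>' \<in> nonneg_measures l" using d e by (auto simp: admissible_iff)
    have c: "cm_integral l ?\<nu> h = of_real s * cm_integral l \<nu> h + of_real t * cm_integral l \<nu>' h"
      by (rule cm_integral_mixture[OF n st(1,2) l ch])
    have "\<bar>s * x + t * x'\<bar> \<le> s * \<bar>x\<bar> + t * \<bar>x'\<bar>"
      using st by (metis abs_mult abs_of_nonneg abs_triangle_ineq)
    also have "\<dots> \<le> s * 1 + t * 1" using d(3) e(3) st by (intro add_mono mult_left_mono) auto
    finally have "\<bar>s * x + t * x'\<bar> \<le> 1" using st(3) by simp
    from DI[OF admissible_mixture[OF d(2) e(2) st] this]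
    have "of_real s * cm_integral l \<nu> h + of_real t * cm_integral l \<nu>' h - cm_integral l \<mu>0 h + of_real (s * x + t * x') * v \<in> D"
      unfolding c .
    also have "of_real s * cm_integral l \<nu> h + of_real t * cm_integral l \<nu>' h - cm_integral l \<mu>0 h + of_real (s * x + t * x') * v
        = of_real s * d + of_real t * e"
    proof -
      have "cm_integral l \<mu>0 h = of_real (s + t) * cm_integral l \<mu>0 h" using st(3) by simp
      then show ?thesis unfolding d(1) e(1) by (simp add: algebra_simps)
    qed
    finally show "s *\<^sub>R d + t *\<^sub>R e \<in> D" by (simp add: scaleR_conv_of_real)
  qed
  ultimately obtain p where p: "norm p = 1" "\<And>d. d \<in> D \<Longrightarrow> Re (d * cnj p) \<le> 0" using convex_separation by blast
  show ?thesis
  proof (rule that[OF p(1)])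
    fix \<nu> assume "\<nu> \<in> admissible l m"
    then have "Re ((cm_integral l \<nu> h - cm_integral l \<mu>0 h + of_real 0 * v) * cnj p) \<le> 0" by (intro p(2) DI) auto
    then show "Re (cm_integral l \<nu> (\<lambda>s. (string_phi l \<omega> \<mu>0 s)\<^sup>2) * cnj p) \<le> Re (cm_integral l \<mu>0 (\<lambda>s. (string_phi l \<omega> \<mu>0 s)\<^sup>2) * cnj p)"
      unfolding h_def by (simp add: algebra_simps)
  next
    have "Re (v * cnj p) \<le> 0" using p(2)[OF DI[OF \<mu>0, of 1]] by simp
    moreover have "Re ((- v) * cnj p) \<le> 0" using p(2)[OF DI[OF \<mu>0, of "-1"]] by simp
    then have "0 \<le> Re (v * cnj p)" by simp
    ultimately show "Re (v * cnj p) = 0" by simp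
  qed
qed

lemma first_order_condition_fixed:
  assumes l: "0 < l" and \<mu>0: "\<mu>0 \<in> admissible l m" and \<omega>: "string_F l \<omega> \<mu>0 = 0" "\<omega> \<noteq> 0"
    and \<phi>l: "string_phi l \<omega> \<mu>0 l \<noteq> 0"
    and bd: "weak_star_local_boundary_point l m \<mu>0 \<omega>"
  obtains p where "norm p = 1"
    "\<And>\<nu>. \<nu> \<in> admissible l m \<Longrightarrow> Re (cm_integral l \<nu> (\<lambda>s. (string_phi l \<omega> \<mu>0 s)\<^sup>2) * cnj p)
        \<le> Re (cm_integral l \<mu>0 (\<lambda>s. (string_phi l \<omega> \<mu>0 s)\<^sup>2) * cnj p)"
proof (rule first_order_condition[OF l \<mu>0 \<omega> \<phi>l, of 1 "\<lambda>_. \<mu>0" 0 0])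
  show "norm (string_F l \<omega> \<mu>0 * string_phi l \<omega> \<mu>0 l + \<i> * \<omega> * of_real \<tau> * 0) \<le> 0 * \<tau>\<^sup>2" for \<tau> :: real using \<omega> by simp
qed (use assms that in \<open>auto simp: bl_close_def\<close>)

context string_measure begin

lemma kernel_propagate:
  assumes c: "continuous_on {0..l} (f :: real \<Rightarrow> complex)" and x: "0 \<le> x" "x \<le> y" "y \<le> l" and null: "measure M {x<..<y} = 0"
  shows "(\<integral>s. of_real (max 0 (y - s)) * f s \<partial>M)
      = (\<integral>s. of_real (max 0 (x - s)) * f s \<partial>M) + of_real (y - x) * integral_upto M f x"
proof -
  have "{x<..<y} \<in> sets M" using x by (intro borel_in_sets) auto
  then have "AE s in M. s \<notin> {x<..<y}" using null by (rule null_AE)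
  then have ae: "AE s in M. of_real (max 0 (y - s)) * f s = of_real (max 0 (x - s)) * f s + of_real (y - x) * (indicator {0..x} s * f s)"
    using AE_space
    by eventually_elim (use x in \<open>auto simp: indicator_def max_def space_M algebra_simps\<close>)
  have i: "integrable M (\<lambda>s. of_real (max 0 (y - s)) * f s)" "integrable M (\<lambda>s. of_real (max 0 (x - s)) * f s)" "integrable M (\<lambda>s. indicator {0..x} s * f s)"
    using integrable_kernel[OF c, of 1] integrable_upto[OF c] by simp_all
  have "(\<integral>s. of_real (max 0 (y - s)) * f s \<partial>M) = (\<integral>s. of_real (max 0 (x - s)) * f s + of_real (y - x) * (indicator {0..x} s * f s) \<partial>M)"
    using i by (intro integral_cong_AE ae borel_measurable_integrable) auto
  then show ?thesis using i by (simp add: integral_upto_def)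
qed

text \<open>
  Constant continuation beyond \<open>b\<close> reduces this to \<open>gronwall\<close>.
\<close>

lemma volterra_unique_initial:
  fixes f g :: "real \<Rightarrow> complex"
  assumes c: "continuous_on {0..l} f" "continuous_on {0..l} g" and b: "0 \<le> b" "b \<le> l"
    and f: "\<And>x. 0 \<le> x \<Longrightarrow> x \<le> b \<Longrightarrow> f x = 1 - \<kappa> * (\<integral>s. of_real (max 0 (x - s)) * f s \<partial>M)"
    and g: "\<And>x. 0 \<le> x \<Longrightarrow> x \<le> b \<Longrightarrow> g x = 1 - \<kappa> * (\<integral>s. of_real (max 0 (x - s)) * g s \<partial>M)"
    and x: "0 \<le> x" "x \<le> b"
  shows "f x = g x"
proof -
  define h where "h y = f (min y b) - g (min y b)" for y
  have ch: "continuous_on {0..l} h"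
    unfolding h_def using b by (intro continuous_intros continuous_on_compose2[OF c(1)] continuous_on_compose2[OF c(2)]) auto
  have le: "norm (h y) \<le> norm \<kappa> * (\<integral>s. max 0 (1 * (y - s)) * norm (h s) \<partial>M)" if y: "0 \<le> y" "y \<le> b" for y
  proof -
    have "h y = - \<kappa> * ((\<integral>s. of_real (max 0 (y - s)) * f s \<partial>M) - (\<integral>s. of_real (max 0 (y - s)) * g s \<partial>M))"
      using f[OF y] g[OF y] y by (simp add: h_def algebra_simps)
    also have "\<dots> = - \<kappa> * (\<integral>s. of_real (max 0 (y - s)) * f s - of_real (max 0 (y - s)) * g s \<partial>M)"
      using integrable_kernel[OF c(1), of 1 y] integrable_kernel[OF c(2), of 1 y] by simp
    also have "(\<integral>s. of_real (max 0 (y - s)) * f s - of_real (max 0 (y - s)) * g s \<partial>M) = (\<integral>s. of_real (max 0 (1 * (y - s))) * h s \<partial>M)"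
      using y by (intro Bochner_Integration.integral_cong refl) (auto simp: h_def max_def min_def algebra_simps)
    finally have "norm (h y) = norm \<kappa> * norm (\<integral>s. of_real (max 0 (1 * (y - s))) * h s \<partial>M)" by (simp add: norm_mult)
    then show ?thesis using norm_kernel_integral[OF ch, of 1 y] by (simp add: mult_left_mono)
  qed
  have "norm (h x) \<le> growth l (measure M {0..l}) (norm \<kappa>) * 0"
  proof (rule gronwall[where \<sigma>=1 and d="\<lambda>x. norm (h x)"])
    show "continuous_on {0..l} (\<lambda>x. norm (h x))" by (intro continuous_intros ch)
    fix y assume y: "y \<in> {0..l}"
    show "norm (h y) \<le> 0 + norm \<kappa> * (\<integral>s. max 0 (1 * (y - s)) * norm (h s) \<partial>M)"
    proof (cases "y \<le> b")
      case True then show ?thesis using le y by simp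
    next
      case False
      then have "norm (h y) = norm (h b)" by (simp add: h_def)
      also have "\<dots> \<le> norm \<kappa> * (\<integral>s. max 0 (1 * (b - s)) * norm (h s) \<partial>M)" by (rule le[OF b(1) order_refl])
      also have "\<dots> \<le> norm \<kappa> * (\<integral>s. max 0 (1 * (y - s)) * norm (h s) \<partial>M)"
      proof (rule mult_left_mono[OF integral_mono])
        show "integrable M (\<lambda>s. max 0 (1 * (b - s)) * norm (h s))" "integrable M (\<lambda>s. max 0 (1 * (y - s)) * norm (h s))"
          by (intro integrable_M continuous_intros ch)+
      qed (use False in \<open>auto intro!: mult_right_mono\<close>)
      finally show ?thesis by simp
    qed
  qed (use x b in auto)
  then show ?thesis using x by (simp add: h_def)
qed

end

text \<open>
  The solutions with the mass \<open>k\<close> at \<open>b\<close> and at \<open>b'\<close> agree up to \<open>b\<close>.  Between the two positions both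
  are linear, and only the one with the mass at \<open>b\<close> has changed its slope.
\<close>

lemma string_phi_two_positions:
  fixes z :: complex
  assumes R: "R \<in> nonneg_measures l" and l: "0 < l" and k: "0 \<le> k" and b: "0 \<le> b" "b < b'" "b' \<le> l"
    and null: "measure (lib_measure l R) {b<..<b'} = 0"
  defines "f \<equiv> string_phi l z (\<lambda>A. complex_of_real 1 * R A + complex_of_real k * point_mass l b A)"
    and "g \<equiv> string_phi l z (\<lambda>A. complex_of_real 1 * R A + complex_of_real k * point_mass l b' A)"
  shows "0 \<le> x \<Longrightarrow> x \<le> b \<Longrightarrow> f x = g x"
    and "g b' = g b + of_real (b' - b) * (- (z\<^sup>2) * integral_upto (lib_measure l R) g b)"
    and "f b' = g b + of_real (b' - b) * (- (z\<^sup>2) * integral_upto (lib_measure l R) g b - z\<^sup>2 * k * g b)"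
proof -
  interpret string_measure "lib_measure l R" l by (rule string_measure_lib[OF R l])
  let ?M = "lib_measure l R"
  have eq: "continuous_on {0..l} (string_phi l z (\<lambda>A. complex_of_real 1 * R A + complex_of_real k * point_mass l a A))"
      "\<And>x. x \<in> {0..l} \<Longrightarrow> string_phi l z (\<lambda>A. complex_of_real 1 * R A + complex_of_real k * point_mass l a A) x
      = 1 - z\<^sup>2 * ((\<integral>s. of_real (max 0 (x - s)) * string_phi l z (\<lambda>A. complex_of_real 1 * R A + complex_of_real k * point_mass l a A) s \<partial>?M)
         + of_real k * (of_real (max 0 (x - a)) * string_phi l z (\<lambda>A. complex_of_real 1 * R A + complex_of_real k * point_mass l a A) a))"
    if a: "a \<in> {0..l}" for a
  proof -
    let ?N = "\<lambda>A. complex_of_real 1 * R A + complex_of_real k * point_mass l a A"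
    have N: "?N \<in> nonneg_measures l" using k by (intro nonneg_mixture R point_mass_nonneg) auto
    show c: "continuous_on {0..l} (string_phi l z ?N)" by (rule continuous_on_string_phi[OF N l])
    fix x assume x: "x \<in> {0..l}"
    have ck: "continuous_on {0..l} (\<lambda>s. of_real (max 0 (x - s)) * string_phi l z ?N s)" by (intro continuous_intros c)
    have "string_phi l z ?N x = 1 - z\<^sup>2 * cm_integral l ?N (\<lambda>s. of_real (max 0 (x - s)) * string_phi l z ?N s)"
      unfolding cm_integral_nonneg[OF N l] using string_phi_eq[OF N l, of z] x unfolding string_eq_def by blast
    also have "cm_integral l ?N (\<lambda>s. of_real (max 0 (x - s)) * string_phi l z ?N s)
        = of_real 1 * cm_integral l R (\<lambda>s. of_real (max 0 (x - s)) * string_phi l z ?N s)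
          + of_real k * cm_integral l (point_mass l a) (\<lambda>s. of_real (max 0 (x - s)) * string_phi l z ?N s)"
      using k by (intro cm_integral_mixture R point_mass_nonneg l ck) auto
    finally show "string_phi l z ?N x = 1 - z\<^sup>2 * ((\<integral>s. of_real (max 0 (x - s)) * string_phi l z ?N s \<partial>?M)
         + of_real k * (of_real (max 0 (x - a)) * string_phi l z ?N a))"
      unfolding cm_integral_point_mass[OF a l ck] cm_integral_nonneg[OF R l] by simp
  qed
  have rb: "b \<in> {0..l}" "b' \<in> {0..l}" using b by auto
  note fe = eq(2)[OF rb(1), folded f_def] and ge = eq(2)[OF rb(2), folded g_def]
  note cf = eq(1)[OF rb(1), folded f_def] and cg = eq(1)[OF rb(2), folded g_def]
  have fg: "f x = g x" if "0 \<le> x" "x \<le> b" for x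
  proof (rule volterra_unique_initial[OF cf cg b(1) _ _ _ that, where \<kappa>="z\<^sup>2"])
    show "b \<le> l" using b by simp
    fix x assume x: "0 \<le> x" "x \<le> b"
    show "f x = 1 - z\<^sup>2 * (\<integral>s. of_real (max 0 (x - s)) * f s \<partial>?M)" using fe[of x] x b by simp
    show "g x = 1 - z\<^sup>2 * (\<integral>s. of_real (max 0 (x - s)) * g s \<partial>?M)" using ge[of x] x b by simp
  qed
  show "f x = g x" if "0 \<le> x" "x \<le> b" using fg that .
  have up: "integral_upto ?M f b = integral_upto ?M g b" by (rule integral_upto_cong) (use fg in auto)
  have gb: "g b = 1 - z\<^sup>2 * (\<integral>s. of_real (max 0 (b - s)) * g s \<partial>?M)" using ge[of b] b by simp
  have fb: "g b = 1 - z\<^sup>2 * (\<integral>s. of_real (max 0 (b - s)) * f s \<partial>?M)" using fe[of b] fg[of b] b by simp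
  have gb': "g b' = 1 - z\<^sup>2 * (\<integral>s. of_real (max 0 (b' - s)) * g s \<partial>?M)" using ge[of b'] b by simp
  have fb': "f b' = 1 - z\<^sup>2 * ((\<integral>s. of_real (max 0 (b' - s)) * f s \<partial>?M) + of_real k * (of_real (b' - b) * g b))"
    using fe[of b'] fg[of b] b by (simp add: max_def)
  note kp = kernel_propagate[OF _ b(1) less_imp_le[OF b(2)] b(3) null]
  show "g b' = g b + of_real (b' - b) * (- (z\<^sup>2) * integral_upto ?M g b)"
    unfolding gb' kp[OF cg] by (subst gb) (simp only: ring_distribs, simp add: mult_ac)
  show "f b' = g b + of_real (b' - b) * (- (z\<^sup>2) * integral_upto ?M g b - z\<^sup>2 * k * g b)"
  proof -
    define A where "A = (\<integral>s. of_real (max 0 (b - s)) * f s \<partial>?M)"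
    have "f b' = (1 - z\<^sup>2 * A) - z\<^sup>2 * (of_real (b' - b) * integral_upto ?M g b + of_real k * (of_real (b' - b) * g b))"
      unfolding fb' kp[OF cf] up A_def[symmetric] by (simp add: algebra_simps)
    also have "1 - z\<^sup>2 * A = g b" unfolding A_def by (rule fb[symmetric])
    finally show ?thesis by (simp add: algebra_simps)
  qed
qed


text \<open>
  Here \<open>d\<close> is the left derivative of \<open>\<phi>\<close> at the mass, so \<open>2 * d - \<omega>\<^sup>2 * k * \<phi> a\<close> is the sum of the two
  one-sided derivatives.  The curve \<open>S\<close> moves the mass from \<open>a\<close> to \<open>a + \<tau>\<close>.  By Green's identity its effect
  is \<open>k\<close> times the increment of \<open>\<phi> * \<psi>\<close> from \<open>a\<close> to \<open>a + \<tau>\<close>, where \<open>\<psi>\<close> belongs to the moved mass.  Of the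
  two factors one moves with the left derivative and the other one with the right derivative, for either
  sign of \<open>\<tau>\<close>, so that the two one-sided directions are opposite.
\<close>

lemma first_order_condition_shift:
  assumes l: "0 < l" and \<mu>0: "\<mu>0 \<in> admissible l m" and \<omega>: "string_F l \<omega> \<mu>0 = 0" "\<omega> \<noteq> 0"
    and \<phi>l: "string_phi l \<omega> \<mu>0 l \<noteq> 0"
    and bd: "weak_star_local_boundary_point l m \<mu>0 \<omega>"
    and a: "0 < \<epsilon>" "0 \<le> a - \<epsilon>" "a + \<epsilon> \<le> l"
    and null: "measure (lib_measure l \<mu>0) {a - \<epsilon><..<a} = 0" "measure (lib_measure l \<mu>0) {a<..<a + \<epsilon>} = 0"
  defines "\<phi> \<equiv> string_phi l \<omega> \<mu>0" and "k \<equiv> measure (lib_measure l \<mu>0) {a}"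
  obtains p d where "norm p = 1"
    "\<And>\<nu>. \<nu> \<in> admissible l m \<Longrightarrow> Re (cm_integral l \<nu> (\<lambda>s. (\<phi> s)\<^sup>2) * cnj p)
        \<le> Re (cm_integral l \<mu>0 (\<lambda>s. (\<phi> s)\<^sup>2) * cnj p)"
    "\<And>b. a - \<epsilon> < b \<Longrightarrow> b < a \<Longrightarrow> \<phi> a = \<phi> b + of_real (a - b) * d"
    "Re (of_real k * (\<phi> a * (2 * d - \<omega>\<^sup>2 * of_real k * \<phi> a)) * cnj p) = 0"
proof -
  have \<mu>0': "\<mu>0 \<in> nonneg_measures l" using \<mu>0 by (simp add: admissible_iff)
  interpret M0: string_measure "lib_measure l \<mu>0" l by (rule string_measure_lib[OF \<mu>0' l])
  have k0: "0 \<le> k" by (simp add: k_def)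
  have a0l: "0 < a" "a < l" using a by auto
  have ab: "{a} \<in> borel_subsets l" using a0l by (auto simp: borel_subsets_def)
  \<comment> \<open>the measure without the atom at \<open>a\<close>\<close>
  define R where "R A = \<mu>0 A - complex_of_real k * point_mass l a A" for A
  have R: "R \<in> nonneg_measures l"
  proof -
    have c: "\<mu>0 \<in> complex_measures l" "point_mass l a \<in> complex_measures l"
      using \<mu>0' point_mass_nonneg by (auto simp: nonneg_measures_def)
    have "R \<in> complex_measures l"
      using c unfolding complex_measures_def R_def by (auto intro!: sums_diff sums_mult)
    moreover have "R A \<in> \<real> \<and> 0 \<le> Re (R A)" if A: "A \<in> borel_subsets l" for A
    proof -
      have real: "\<mu>0 A \<in> \<real>" "0 \<le> Re (\<mu>0 A)" using \<mu>0' A by (auto simp: nonneg_measures_def)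
      have "k \<le> Re (\<mu>0 A)" if "a \<in> A"
        unfolding measure_lib(1)[OF \<mu>0' l A, symmetric] k_def
        by (rule M0.finite_measure_mono) (use that A M0.sets_M_iff in auto)
      then show ?thesis using real by (auto simp: R_def point_mass_def)
    qed
    ultimately show ?thesis by (simp add: nonneg_measures_def)
  qed
  interpret R: string_measure "lib_measure l R" l by (rule string_measure_lib[OF R l])
  have Rnull: "measure (lib_measure l R) B = 0" if B: "B \<in> borel_subsets l" "B \<subseteq> {a - \<epsilon><..<a + \<epsilon>}" for B
  proof -
    define B1 B2 where "B1 = {a - \<epsilon><..<a}" and "B2 = {a<..<a + \<epsilon>}"
    have i: "B1 \<in> borel_subsets l" "B2 \<in> borel_subsets l"
      using a by (auto simp: borel_subsets_def B1_def B2_def)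
    have z: "measure (lib_measure l R) B1 = 0" "measure (lib_measure l R) B2 = 0"
      unfolding measure_lib(1)[OF R l i(1)] measure_lib(1)[OF R l i(2)] using null i
      by (simp_all add: R_def point_mass_def measure_lib(1)[OF \<mu>0' l i(1)] measure_lib(1)[OF \<mu>0' l i(2)] flip: B1_def B2_def) (auto simp: B1_def B2_def)
    have za: "measure (lib_measure l R) {a} = 0"
      unfolding measure_lib(1)[OF R l ab] using ab measure_lib(1)[OF \<mu>0' l ab] by (simp add: R_def point_mass_def k_def)
    have sub: "B \<subseteq> B1 \<union> ({a} \<union> B2)" using B(2) by (auto simp: B1_def B2_def)
    have sets: "B1 \<in> sets (lib_measure l R)" "{a} \<in> sets (lib_measure l R)" "B2 \<in> sets (lib_measure l R)"
      using i ab by (simp_all only: R.sets_M_iff)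
    have "measure (lib_measure l R) B \<le> measure (lib_measure l R) (B1 \<union> ({a} \<union> B2))"
      by (rule R.finite_measure_mono[OF sub]) (intro sets.Un sets)
    also have "\<dots> \<le> measure (lib_measure l R) B1 + (measure (lib_measure l R) {a} + measure (lib_measure l R) B2)"
      using measure_Un_le[OF sets(1) sets.Un[OF sets(2,3)]] measure_Un_le[OF sets(2,3)] by linarith
    finally show ?thesis using z za by (simp add: measure_le_0_iff)
  qed
  define S where "S \<tau> = (\<lambda>A. complex_of_real 1 * R A + complex_of_real k * point_mass l (a + \<tau>) A)" for \<tau>
  have S0: "S 0 = \<mu>0" by (simp add: S_def R_def)
  have inl: "a + \<tau> \<in> {0..l}" if "\<bar>\<tau>\<bar> \<le> \<epsilon> / 2" for \<tau> using a that by auto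
  have Sn: "S \<tau> \<in> nonneg_measures l" for \<tau> unfolding S_def using k0 by (intro nonneg_mixture R point_mass_nonneg) auto
  have Sint: "cm_integral l (S \<tau>) f = cm_integral l R f + of_real k * f (a + \<tau>)" if "\<bar>\<tau>\<bar> \<le> \<epsilon> / 2" "continuous_on {0..l} f" for \<tau> f
    unfolding S_def using cm_integral_mixture[OF R point_mass_nonneg zero_le_one k0 l that(2)]
    by (simp add: cm_integral_point_mass[OF inl[OF that(1)] l that(2)])
  have Sadm: "S \<tau> \<in> admissible l m" if \<tau>: "\<bar>\<tau>\<bar> \<le> \<epsilon> / 2" for \<tau>
  proof -
    have "S \<tau> {0..l} = \<mu>0 {0..l}"
      using inl[OF \<tau>] a0l interval_borel_subset by (simp add: S_def R_def point_mass_def)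
    then show ?thesis using Sn \<mu>0 by (simp add: admissible_iff)
  qed
  define d where "d = - (\<omega>\<^sup>2) * integral_upto (lib_measure l R) \<phi> a"
  define u where "u = \<phi> a"
  define v where "v = of_real k * (u * (2 * d - \<omega>\<^sup>2 * of_real k * u))"
  define X where "X = norm \<omega> * (k * norm (d * (d - \<omega>\<^sup>2 * of_real k * u)))"
  have c\<phi>: "continuous_on {0..l} \<phi>" unfolding \<phi>_def by (rule continuous_on_string_phi[OF \<mu>0' l])
  have upto: "integral_upto (lib_measure l R) \<phi> b = integral_upto (lib_measure l R) \<phi> a" if b: "a - \<epsilon> < b" "b < a" for b
  proof -
    have "measure (lib_measure l R) {b<..<a} = 0" "measure (lib_measure l R) {a} = 0"
      using b a by (auto intro!: Rnull simp: borel_subsets_def)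
    then show ?thesis using R.integral_upto_jump[OF c\<phi>, of b a] b a by simp
  qed
  have left: "\<phi> a = \<phi> b + of_real (a - b) * d" if b: "a - \<epsilon> < b" "b < a" for b
  proof -
    have n: "measure (lib_measure l R) {b<..<a} = 0" using b a by (intro Rnull) (auto simp: borel_subsets_def)
    have "S 0 = (\<lambda>A. complex_of_real 1 * R A + complex_of_real k * point_mass l a A)" by (simp add: S_def)
    then have e: "\<phi> = string_phi l \<omega> (\<lambda>A. complex_of_real 1 * R A + complex_of_real k * point_mass l a A)"
      unfolding \<phi>_def S0 by simp
    show ?thesis using string_phi_two_positions(2)[OF R l k0 _ b(2) _ n, where z=\<omega>] b a upto[OF b] unfolding d_def e[symmetric] by simp
  qed
  have first: "norm (string_F l \<omega> (S \<tau>) * \<phi> l + \<i> * \<omega> * of_real \<tau> * v) \<le> X * \<tau>\<^sup>2" if \<tau>: "\<bar>\<tau>\<bar> \<le> \<epsilon> / 2" for \<tau>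
  proof -
    define \<psi> where "\<psi> = string_phi l \<omega> (S \<tau>)"
    have c\<psi>: "continuous_on {0..l} \<psi>" unfolding \<psi>_def by (rule continuous_on_string_phi[OF Sn l])
    have ch: "continuous_on {0..l} (\<lambda>s. \<phi> s * \<psi> s)" by (intro continuous_intros c\<phi> c\<psi>)
    have z: "\<bar>0\<bar> \<le> \<epsilon> / 2" using a by simp
    have F: "string_F l \<omega> (S \<tau>) * \<phi> l = - \<i> * \<omega> * (of_real k * (\<phi> (a + \<tau>) * \<psi> (a + \<tau>) - \<phi> a * \<psi> a))"
      using string_F_difference[OF \<mu>0' Sn l, of \<omega> \<tau>] Sint[OF \<tau> ch] Sint[OF z ch]
      unfolding S0 \<phi>_def[symmetric] \<psi>_def[symmetric] by (simp add: \<omega> algebra_simps)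
    have P: "\<phi> (a + \<tau>) * \<psi> (a + \<tau>) - \<phi> a * \<psi> a = of_real \<tau> * (u * (2 * d - \<omega>\<^sup>2 * of_real k * u)) + of_real (\<tau>\<^sup>2) * (d * (d - \<omega>\<^sup>2 * of_real k * u))"
    proof -
      consider "\<tau> = 0" | "0 < \<tau>" | "\<tau> < 0" by linarith
      then show ?thesis
      proof cases
        case 1 then show ?thesis by (simp add: \<psi>_def S0 \<phi>_def)
      next
        case 2
        have n: "measure (lib_measure l R) {a<..<a + \<tau>} = 0" using 2 \<tau> a by (intro Rnull) (auto simp: borel_subsets_def)
        have e: "\<phi> = string_phi l \<omega> (\<lambda>A. complex_of_real 1 * R A + complex_of_real k * point_mass l a A)"
          using S0 unfolding \<phi>_def S_def by simp
        have e': "\<psi> = string_phi l \<omega> (\<lambda>A. complex_of_real 1 * R A + complex_of_real k * point_mass l (a + \<tau>) A)"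
          by (simp add: \<psi>_def S_def)
        have r: "0 \<le> a" "a < a + \<tau>" "a + \<tau> \<le> l" using 2 \<tau> a by auto
        note tp = string_phi_two_positions[OF R l k0 r n, where z=\<omega>, folded e e']
        have eqs: "\<phi> x = \<psi> x" if "0 \<le> x" "x \<le> a" for x by (rule tp(1)[OF that])
        have up: "integral_upto (lib_measure l R) \<psi> a = integral_upto (lib_measure l R) \<phi> a"
          by (rule R.integral_upto_cong) (use eqs in auto)
        have pa: "\<psi> a = u" using eqs[of a] a0l by (simp add: u_def)
        have p1: "\<psi> (a + \<tau>) = u + of_real \<tau> * d" using tp(2) unfolding up pa d_def by simp
        have p2: "\<phi> (a + \<tau>) = u + of_real \<tau> * (d - \<omega>\<^sup>2 * of_real k * u)" using tp(3) unfolding up pa d_def by simp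
        show ?thesis unfolding p1 p2 pa u_def[symmetric] by (simp add: power2_eq_square algebra_simps)
      next
        case 3
        define b where "b = a + \<tau>"
        have b: "a - \<epsilon> < b" "b < a" "0 \<le> b" using 3 \<tau> a by (auto simp: b_def)
        have n: "measure (lib_measure l R) {b<..<a} = 0" using b a by (intro Rnull) (auto simp: borel_subsets_def)
        have e: "\<phi> = string_phi l \<omega> (\<lambda>A. complex_of_real 1 * R A + complex_of_real k * point_mass l a A)"
          using S0 unfolding \<phi>_def S_def by simp
        have e': "\<psi> = string_phi l \<omega> (\<lambda>A. complex_of_real 1 * R A + complex_of_real k * point_mass l b A)"
          by (simp add: \<psi>_def S_def b_def)
        note tp = string_phi_two_positions[OF R l k0 b(3) b(2) less_imp_le[OF a0l(2)] n, where z=\<omega>, folded e e']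
        have pb: "\<psi> b = \<phi> b" using tp(1)[of b] b by simp
        have t: "a - b = - \<tau>" by (simp add: b_def)
        have ub: "\<phi> b = u + of_real \<tau> * d" using left[OF b(1,2)] unfolding t u_def[symmetric] by (simp add: algebra_simps)
        have p1: "\<psi> a = \<phi> b + of_real (- \<tau>) * (d - \<omega>\<^sup>2 * of_real k * \<phi> b)" using tp(3) upto[OF b(1,2)] unfolding t d_def by simp
        show ?thesis unfolding b_def[symmetric] p1 pb u_def[symmetric] ub by (simp add: power2_eq_square algebra_simps)
      qed
    qed
    have "string_F l \<omega> (S \<tau>) * \<phi> l + \<i> * \<omega> * of_real \<tau> * v = - (\<i> * \<omega> * (of_real k * (of_real (\<tau>\<^sup>2) * (d * (d - \<omega>\<^sup>2 * of_real k * u)))))"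
      unfolding F P v_def by (simp add: algebra_simps)
    then have "norm (string_F l \<omega> (S \<tau>) * \<phi> l + \<i> * \<omega> * of_real \<tau> * v) = norm \<omega> * (k * (\<tau>\<^sup>2 * norm (d * (d - \<omega>\<^sup>2 * of_real k * u))))"
      using k0 by (simp only: norm_minus_cancel norm_mult norm_of_real norm_ii mult_1_left abs_of_nonneg zero_le_power2)
    then show ?thesis by (simp add: X_def mult_ac)
  qed
  define K where "K = k + X"
  have K: "0 \<le> K" "k \<le> K" "X \<le> K" using k0 by (auto simp: K_def X_def)
  have first': "norm (string_F l \<omega> (S \<tau>) * string_phi l \<omega> \<mu>0 l + \<i> * \<omega> * of_real \<tau> * v) \<le> K * \<tau>\<^sup>2" if "\<bar>\<tau>\<bar> \<le> \<epsilon> / 2" for \<tau>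
    using first[OF that] mult_right_mono[OF K(3), of "\<tau>\<^sup>2"] unfolding \<phi>_def by (meson order_trans zero_le_power2)
  have bl: "bl_close l (S \<tau>) (S \<tau>') (K * \<bar>\<tau> - \<tau>'\<bar>)" if t: "\<bar>\<tau>\<bar> \<le> \<epsilon> / 2" "\<bar>\<tau>'\<bar> \<le> \<epsilon> / 2" for \<tau> \<tau>'
    unfolding bl_close_def
  proof (intro allI impI, elim conjE)
    fix f :: "real \<Rightarrow> complex" and B :: real
    assume fb: "\<forall>s\<in>{0..l}. norm (f s) \<le> B" and fl: "\<forall>s\<in>{0..l}. \<forall>t\<in>{0..l}. norm (f s - f t) \<le> B * \<bar>s - t\<bar>"
    have B: "0 \<le> B" using order_trans[OF norm_ge_zero fb[rule_format, of 0]] l by simp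
    have f: "continuous_on {0..l} f"
      by (rule lipschitz_on_continuous_on[where L=B]) (use fl B in \<open>auto simp: lipschitz_on_def dist_norm dist_real_def\<close>)
    have "cm_integral l (S \<tau>) f - cm_integral l (S \<tau>') f = of_real k * (f (a + \<tau>) - f (a + \<tau>'))"
      unfolding Sint[OF t(1) f] Sint[OF t(2) f] by (simp add: algebra_simps)
    then have "norm (cm_integral l (S \<tau>) f - cm_integral l (S \<tau>') f) = k * norm (f (a + \<tau>) - f (a + \<tau>'))"
      using k0 by (simp add: norm_mult)
    also have "\<dots> \<le> K * (B * \<bar>(a + \<tau>) - (a + \<tau>')\<bar>)"
      using K k0 by (intro mult_mono fl[rule_format, OF inl[OF t(1)] inl[OF t(2)]]) auto
    finally show "norm (cm_integral l (S \<tau>) f - cm_integral l (S \<tau>') f) \<le> K * \<bar>\<tau> - \<tau>'\<bar> * B" by (simp add: mult_ac)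
  qed
  have cont: "isCont (\<lambda>\<tau>. cm_integral l (S \<tau>) f) 0" if f: "continuous_on {0..l} f" for f
  proof -
    have "continuous_on {0<..<l} f" using f by (rule continuous_on_subset) auto
    then have fa: "isCont f (a + 0)" using a0l by (simp add: continuous_on_eq_continuous_at)
    have "isCont (\<lambda>\<tau>. f (a + \<tau>)) 0" by (rule isCont_o2[where f="\<lambda>\<tau>. a + \<tau>" and g=f, OF _ fa]) (intro continuous_intros)
    then have c: "isCont (\<lambda>\<tau>. cm_integral l R f + of_real k * f (a + \<tau>)) 0" by (intro continuous_intros)
    have "\<forall>\<^sub>F \<tau> in nhds 0. \<bar>\<tau>\<bar> \<le> \<epsilon> / 2"
      using a unfolding eventually_nhds_metric by (intro exI[of _ "\<epsilon> / 2"]) (auto simp: dist_real_def)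
    then have "\<forall>\<^sub>F \<tau> in nhds 0. cm_integral l (S \<tau>) f = cm_integral l R f + of_real k * f (a + \<tau>)"
      by eventually_elim (rule Sint[OF _ f])
    from isCont_cong[OF this] c show ?thesis by blast
  qed
  have e2: "0 < \<epsilon> / 2" using a by simp
  show ?thesis
  proof (rule first_order_condition[OF l \<mu>0 \<omega> \<phi>l e2 Sadm S0 K(1) bl cont first' bd])
    fix p assume p: "norm p = 1" "\<And>\<nu>. \<nu> \<in> admissible l m \<Longrightarrow> Re (cm_integral l \<nu> (\<lambda>s. (string_phi l \<omega> \<mu>0 s)\<^sup>2) * cnj p)
        \<le> Re (cm_integral l \<mu>0 (\<lambda>s. (string_phi l \<omega> \<mu>0 s)\<^sup>2) * cnj p)" "Re (v * cnj p) = 0"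
    show thesis
      by (rule that[OF p(1) p(2)[folded \<phi>_def] left p(3)[unfolded v_def u_def]])
  qed
qed

lemma resonance_lib:
  assumes "0 < l" "\<mu> \<in> admissible l m" "\<omega> \<in> quasi_eigenvalues l \<mu>" "0 < Re \<omega>"
  shows "resonance (lib_measure l \<mu>) l \<omega> (string_phi l \<omega> \<mu>)"
proof -
  have \<mu>: "\<mu> \<in> nonneg_measures l" using assms by (simp add: admissible_iff)
  show ?thesis
  proof (intro resonance.intro resonance_axioms.intro string_measure_lib[OF \<mu> assms(1)] string_phi_eq[OF \<mu> assms(1)] assms(4))
    show "string_phi l \<omega> \<mu> l = \<i> * \<omega> * (\<integral>s. string_phi l \<omega> \<mu> s \<partial>lib_measure l \<mu>)"
      using assms(3) by (simp add: quasi_eigenvalues_def string_F_def cm_integral_nonneg[OF \<mu> assms(1)])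
  qed
qed

text \<open>
  Testing the first-order condition with \<open>m\<close> times a point mass bounds \<open>Re ((\<phi> x)\<^sup>2 * cnj p)\<close> by
  \<open>c = I / m\<close>, where \<open>I\<close> is the value of the functional at \<open>\<mu>\<close>; the zero measure gives \<open>c \<ge> 0\<close>.  Then
  \<open>c m = I \<le> c |\<mu>| \<le> c m\<close> must be equalities, so that the bound is attained almost everywhere and
  \<open>c = 0\<close> unless the mass constraint is active.
\<close>

lemma extremal_lib:
  assumes l: "0 < l" and m: "0 < m" and \<mu>: "\<mu> \<in> admissible l m" and \<omega>: "\<omega> \<in> quasi_eigenvalues l \<mu>" "0 < Re \<omega>"
    and p: "norm p = 1" and opt: "\<And>\<nu>. \<nu> \<in> admissible l m \<Longrightarrow> Re (cm_integral l \<nu> (\<lambda>s. (string_phi l \<omega> \<mu> s)\<^sup>2) * cnj p)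
        \<le> Re (cm_integral l \<mu> (\<lambda>s. (string_phi l \<omega> \<mu> s)\<^sup>2) * cnj p)"
  shows "extremal (lib_measure l \<mu>) l \<omega> (string_phi l \<omega> \<mu>) p (Re p)"
    and "Re (cm_integral l \<mu> (\<lambda>s. (string_phi l \<omega> \<mu> s)\<^sup>2) * cnj p) = m * Re p"
    and "measure (lib_measure l \<mu>) {0..l} < m \<Longrightarrow> Re p = 0"
proof -
  have \<mu>': "\<mu> \<in> nonneg_measures l" using \<mu> by (simp add: admissible_iff)
  interpret resonance "lib_measure l \<mu>" l \<omega> "string_phi l \<omega> \<mu>" by (rule resonance_lib[OF l \<mu> \<omega>])
  let ?\<phi> = "string_phi l \<omega> \<mu>" and ?M = "lib_measure l \<mu>"
  define I where "I = Re (cm_integral l \<mu> (\<lambda>s. (?\<phi> s)\<^sup>2) * cnj p)"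
  define c where "c = I / m"
  have ch: "continuous_on {0..l} (\<lambda>s. (?\<phi> s)\<^sup>2)" by (intro continuous_intros cont_phi)
  \<comment> \<open>The zero measure is written as a mixture so that \<open>cm_integral_mixture\<close> evaluates it.\<close>
  have zero: "(\<lambda>A. complex_of_real 0 * point_mass l 0 A + complex_of_real 0 * point_mass l 0 A) \<in> nonneg_measures l"
    by (intro nonneg_mixture point_mass_nonneg) auto
  have "(\<lambda>A. complex_of_real 0 * point_mass l 0 A + complex_of_real 0 * point_mass l 0 A) \<in> admissible l m"
    using zero m by (simp add: admissible_iff)
  from opt[OF this] have I0: "0 \<le> I"
    unfolding cm_integral_mixture[OF point_mass_nonneg point_mass_nonneg order_refl order_refl l ch] I_def by simp
  then have c0: "0 \<le> c" using m by (simp add: c_def)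
  have le: "Re ((?\<phi> x)\<^sup>2 * cnj p) \<le> c" if x: "x \<in> {0..l}" for x
  proof -
    have m0: "0 \<le> m" using m by simp
    have n: "(\<lambda>A. complex_of_real m * point_mass l x A + complex_of_real 0 * point_mass l 0 A) \<in> nonneg_measures l"
      using m by (intro nonneg_mixture point_mass_nonneg) auto
    have "(\<lambda>A. complex_of_real m * point_mass l x A + complex_of_real 0 * point_mass l 0 A) \<in> admissible l m"
      using n x interval_borel_subset by (simp add: admissible_iff point_mass_def)
    from opt[OF this] have "Re (of_real m * ((?\<phi> x)\<^sup>2 * cnj p)) \<le> I"
      unfolding cm_integral_mixture[OF point_mass_nonneg point_mass_nonneg m0 order_refl l ch] cm_integral_point_mass[OF x l ch] I_def
      by (simp only: of_real_0 mult_zero_left add_0_right mult.assoc)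
    then show ?thesis using m unfolding Re_of_real_mult c_def by (simp only: pos_le_divide_eq) (simp add: mult.commute)
  qed
  have cg: "continuous_on {0..l} (\<lambda>s. c - Re ((?\<phi> s)\<^sup>2 * cnj p))" by (intro continuous_intros cont_phi)
  have int: "(\<integral>s. c - Re ((?\<phi> s)\<^sup>2 * cnj p) \<partial>?M) = c * measure ?M {0..l} - I"
  proof -
    have i: "integrable ?M (\<lambda>s. (?\<phi> s)\<^sup>2 * cnj p)" by (intro integrable_M continuous_intros cont_phi)
    have "(\<integral>s. c - Re ((?\<phi> s)\<^sup>2 * cnj p) \<partial>?M) = (\<integral>s. c \<partial>?M) - (\<integral>s. Re ((?\<phi> s)\<^sup>2 * cnj p) \<partial>?M)"
      by (rule Bochner_Integration.integral_diff[OF _ integrable_Re[OF i]]) simp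
    also have "(\<integral>s. Re ((?\<phi> s)\<^sup>2 * cnj p) \<partial>?M) = Re (\<integral>s. (?\<phi> s)\<^sup>2 * cnj p \<partial>?M)" by (rule Bochner_Integration.integral_Re[OF i])
    also have "(\<integral>s. (?\<phi> s)\<^sup>2 * cnj p \<partial>?M) = (\<integral>s. (?\<phi> s)\<^sup>2 \<partial>?M) * cnj p" by (rule integral_mult_left_zero)
    finally show ?thesis unfolding I_def cm_integral_nonneg[OF \<mu>' l] by (simp add: space_M)
  qed
  have nn: "AE s in ?M. 0 \<le> c - Re ((?\<phi> s)\<^sup>2 * cnj p)"
    using AE_space by eventually_elim (use le in \<open>simp add: space_M\<close>)
  have "0 \<le> (\<integral>s. c - Re ((?\<phi> s)\<^sup>2 * cnj p) \<partial>?M)" by (rule integral_nonneg_AE[OF nn])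
  moreover have Ic: "I = c * m" using m by (simp add: c_def)
  ultimately have ge: "c * m \<le> c * measure ?M {0..l}" unfolding int by simp
  have mass: "measure ?M {0..l} \<le> m" by (rule admissible_lib(2)[OF \<mu> l])
  have eq: "c * measure ?M {0..l} = c * m" by (rule antisym[OF mult_left_mono[OF mass c0] ge])
  have "(\<integral>s. c - Re ((?\<phi> s)\<^sup>2 * cnj p) \<partial>?M) = 0" unfolding int Ic eq by simp
  then have "AE s in ?M. c - Re ((?\<phi> s)\<^sup>2 * cnj p) = 0"
    using integral_nonneg_eq_0_iff_AE[OF integrable_M[OF cg] nn] by simp
  then have ae: "AE s in ?M. Re ((?\<phi> s)\<^sup>2 * cnj p) = c" by eventually_elim simp
  interpret E: extremal "lib_measure l \<mu>" l \<omega> "string_phi l \<omega> \<mu>" p c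
    by unfold_locales (use p c0 le ae in auto)
  have cp: "c = Re p" by (rule E.c_eq)
  show "extremal (lib_measure l \<mu>) l \<omega> (string_phi l \<omega> \<mu>) p (Re p)" using E.extremal_axioms unfolding cp .
  show "Re (cm_integral l \<mu> (\<lambda>s. (string_phi l \<omega> \<mu> s)\<^sup>2) * cnj p) = m * Re p"
    using Ic unfolding I_def cp by simp
  show "Re p = 0" if "measure (lib_measure l \<mu>) {0..l} < m" using eq that cp by simp
qed

section \<open>Lines, enumeration of the masses, and the trajectory\<close>

lemma line_eq_hyperplane:
  assumes "line_with_unit_normal L p" "u \<in> L"
  shows "L = {x. p \<bullet> x = p \<bullet> u}"
proof (rule affine_dim_equal)
  have p: "p \<noteq> 0" using assms by (auto simp: line_with_unit_normal_def)
  show "affine L" "L \<noteq> {}" using assms by (auto simp: line_with_unit_normal_def)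
  show "affine {x. p \<bullet> x = p \<bullet> u}" by (rule affine_hyperplane)
  show "L \<subseteq> {x. p \<bullet> x = p \<bullet> u}"
  proof
    fix x assume "x \<in> L"
    then have "orthogonal (x - u) p" using assms by (auto simp: line_with_unit_normal_def)
    then have "p \<bullet> (x - u) = 0" by (simp add: orthogonal_def inner_commute)
    then show "x \<in> {x. p \<bullet> x = p \<bullet> u}" by (simp only: inner_diff_right mem_Collect_eq)
  qed
  show "aff_dim L = aff_dim {x. p \<bullet> x = p \<bullet> u}"
    using assms aff_dim_hyperplane[OF p] by (simp add: line_with_unit_normal_def)
qed

lemma hyperplane_line:
  assumes "norm p = 1"
  shows "line_with_unit_normal {x. p \<bullet> x = p \<bullet> u} p"
proof -
  have p: "p \<noteq> 0" using assms by auto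
  have "orthogonal (x - y) p" if "p \<bullet> x = p \<bullet> u" "p \<bullet> y = p \<bullet> u" for x y
  proof -
    have "p \<bullet> (x - y) = 0" using that by (simp only: inner_diff_right)
    then show ?thesis by (simp only: orthogonal_def inner_commute)
  qed
  then show ?thesis
    using assms aff_dim_hyperplane[OF p] by (auto simp: line_with_unit_normal_def affine_hyperplane)
qed

lemma line_through_one_iff:
  assumes "norm p = 1"
  shows "z \<in> {x. p \<bullet> x = p \<bullet> 1} \<longleftrightarrow> Re (z * cnj p) = Re p"
    and "Re (z * cnj p) = Re p \<Longrightarrow> z = 1 + \<i> * p * of_real (Im ((z - 1) * cnj p))"
proof -
  show "z \<in> {x. p \<bullet> x = p \<bullet> 1} \<longleftrightarrow> Re (z * cnj p) = Re p"
    unfolding mem_Collect_eq inner_commute[of p] inner_eq_Re by (simp add: mult.commute)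
  assume "Re (z * cnj p) = Re p"
  then have "(z - 1) * cnj p = \<i> * of_real (Im ((z - 1) * cnj p))" by (simp add: complex_eq_iff algebra_simps)
  then have "(z - 1) * (p * cnj p) = \<i> * p * of_real (Im ((z - 1) * cnj p))" by (metis mult.assoc mult.commute)
  also have "p * cnj p = 1" using assms by (simp add: complex_norm_square[symmetric])
  finally show "z = 1 + \<i> * p * of_real (Im ((z - 1) * cnj p))" by (simp add: algebra_simps)
qed

lemma line_through_one_range:
  assumes "norm p = 1"
  shows "{x. p \<bullet> x = p \<bullet> 1} = range (\<lambda>t::real. 1 + \<i> * p * complex_of_real t)"
proof (intro set_eqI iffI)
  fix z assume "z \<in> {x. p \<bullet> x = p \<bullet> 1}"
  then show "z \<in> range (\<lambda>t::real. 1 + \<i> * p * complex_of_real t)"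
    using line_through_one_iff[OF assms] by blast
next
  fix z assume "z \<in> range (\<lambda>t::real. 1 + \<i> * p * complex_of_real t)"
  then obtain t :: real where t: "z = 1 + \<i> * p * of_real t" by blast
  have "z * cnj p = cnj p + \<i> * of_real t * (p * cnj p)" unfolding t by (simp add: algebra_simps)
  also have "p * cnj p = 1" using assms by (simp add: complex_norm_square[symmetric])
  finally have "Re (z * cnj p) = Re p" by simp
  then show "z \<in> {x. p \<bullet> x = p \<bullet> 1}" using line_through_one_iff(1)[OF assms] by blast
qed

lemma unit_normal_real_line:
  assumes "norm p = 1" "Re p = 0" shows "{x. p \<bullet> x = p \<bullet> 1} = \<real>"
proof -
  have "Im p \<noteq> 0" using assms by (auto simp: cmod_def)
  then show ?thesis using assms by (auto simp: inner_complex_def complex_is_Real_iff)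
qed

context string_measure begin

text \<open>
  The value \<open>a (n + 1) = l\<close> makes the last segment end at \<open>l\<close>; it is degenerate if there is a mass at \<open>l\<close>.
\<close>

definition enumerates_atoms :: "nat \<Rightarrow> (nat \<Rightarrow> real) \<Rightarrow> bool" where
  "enumerates_atoms n a \<longleftrightarrow> 1 \<le> n \<and> strict_mono_on {1..n} a \<and> a ` {1..n} = atoms \<and> a (n + 1) = l"

lemma enumeration_exists:
  assumes "finite atoms" "atoms \<noteq> {}"
  obtains n a where "enumerates_atoms n a"
proof -
  define h where "h i = sorted_list_of_set atoms ! i" for i
  have h: "bij_betw h {0..<card atoms} atoms" "strict_mono_on {0..<card atoms} h"
  proof -
    have "bij_betw ((!) (sorted_list_of_set atoms)) {0..<card atoms} atoms"
      by (rule bij_betw_nth) (use assms(1) in auto)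
    then show "bij_betw h {0..<card atoms} atoms" by (simp add: h_def[abs_def])
    have "sorted_wrt (<) (sorted_list_of_set atoms)" by simp
    then show "strict_mono_on {0..<card atoms} h"
      using assms(1) by (auto simp: strict_mono_on_def h_def sorted_wrt_iff_nth_less)
  qed
  define n where "n = card atoms"
  define a where "a j = (if j \<le> n then h (j - 1) else l)" for j
  have n: "1 \<le> n" using assms by (simp add: n_def Suc_leI card_gt_0_iff)
  have "strict_mono_on {1..n} a"
  proof (rule strict_mono_onI)
    fix r s assume rs: "r \<in> {1..n}" "s \<in> {1..n}" "r < s"
    then have "h (r - 1) < h (s - 1)" by (intro strict_mono_onD[OF h(2)]) (auto simp: n_def)
    then show "a r < a s" using rs by (simp add: a_def)
  qed
  moreover have "a ` {1..n} = atoms"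
  proof -
    have "a ` {1..n} = h ` ((\<lambda>j. j - 1) ` {1..n})" by (auto simp: a_def image_image)
    also have "(\<lambda>j. j - 1) ` {1..n} = {0..<n}"
    proof (intro set_eqI iffI)
      fix x assume "x \<in> {0..<n}"
      then show "x \<in> (\<lambda>j. j - 1) ` {1..n}" by (intro image_eqI[of _ _ "x + 1"]) auto
    qed auto
    finally show ?thesis using h(1) by (simp add: bij_betw_def n_def)
  qed
  ultimately show ?thesis using n by (intro that[of n a]) (simp add: enumerates_atoms_def a_def)
qed

lemma enumeration_atom: "enumerates_atoms n a \<Longrightarrow> 1 \<le> j \<Longrightarrow> j \<le> n \<Longrightarrow> a j \<in> atoms"
  by (auto simp: enumerates_atoms_def)

lemma enumeration_index:
  assumes "enumerates_atoms n a" "x \<in> atoms" obtains k where "1 \<le> k" "k \<le> n" "a k = x"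
proof -
  have "x \<in> a ` {1..n}" using assms by (simp only: enumerates_atoms_def)
  then show ?thesis using that by auto
qed

lemma enumeration_less: "enumerates_atoms n a \<Longrightarrow> 1 \<le> j \<Longrightarrow> j < k \<Longrightarrow> k \<le> n \<Longrightarrow> a j < a k"
  by (auto simp: enumerates_atoms_def strict_mono_on_def)

lemma atoms_range: "x \<in> atoms \<Longrightarrow> 0 \<le> x \<and> x \<le> l"
  by (simp add: atoms_def)

lemma enumeration_le_end: "enumerates_atoms n a \<Longrightarrow> 1 \<le> j \<Longrightarrow> j \<le> n \<Longrightarrow> a j \<le> a (j + 1)"
  using enumeration_less[of n a j "j + 1"] enumeration_atom[of n a j] atoms_range[of "a j"]
  by (cases "j = n") (auto simp: enumerates_atoms_def)

lemma enumeration_gap: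
  assumes e: "enumerates_atoms n a" and j: "1 \<le> j" "j \<le> n"
  shows "{a j<..<a (j + 1)} \<inter> atoms = {}"
proof (rule ccontr)
  assume "\<not> ?thesis"
  then obtain x where x: "x \<in> atoms" "a j < x" "x < a (j + 1)" by auto
  obtain k where "1 \<le> k" "k \<le> n" "a k = x" by (rule enumeration_index[OF e x(1)])
  then have k: "1 \<le> k" "k \<le> n" "a j < a k" "a k < a (j + 1)" using x by auto
  show False
  proof (cases "k \<le> j")
    case True then show ?thesis using enumeration_less[OF e k(1), of j] j k by (cases "k = j") auto
  next
    case False then show ?thesis using enumeration_less[OF e _ _ k(2), of "j + 1"] j k by (cases "k = j + 1") auto
  qed
qed

lemma enumeration_cover:
  assumes e: "enumerates_atoms n a" and x: "a 1 \<le> x" "x \<le> l"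
  obtains j where "1 \<le> j" "j \<le> n" "a j \<le> x" "x \<le> a (j + 1)"
proof -
  let ?J = "{j \<in> {1..n}. a j \<le> x}"
  have n: "1 \<le> n" "a (n + 1) = l" using e by (auto simp: enumerates_atoms_def)
  have fin: "finite ?J" "?J \<noteq> {}" using x n by auto
  let ?j = "Max ?J"
  have j: "?j \<in> ?J" by (rule Max_in[OF fin])
  have "x \<le> a (?j + 1)"
  proof (cases "?j = n")
    case True then show ?thesis using n x by simp
  next
    case False
    have "?j + 1 \<notin> ?J"
    proof
      assume "?j + 1 \<in> ?J"
      then have "?j + 1 \<le> ?j" by (rule Max_ge[OF fin(1)])
      then show False by linarith
    qed
    then show ?thesis using j False by auto
  qed
  then show ?thesis using that[of ?j] j by auto
qed

end

lemma affine_image_segment: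
  fixes f :: "real \<Rightarrow> complex"
  assumes "x \<le> y" and f: "\<And>t. x \<le> t \<Longrightarrow> t \<le> y \<Longrightarrow> f t = f x + of_real (t - x) * d"
  shows "f ` {x..y} = closed_segment (f x) (f y)"
proof (intro set_eqI iffI)
  fix z assume "z \<in> f ` {x..y}"
  then obtain t where t: "x \<le> t" "t \<le> y" "z = f t" by auto
  show "z \<in> closed_segment (f x) (f y)"
  proof (cases "x = y")
    case True then show ?thesis using t by simp
  next
    case False
    define u where "u = (t - x) / (y - x)"
    have u: "0 \<le> u" "u \<le> 1" "u * (y - x) = t - x" using t False assms(1) by (auto simp: u_def field_simps)
    have e: "of_real (t - x) * d = of_real u * (of_real (y - x) * d)" unfolding u(3)[symmetric] by simp
    have fy: "f y = f x + of_real (y - x) * d" using f[of y] assms(1) by simp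
    have "z = f x + of_real u * (of_real (y - x) * d)" using t f[of t] e by simp
    then have "z = (1 - u) *\<^sub>R f x + u *\<^sub>R f y"
      unfolding fy by (simp add: scaleR_conv_of_real algebra_simps)
    then show ?thesis using u by (auto simp: in_segment)
  qed
next
  fix z assume "z \<in> closed_segment (f x) (f y)"
  then obtain u where u: "0 \<le> u" "u \<le> 1" "z = (1 - u) *\<^sub>R f x + u *\<^sub>R f y" by (auto simp: in_segment)
  define t where "t = x + u * (y - x)"
  have "u * (y - x) \<le> 1 * (y - x)" by (rule mult_right_mono) (use u assms(1) in auto)
  moreover have "0 \<le> u * (y - x)" using u assms(1) by simp
  ultimately have t: "x \<le> t" "t \<le> y" by (auto simp: t_def)
  have tx: "t - x = u * (y - x)" by (simp add: t_def)
  have "f t = f x + of_real u * (of_real (y - x) * d)" using f[OF t] unfolding tx by simp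
  also have "of_real (y - x) * d = f y - f x" using f[of y] assms(1) by simp
  finally have ft: "f t = f x + of_real u * (f y - f x)" .
  have "f t = z" unfolding ft u(3) by (simp add: scaleR_conv_of_real algebra_simps)
  then show "z \<in> f ` {x..y}" using t by auto
qed

context extremal begin

lemma enumeration_first:
  assumes e: "enumerates_atoms n a" shows "a 1 = a0"
proof -
  obtain k where k: "1 \<le> k" "k \<le> n" "a k = a0" by (rule enumeration_index[OF e a0_atom])
  have "a 1 \<in> atoms" using k by (intro enumeration_atom[OF e]) auto
  then have "a0 \<le> a 1" by (rule atom_ge_a0)
  then show ?thesis using enumeration_less[OF e, of 1 k] k by (cases "k = 1") auto
qed

lemma affine_piece:
  assumes e: "enumerates_atoms n a" and j: "1 \<le> j" "j \<le> n" and x: "a j \<le> x" "x \<le> a (j + 1)"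
  shows "\<phi> x = \<phi> (a j) + of_real (x - a j) * q (a j)"
proof (rule affine_between[OF _ x _ enumeration_gap[OF e j]])
  show "0 \<le> a j" using atoms_range enumeration_atom[OF e j] by blast
  show "a (j + 1) \<le> l"
    using e atoms_range enumeration_atom[OF e, of "j + 1"] j by (cases "j = n") (auto simp: enumerates_atoms_def)
qed

lemma trajectory_extremal:
  assumes e: "enumerates_atoms n a"
  shows "trajectory_condition l \<phi> n a p"
proof -
  have one: "\<phi> x = 1" if "x \<in> {0..a 1}" for x
    using that unfolding enumeration_first[OF e] by (intro phi_before) auto
  have A0: "affine_map_on {0..a 1} \<phi>" unfolding affine_map_on_def
    by (rule exI[of _ 1], rule exI[of _ 0]) (simp add: one)
  have A: "affine_map_on {a j..a (j + 1)} \<phi>" if "j \<in> {1..n}" for j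
    unfolding affine_map_on_def
  proof (rule exI[of _ "\<phi> (a j) - of_real (a j) * q (a j)"], rule exI[of _ "q (a j)"], rule ballI)
    fix x assume "x \<in> {a j..a (j + 1)}"
    then have "\<phi> x = \<phi> (a j) + of_real (x - a j) * q (a j)" using affine_piece[OF e, of j x] that by auto
    then show "\<phi> x = \<phi> (a j) - of_real (a j) * q (a j) + of_real x * q (a j)" by (simp add: algebra_simps)
  qed
  have S: "\<phi> ` {0..l} \<subseteq> {\<zeta>. (\<zeta>\<^sup>2 - 1) \<bullet> p \<le> 0}"
  proof safe
    fix x assume "x \<in> {0..l}"
    then have "Re ((\<phi> x)\<^sup>2 * cnj p) \<le> Re p" using g_le c_eq by simp
    then show "((\<phi> x)\<^sup>2 - 1) \<bullet> p \<le> 0" unfolding inner_eq_Re left_diff_distrib by simp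
  qed
  have seg: "\<phi> ` {a j..a (j + 1)} = closed_segment (\<phi> (a j)) (\<phi> (a (j + 1)))" if j: "1 \<le> j" "j \<le> n" for j
    by (rule affine_image_segment[OF enumeration_le_end[OF e j] affine_piece[OF e j]])
  have n: "1 \<le> n" "a (n + 1) = l" using e by (auto simp: enumerates_atoms_def)
  have "{0..l} = {0..a 1} \<union> (\<Union>j\<in>{1..n}. {a j..a (j + 1)})"
  proof (intro set_eqI iffI)
    fix x assume x: "x \<in> {0..l}"
    show "x \<in> {0..a 1} \<union> (\<Union>j\<in>{1..n}. {a j..a (j + 1)})"
    proof (cases "a 1 \<le> x")
      case True
      then obtain j where "1 \<le> j" "j \<le> n" "a j \<le> x" "x \<le> a (j + 1)"
        using enumeration_cover[OF e] x by auto
      then show ?thesis by auto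
    qed (use x in auto)
  next
    have le: "0 \<le> a j \<and> a (j + 1) \<le> l" if "1 \<le> j" "j \<le> n" for j
      using atoms_range enumeration_atom[OF e that] enumeration_atom[OF e, of "j + 1"] that n by (cases "j = n") auto
    fix x assume "x \<in> {0..a 1} \<union> (\<Union>j\<in>{1..n}. {a j..a (j + 1)})"
    then show "x \<in> {0..l}" using le atoms_range enumeration_atom[OF e, of 1] n by fastforce
  qed
  then have "\<phi> ` {0..l} = \<phi> ` {0..a 1} \<union> (\<Union>j\<in>{1..n}. \<phi> ` {a j..a (j + 1)})" by (simp add: image_Un image_UN)
  also have "(\<Union>j\<in>{1..n}. \<phi> ` {a j..a (j + 1)}) = (\<Union>j\<in>{1..n}. closed_segment (\<phi> (a j)) (\<phi> (a (j + 1))))"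
    using seg by (intro SUP_cong) auto
  also have "\<phi> ` {0..a 1} \<union> \<dots> = \<dots>"
  proof -
    have "\<phi> ` {0..a 1} \<subseteq> {1}" using one by auto
    moreover have "1 \<in> closed_segment (\<phi> (a 1)) (\<phi> (a (1 + 1)))" using enumeration_first[OF e] by simp
    ultimately show ?thesis using n(1) by (intro Un_absorb1) fastforce
  qed
  finally show ?thesis using A0 A S unfolding trajectory_condition_def by blast
qed

lemma Z_iff_line:
  "x \<in> {0..l} \<Longrightarrow> x \<in> Z \<longleftrightarrow> (\<phi> x)\<^sup>2 \<in> {x. p \<bullet> x = p \<bullet> 1}"
  unfolding line_through_one_iff(1)[OF norm_p] Z_def using c_eq by auto

lemma mass_position_extremal:
  assumes e: "enumerates_atoms n a"
  shows "mass_position_condition l \<phi> n a {x. p \<bullet> x = p \<bullet> 1}"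
proof -
  have n: "1 \<le> n" and A: "a ` {1..n} = atoms" using e by (auto simp: enumerates_atoms_def)
  have last: "x \<le> a n" if xa: "x \<in> atoms" for x
  proof -
    obtain k where "1 \<le> k" "k \<le> n" "a k = x" by (rule enumeration_index[OF e xa])
    then show ?thesis using enumeration_less[OF e, of k n] by (cases "k = n") auto
  qed
  have a1: "a 1 = a0" by (rule enumeration_first[OF e])
  show ?thesis unfolding mass_position_condition_def a1 A
  proof (intro conjI impI)
    assume an: "a n < l"
    have "x \<in> atoms \<longleftrightarrow> x \<in> Z \<inter> {a0..<l}" for x
      using Z_before_end atoms_subset last[of x] an by fastforce
    then show "atoms = {x \<in> {a0..<l}. (\<phi> x)\<^sup>2 \<in> {x. p \<bullet> x = p \<bullet> 1}}"
      using Z_iff_line a0_range by auto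
  next
    assume an: "a n = l"
    then have "l \<in> atoms" using A n by (metis atLeastAtMost_iff image_eqI order_refl)
    then have "x \<in> atoms \<longleftrightarrow> x \<in> Z \<inter> {a0..l}" for x
      using Z_before_end atoms_subset by (cases "x = l") auto
    then show "atoms = {x \<in> {a0..l}. (\<phi> x)\<^sup>2 \<in> {x. p \<bullet> x = p \<bullet> 1}}"
      using Z_iff_line a0_range by auto
  qed
qed

lemma enumeration_value:
  assumes e: "enumerates_atoms n a" and j: "1 \<le> j" "j \<le> n"
  shows "Re ((\<phi> (a j))\<^sup>2 * cnj p) = c"
  using atoms_subset enumeration_atom[OF e j] by (intro Z_value) auto

lemma consecutive_enumeration:
  assumes e: "enumerates_atoms n a" and j: "1 \<le> j" "j < n"
  shows "Im ((\<phi> (a (j + 1)))\<^sup>2 * cnj p) < Im ((\<phi> (a j))\<^sup>2 * cnj p)"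
    "c = 0 \<Longrightarrow> 0 < Im ((\<phi> (a j))\<^sup>2 * cnj p)" "c = 0 \<Longrightarrow> Im ((\<phi> (a (j + 1)))\<^sup>2 * cnj p) < 0"
proof -
  note co = consecutive_atoms[of "a j" "a (j + 1)", OF enumeration_atom[OF e] enumeration_atom[OF e] enumeration_less[OF e] enumeration_gap[OF e]]
  show "Im ((\<phi> (a (j + 1)))\<^sup>2 * cnj p) < Im ((\<phi> (a j))\<^sup>2 * cnj p)"
    "c = 0 \<Longrightarrow> 0 < Im ((\<phi> (a j))\<^sup>2 * cnj p)" "c = 0 \<Longrightarrow> Im ((\<phi> (a (j + 1)))\<^sup>2 * cnj p) < 0"
    using co j by auto
qed

lemma enumeration_decreasing:
  assumes e: "enumerates_atoms n a" and j: "1 \<le> j" "j < k" "k \<le> n"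
  shows "Im ((\<phi> (a k))\<^sup>2 * cnj p) < Im ((\<phi> (a j))\<^sup>2 * cnj p)"
proof -
  have "Suc j \<le> k" using j by simp
  then show ?thesis using j(3)
  proof (induction k rule: dec_induct)
    case base then show ?case using consecutive_enumeration(1)[OF e j(1)] by simp
  next
    case (step i)
    have "Im ((\<phi> (a (i + 1)))\<^sup>2 * cnj p) < Im ((\<phi> (a i))\<^sup>2 * cnj p)"
      using step j by (intro consecutive_enumeration(1)[OF e]) auto
    also have "\<dots> < Im ((\<phi> (a j))\<^sup>2 * cnj p)" using step by auto
    finally show ?case by simp
  qed
qed

text \<open>
  The line passes through the distinct points \<open>1\<close> and \<open>\<phi>(a\<^sub>2)\<^sup>2\<close>, so only the sign of the normal is in
  question.  With both \<open>p\<close> and \<open>- p\<close> the squares would stay on the line for all \<open>x\<close>, so the contact set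
  would be infinite.
\<close>

lemma line_unique:
  assumes e: "enumerates_atoms n a" and n: "2 \<le> n"
    and L: "line_with_unit_normal L p'" "trajectory_condition l \<phi> n a p'" "mass_position_condition l \<phi> n a L"
  shows "L = {x. p \<bullet> x = p \<bullet> 1}" "p' = p"
proof -
  have p': "norm p' = 1" using L by (simp add: line_with_unit_normal_def)
  have al: "a n \<le> l" using atoms_range enumeration_atom[OF e, of n] n by auto
  have inL: "(\<phi> x)\<^sup>2 \<in> L" if "x \<in> a ` {1..n}" for x
    using L(3) al that unfolding mass_position_condition_def by (cases "a n = l") auto
  have a1: "a 1 = a0" by (rule enumeration_first[OF e])
  have "(\<phi> (a 1))\<^sup>2 \<in> L" using n by (intro inL) auto
  then have one: "1 \<in> L" by (simp add: a1[simplified])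
  have LH: "L = {x. p' \<bullet> x = p' \<bullet> 1}" by (rule line_eq_hyperplane[OF L(1) one])
  define w where "w = (\<phi> (a 2))\<^sup>2"
  have "w \<in> L" unfolding w_def using n by (intro inL) auto
  then have w': "Re (w * cnj p') = Re p'" using LH line_through_one_iff(1)[OF p'] by blast
  have w: "Re (w * cnj p) = Re p" using enumeration_value[OF e, of 2] n c_eq by (simp add: w_def)
  define s where "s = Im ((w - 1) * cnj p)"
  have ws: "w = 1 + \<i> * p * of_real s" using line_through_one_iff(2)[OF norm_p w] by (simp add: s_def)
  have "Im (w * cnj p) < Im ((\<phi> (a 1))\<^sup>2 * cnj p)"
    using enumeration_decreasing[OF e, of 1 2] n by (simp add: w_def)
  then have s: "s < 0" unfolding s_def left_diff_distrib using a1 by simp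
  have "Re (w * cnj p') = Re p' + - (s * Im (p * cnj p'))" unfolding ws by (simp add: algebra_simps)
  then have im: "Im (p * cnj p') = 0" using w' s by (simp only: add_cancel_left_right neg_equal_0_iff_equal mult_eq_0_iff) auto
  have "norm (p * cnj p') = 1" using norm_p p' by (simp add: norm_mult)
  then have "\<bar>Re (p * cnj p')\<bar> = 1" using im by (simp add: cmod_eq_Re)
  then have "p * cnj p' = 1 \<or> p * cnj p' = -1" using im by (auto simp: complex_eq_iff abs_if split: if_splits)
  then have "p * (cnj p' * p') = p' \<or> p * (cnj p' * p') = - p'" by (metis mult.assoc mult_1 mult_minus1)
  moreover have "cnj p' * p' = 1" using p' by (simp add: complex_norm_square[symmetric] mult.commute)
  ultimately have pm: "p' = p \<or> p' = - p" by (auto)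
  show "p' = p"
  proof (rule ccontr)
    assume "p' \<noteq> p"
    then have pp: "p' = - p" using pm by simp
    have "x \<in> Z" if "x \<in> {0..l}" for x
    proof -
      have "((\<phi> x)\<^sup>2 - 1) \<bullet> p' \<le> 0" using L(2) that unfolding trajectory_condition_def by blast
      then have "0 \<le> Re (((\<phi> x)\<^sup>2 - 1) * cnj p)" unfolding pp inner_eq_Re by simp
      then have "Re p \<le> Re ((\<phi> x)\<^sup>2 * cnj p)" unfolding left_diff_distrib by simp
      then show ?thesis using g_le[OF that] that c_eq unfolding Z_def by simp
    qed
    then have "{a0..l} \<subseteq> Z \<inter> {a0..l}" using a0_range by auto
    then have "finite {a0..l}" using finite_Z finite_subset by blast
    then show False using infinite_Icc[OF a0_less] by blast
  qed
  then show "L = {x. p \<bullet> x = p \<bullet> 1}" using LH by simp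
qed

text \<open>
  Otherwise \<open>g\<close> would be constant on the segment from \<open>a j\<close> to \<open>a (j + 1)\<close>, being quadratic with value
  zero at both ends and slope zero at the right one.
\<close>

lemma slope_incoming_nonzero:
  assumes e: "enumerates_atoms n a" and j: "1 \<le> j" "j < n"
  shows "Re (\<phi> (a (j + 1)) * q (a j) * cnj p) \<noteq> 0"
proof
  assume z: "Re (\<phi> (a (j + 1)) * q (a j) * cnj p) = 0"
  let ?x = "a j" and ?y = "a (j + 1)"
  have xy: "?x < ?y" using enumeration_less[OF e j(1), of "j + 1"] j by simp
  have at: "?x \<in> atoms" "?y \<in> atoms" using enumeration_atom[OF e] j by auto
  have Z: "?x \<in> Z" "?y \<in> Z" "a0 \<le> ?x" "?y \<le> l" using at atoms_subset by auto
  have gap: "{?x<..<?y} \<inter> Z = {}" using Z_before_end enumeration_gap[OF e, of j] j Z by fastforce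
  note gc = gap_chord[OF Z(3) xy Z(1,2) gap]
  define h Q where "h = ?y - ?x" and "Q = q ?x"
  have x: "\<phi> ?x = \<phi> ?y - of_real h * Q" unfolding gc(1) h_def Q_def by simp
  have ex: "Re ((\<phi> ?y - of_real t * Q)\<^sup>2 * cnj p) = c + t\<^sup>2 * Re (Q\<^sup>2 * cnj p)" for t
  proof -
    have "(\<phi> ?y - of_real t * Q)\<^sup>2 * cnj p = (\<phi> ?y)\<^sup>2 * cnj p - of_real (2 * t) * (\<phi> ?y * Q * cnj p) + of_real (t\<^sup>2) * (Q\<^sup>2 * cnj p)"
      by (simp add: power2_eq_square algebra_simps)
    from Re_quadratic[OF this] show ?thesis unfolding z[folded Q_def] Z_value[OF Z(2)] by simp
  qed
  have "h\<^sup>2 * Re (Q\<^sup>2 * cnj p) = 0" using ex[of h] Z_value[OF Z(1)] unfolding x by simp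
  then have "Re (Q\<^sup>2 * cnj p) = 0" using xy by (simp only: mult_eq_0_iff) (simp add: h_def)
  then have "Re ((\<phi> ?y - of_real (h / 2) * Q)\<^sup>2 * cnj p) = c" unfolding ex by simp
  moreover have "(\<phi> ?x + \<phi> ?y) / 2 = \<phi> ?y - of_real (h / 2) * Q" unfolding x by (simp add: field_simps)
  ultimately have "Re (((\<phi> ?x + \<phi> ?y) / 2)\<^sup>2 * cnj p) = c" by (simp only:)
  then show False using gc(3) by (simp only: less_irrefl)
qed

lemma q_next:
  assumes e: "enumerates_atoms n a" and j: "1 \<le> j" "j < n"
  shows "q (a (j + 1)) = q (a j) - \<omega>\<^sup>2 * of_real (measure M {a (j + 1)}) * \<phi> (a (j + 1))"
proof -
  have "0 \<le> a j" "a (j + 1) \<le> l" using atoms_range enumeration_atom[OF e] j by auto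
  then show ?thesis
    using enumeration_less[OF e j(1), of "j + 1"] j enumeration_gap[OF e, of j]
    by (intro q_jump null_between_atoms) auto
qed

end

section \<open>The structure theorem\<close>

text \<open>
  The whole space is a neighbourhood of \<open>\<mu>\<close>, and there are no quasi-eigenvalues above \<open>\<omega>\<close> on the
  vertical line through it.
\<close>

lemma minimal_decay_local_boundary:
  assumes l: "0 < l" and md: "minimal_decay l m \<alpha> \<omega> \<mu>"
  shows "weak_star_local_boundary_point l m \<mu> \<omega>"
proof -
  obtain \<beta> where \<mu>: "\<mu> \<in> admissible l m" "\<omega> \<in> quasi_eigenvalues l \<mu>"
    and \<beta>: "\<omega> = complex_of_real \<alpha> - \<i> * complex_of_real \<beta>" "ereal \<beta> = beta_min l m \<alpha>"
    using md by (auto simp: minimal_decay_def)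
  let ?S = "quasi_eigenvalues_of l (admissible l m)"
  define W where "W = {\<mu> \<in> complex_measures l. cm_integral l \<mu> (\<lambda>_. 0) \<in> UNIV}"
  have "openin (weak_star_topology l) W"
    unfolding weak_star_topology_def W_def
    by (rule topology_generated_by_Basis) (blast intro: continuous_on_const open_UNIV)
  moreover have W: "W = complex_measures l" by (simp add: W_def)
  have AW: "admissible l m \<inter> W = admissible l m" unfolding W by (auto simp: admissible_def)
  have "\<omega> \<in> frontier ?S"
    unfolding frontier_def
  proof
    have "\<omega> \<in> ?S" using \<mu> by (auto simp: quasi_eigenvalues_of_def)
    then show "\<omega> \<in> closure ?S" using closure_subset by blast
    show "\<omega> \<notin> interior ?S"
    proof
      assume "\<omega> \<in> interior ?S"
      then obtain e where e: "0 < e" "cball \<omega> e \<subseteq> ?S" using mem_interior_cball by blast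
      let ?w = "complex_of_real \<alpha> - \<i> * complex_of_real (\<beta> - e)"
      have "\<omega> - ?w = - (\<i> * of_real e)" by (simp add: \<beta>(1) algebra_simps)
      then have "dist \<omega> ?w = e" using e(1) by (simp add: dist_norm norm_mult)
      then have "?w \<in> ?S" using e(2) by auto
      then have "beta_min l m \<alpha> \<le> ereal (\<beta> - e)" unfolding beta_min_def by (intro INF_lower) simp
      then show False using \<beta>(2)[symmetric] e(1) by simp
    qed
  qed
  then have "\<omega> \<in> frontier (quasi_eigenvalues_of l (admissible l m \<inter> W))" unfolding AW .
  moreover have "\<mu> \<in> W" using \<mu> W by (auto simp: admissible_def)
  ultimately show ?thesis using \<mu> unfolding weak_star_local_boundary_point_def by blast
qed

text \<open>
  The supremum has to be bounded, since \<open>SUP\<close> over an unbounded set of reals has no meaning.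
\<close>

lemma mass_le_total_variation:
  assumes l: "0 < l" and \<mu>: "\<mu> \<in> nonneg_measures l"
  shows "measure (lib_measure l \<mu>) {0..l} \<le> total_variation l \<mu>"
proof -
  interpret string_measure "lib_measure l \<mu>" l by (rule string_measure_lib[OF \<mu> l])
  let ?P = "{P. finite P \<and> disjoint P \<and> P \<subseteq> borel_subsets l}"
  have nm: "norm (\<mu> A) = measure (lib_measure l \<mu>) A" if "A \<in> borel_subsets l" for A
    unfolding measure_lib(2)[OF \<mu> l that] by simp
  have bound: "(\<Sum>A\<in>P. norm (\<mu> A)) \<le> measure (lib_measure l \<mu>) {0..l}" if P: "P \<in> ?P" for P
  proof -
    have sets: "P \<subseteq> sets (lib_measure l \<mu>)" using P sets_M_iff by auto
    have "(\<Sum>A\<in>P. norm (\<mu> A)) = (\<Sum>A\<in>P. measure (lib_measure l \<mu>) A)"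
      using P nm by (intro sum.cong) auto
    also have "\<dots> = measure (lib_measure l \<mu>) (\<Union>A\<in>P. A)"
      using P sets by (intro finite_measure_finite_Union[symmetric]) (auto simp: disjoint_family_on_def disjoint_def)
    also have "\<dots> \<le> measure (lib_measure l \<mu>) {0..l}"
    proof (rule finite_measure_mono)
      show "(\<Union>A\<in>P. A) \<subseteq> {0..l}" using P by (auto simp: borel_subsets_def)
    qed (auto intro: borel_in_sets)
    finally show ?thesis .
  qed
  have "(\<Sum>A\<in>{{0..l}}. norm (\<mu> A)) \<le> total_variation l \<mu>"
    unfolding total_variation_def
  proof (rule cSUP_upper)
    show "{{0..l}} \<in> ?P" using interval_borel_subset by (simp add: disjoint_def)
    show "bdd_above ((\<lambda>P. \<Sum>A\<in>P. norm (\<mu> A)) ` ?P)" using bound by (intro bdd_aboveI2)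
  qed
  then show ?thesis using nm[OF interval_borel_subset] by simp
qed

lemma left_derivative_affine:
  fixes f :: "real \<Rightarrow> complex"
  assumes "b < x" and aff: "\<And>y. b \<le> y \<Longrightarrow> y \<le> x \<Longrightarrow> f y = f x - of_real (x - y) * d"
  shows "left_deriv f x = d" "left_deriv (\<lambda>y. (f y)\<^sup>2) x = 2 * f x * d"
proof -
  have "((\<lambda>y. f x - of_real (x - y) * d) has_vector_derivative d) (at x within {..x})"
    by (auto intro!: derivative_eq_intros simp: has_vector_derivative_def scaleR_conv_of_real)
  then have "(f has_vector_derivative d) (at x within {..x})"
  proof (rule has_vector_derivative_transform_within[where d="x - b"])
    fix y assume "y \<in> {..x}" "dist y x < x - b"
    then show "f x - of_real (x - y) * d = f y" using aff[of y] by (simp add: dist_real_def)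
  qed (use assms(1) in auto)
  then have D: "(f has_vector_derivative d) (at_left x)"
    by (rule has_vector_derivative_within_subset) auto
  then show "left_deriv f x = d" by (intro vector_derivative_within) auto
  have "((\<lambda>y. f y * f y) has_vector_derivative (f x * d + d * f x)) (at_left x)"
    by (rule has_vector_derivative_mult[OF D D])
  then have "((\<lambda>y. (f y)\<^sup>2) has_vector_derivative (2 * f x * d)) (at_left x)" by (simp add: power2_eq_square algebra_simps)
  then show "left_deriv (\<lambda>y. (f y)\<^sup>2) x = 2 * f x * d" by (intro vector_derivative_within) auto
qed

lemma right_derivative_affine:
  fixes f :: "real \<Rightarrow> complex"
  assumes "x < b" and aff: "\<And>y. x \<le> y \<Longrightarrow> y \<le> b \<Longrightarrow> f y = f x + of_real (y - x) * d"
  shows "right_deriv (\<lambda>y. (f y)\<^sup>2) x = 2 * f x * d"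
proof -
  have "((\<lambda>y. f x + of_real (y - x) * d) has_vector_derivative d) (at x within {x..})"
    by (auto intro!: derivative_eq_intros simp: has_vector_derivative_def scaleR_conv_of_real)
  then have "(f has_vector_derivative d) (at x within {x..})"
  proof (rule has_vector_derivative_transform_within[where d="b - x"])
    fix y assume "y \<in> {x..}" "dist y x < b - x"
    then show "f x + of_real (y - x) * d = f y" using aff[of y] by (simp add: dist_real_def)
  qed (use assms(1) in auto)
  then have D: "(f has_vector_derivative d) (at_right x)"
    by (rule has_vector_derivative_within_subset) auto
  have "((\<lambda>y. f y * f y) has_vector_derivative (f x * d + d * f x)) (at_right x)"
    by (rule has_vector_derivative_mult[OF D D])
  then have "((\<lambda>y. (f y)\<^sup>2) has_vector_derivative (2 * f x * d)) (at_right x)" by (simp add: power2_eq_square algebra_simps)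
  then show ?thesis by (intro vector_derivative_within) auto
qed

theorem theorem6p1:
  fixes l m :: real and \<mu>\<^sub>0 :: "real set \<Rightarrow> complex" and \<omega> :: complex
    and \<Phi> :: "real \<Rightarrow> complex" and z\<^sub>0 :: complex
  assumes "0 < l" and "0 < m"
    and "\<mu>\<^sub>0 \<in> admissible l m"
    and "\<omega> \<in> quasi_eigenvalues l \<mu>\<^sub>0"
    and "0 < Re \<omega>"
    and \<Phi>_eq: "\<Phi> = string_phi l \<omega> \<mu>\<^sub>0"
    and z\<^sub>0_eq: "z\<^sub>0 = cm_integral l \<mu>\<^sub>0 (\<lambda>x. (\<Phi> x)\<^sup>2) / complex_of_real m"
  shows
    "(minimal_decay l m (Re \<omega>) \<omega> \<mu>\<^sub>0 \<longrightarrow> weak_star_local_boundary_point l m \<mu>\<^sub>0 \<omega>) \<and>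
     (weak_star_local_boundary_point l m \<mu>\<^sub>0 \<omega> \<longrightarrow>
      (\<exists>(n::nat) (mass :: nat \<Rightarrow> real) (a :: nat \<Rightarrow> real).
         1 \<le> n \<and>
         (\<forall>j\<in>{1..n}. 0 < mass j \<and> a j \<in> {0..l}) \<and>
         strict_mono_on {1..n} a \<and> a (n + 1) = l \<and>
         \<mu>\<^sub>0 = (\<lambda>A. \<Sum>j=1..n. complex_of_real (mass j) * point_mass l (a j) A) \<and>
         a 1 \<in> measure_support l \<mu>\<^sub>0 \<and> (\<forall>x\<in>measure_support l \<mu>\<^sub>0. a 1 \<le> x) \<and>
         (\<exists>L p. line_with_unit_normal L p \<and> z\<^sub>0 \<in> L \<and>
            trajectory_condition l \<Phi> n a p \<and> mass_position_condition l \<Phi> n a L) \<and>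
         (\<forall>L p. line_with_unit_normal L p \<and> z\<^sub>0 \<in> L \<and>
            trajectory_condition l \<Phi> n a p \<and> mass_position_condition l \<Phi> n a L \<longrightarrow>
            \<Phi> (a 1) = 1 \<and> 1 \<in> L \<and> L = range (\<lambda>t::real. 1 + \<i> * p * complex_of_real t) \<and>
            (2 \<le> n \<longrightarrow>
               (\<forall>L' p'. line_with_unit_normal L' p' \<and>
                  trajectory_condition l \<Phi> n a p' \<and> mass_position_condition l \<Phi> n a L' \<longrightarrow>
                  L' = L \<and> p' = p) \<and>
               a 1 = 0 \<and>
               (\<exists>s :: nat \<Rightarrow> real.
                  (\<forall>j\<in>{1..n}. (\<Phi> (a j))\<^sup>2 = 1 + \<i> * p * complex_of_real (s j)) \<and>
                  s 1 = 0 \<and> (\<forall>j\<in>{1..n}. \<forall>k\<in>{1..n}. j < k \<longrightarrow> s k < s j)) \<and>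
               (\<forall>j\<in>{2..n}. a j < l \<longrightarrow>
                  mass j = (left_deriv (\<lambda>x. (\<Phi> x)\<^sup>2) (a j) \<bullet> p) / ((\<omega>\<^sup>2 * (\<Phi> (a j))\<^sup>2) \<bullet> p) \<and>
                  mass j = - ((right_deriv (\<lambda>x. (\<Phi> x)\<^sup>2) (a j) \<bullet> p) / ((\<omega>\<^sup>2 * (\<Phi> (a j))\<^sup>2) \<bullet> p))) \<and>
               (a n = l \<longrightarrow>
                  complex_of_real (mass n) =
                    left_deriv \<Phi> (a n) / (\<omega>\<^sup>2 * \<Phi> (a n)) - \<i> / \<omega>)) \<and>
            (total_variation l \<mu>\<^sub>0 < m \<longrightarrow> L = \<real> \<and> n \<le> 2 \<and> a 1 = 0))))"
proof (intro conjI impI, goal_cases)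
  case 1
  then show ?case by (rule minimal_decay_local_boundary[OF assms(1)])
next
  case bd: 2
  note l = assms(1) and m = assms(2) and \<mu>0 = assms(3) and \<omega>q = assms(4) and Re\<omega> = assms(5)
  have \<mu>0': "\<mu>\<^sub>0 \<in> nonneg_measures l" using \<mu>0 by (simp add: admissible_iff)
  define M where "M = lib_measure l \<mu>\<^sub>0"
  interpret resonance M l \<omega> \<Phi> unfolding M_def \<Phi>_eq by (rule resonance_lib[OF l \<mu>0 \<omega>q Re\<omega>])
  have F0: "string_F l \<omega> \<mu>\<^sub>0 = 0" using \<omega>q by (simp add: quasi_eigenvalues_def)
  have \<Phi>l: "string_phi l \<omega> \<mu>\<^sub>0 l \<noteq> 0" using phi_end_nonzero by (simp add: \<Phi>_eq)
  have to_extremal: "extremal M l \<omega> \<Phi> p (Re p)" "Re (cm_integral l \<mu>\<^sub>0 (\<lambda>s. (\<Phi> s)\<^sup>2) * cnj p) = m * Re p"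
      "measure M {0..l} < m \<Longrightarrow> Re p = 0"
    if "norm p = 1" "\<And>\<nu>. \<nu> \<in> admissible l m \<Longrightarrow> Re (cm_integral l \<nu> (\<lambda>s. (\<Phi> s)\<^sup>2) * cnj p) \<le> Re (cm_integral l \<mu>\<^sub>0 (\<lambda>s. (\<Phi> s)\<^sup>2) * cnj p)" for p
    using extremal_lib[OF l m \<mu>0 \<omega>q Re\<omega> that(1)] that(2) unfolding M_def \<Phi>_eq by blast+
  obtain p0 where p0: "norm p0 = 1" "\<And>\<nu>. \<nu> \<in> admissible l m \<Longrightarrow> Re (cm_integral l \<nu> (\<lambda>s. (\<Phi> s)\<^sup>2) * cnj p0) \<le> Re (cm_integral l \<mu>\<^sub>0 (\<lambda>s. (\<Phi> s)\<^sup>2) * cnj p0)"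
    using first_order_condition_fixed[OF l \<mu>0 F0 omega_nonzero \<Phi>l bd] unfolding \<Phi>_eq by blast
  have ext0: "extremal M l \<omega> \<Phi> p0 (Re p0)" "Re (cm_integral l \<mu>\<^sub>0 (\<lambda>s. (\<Phi> s)\<^sup>2) * cnj p0) = m * Re p0"
      "measure M {0..l} < m \<Longrightarrow> Re p0 = 0"
    using to_extremal[OF p0(1)] p0(2) by blast+
  interpret E: extremal M l \<omega> \<Phi> p0 "Re p0" by (rule ext0(1))
  have "atoms \<noteq> {}" using E.a0_atom by auto
  then obtain n a where e: "enumerates_atoms n a" by (rule enumeration_exists[OF E.finite_atoms])
  define mass where "mass j = measure M {a j}" for j
  have n1: "1 \<le> n" and mono: "strict_mono_on {1..n} a" and img: "a ` {1..n} = atoms" and last: "a (n + 1) = l"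
    using e by (simp_all only: enumerates_atoms_def)
  have a1: "a 1 = a0" by (rule E.enumeration_first[OF e])
  have \<Phi>1: "\<Phi> (a 1) = 1" unfolding a1 by simp
  have at: "a j \<in> atoms" if "1 \<le> j" "j \<le> n" for j by (rule enumeration_atom[OF e that])
  have mass_pos': "0 < mass j" "a j \<in> {0..l}" if "1 \<le> j" "j \<le> n" for j
    using at[OF that] by (auto simp: atoms_def mass_def)
  have inj: "inj_on a {1..n}" using mono by (rule strict_mono_on_imp_inj_on)
  have repr: "\<mu>\<^sub>0 = (\<lambda>A. \<Sum>j=1..n. complex_of_real (mass j) * point_mass l (a j) A)"
  proof
    fix A
    show "\<mu>\<^sub>0 A = (\<Sum>j=1..n. complex_of_real (mass j) * point_mass l (a j) A)"
    proof (cases "A \<in> borel_subsets l")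
      case False
      then have "\<mu>\<^sub>0 A = 0" using \<mu>0' by (auto simp: nonneg_measures_def complex_measures_def)
      then show ?thesis using False by (simp add: point_mass_def)
    next
      case True
      have "measure M A = (\<Sum>x\<in>atoms \<inter> A. measure M {x})" using True sets_M_iff by (intro E.measure_atoms) auto
      also have "\<dots> = (\<Sum>x\<in>atoms. if x \<in> A then measure M {x} else 0)"
        using E.finite_atoms by (simp add: sum.inter_restrict)
      also have "\<dots> = (\<Sum>j=1..n. if a j \<in> A then mass j else 0)"
        unfolding img[symmetric] sum.reindex[OF inj] by (intro sum.cong refl) (simp add: mass_def)
      finally have "\<mu>\<^sub>0 A = of_real (\<Sum>j=1..n. if a j \<in> A then mass j else 0)"
        using measure_lib(2)[OF \<mu>0' l True] by (simp add: M_def)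
      also have "\<dots> = (\<Sum>j=1..n. complex_of_real (mass j) * point_mass l (a j) A)"
        unfolding of_real_sum using True by (intro sum.cong refl) (auto simp: point_mass_def)
      finally show ?thesis .
    qed
  qed
  have supp1: "a 1 \<in> measure_support l \<mu>\<^sub>0"
  proof -
    have r: "a 1 \<in> {0..l}" using mass_pos'(2)[of 1] n1 by simp
    then have b: "{a 1} \<in> borel_subsets l" by (auto simp: borel_subsets_def)
    have "\<mu>\<^sub>0 {a 1} \<noteq> 0"
      unfolding measure_lib(2)[OF \<mu>0' l b] M_def[symmetric] using mass_pos'(1)[of 1] n1 by (simp add: mass_def)
    then show ?thesis using r b unfolding measure_support_def by blast
  qed
  have supp: "a 1 \<le> x" if x: "x \<in> measure_support l \<mu>\<^sub>0" for x
  proof (rule ccontr)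
    assume "\<not> a 1 \<le> x"
    then obtain B where B: "B \<in> borel_subsets l" "B \<subseteq> {..<a 1}" "\<mu>\<^sub>0 B \<noteq> 0"
      using x unfolding measure_support_def by (auto dest!: spec[of _ "{..<a 1}"])
    have "B \<inter> atoms = {}" using B(2) E.atom_ge_a0 a1 by fastforce
    then have "measure M B = 0" using B(1) by (intro E.null_between_atoms) (auto simp: borel_subsets_def)
    then show False using B(3) unfolding measure_lib(2)[OF \<mu>0' l B(1)] M_def by simp
  qed
  have z0val: "Re (z\<^sub>0 * cnj p0) = Re p0"
  proof -
    have "z\<^sub>0 * cnj p0 = of_real (1 / m) * (cm_integral l \<mu>\<^sub>0 (\<lambda>s. (\<Phi> s)\<^sup>2) * cnj p0)" by (simp add: z\<^sub>0_eq)
    then have "Re (z\<^sub>0 * cnj p0) = 1 / m * (m * Re p0)" by (simp only: Re_of_real_mult ext0(2))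
    then show ?thesis using m by simp
  qed
  \<comment> \<open>This \<open>p0\<close> supplies the line; for \<open>n \<ge> 2\<close> every other line and normal coincide with it.\<close>
  define L0 where "L0 = {x. p0 \<bullet> x = p0 \<bullet> 1}"
  have L0: "line_with_unit_normal L0 p0" "z\<^sub>0 \<in> L0" "trajectory_condition l \<Phi> n a p0" "mass_position_condition l \<Phi> n a L0"
    unfolding L0_def
    using hyperplane_line[OF p0(1)] line_through_one_iff(1)[OF p0(1)] z0val E.trajectory_extremal[OF e] E.mass_position_extremal[OF e] by blast+
  have uniq: "L' = L0" "p' = p0"
    if "2 \<le> n" "line_with_unit_normal L' p'" "trajectory_condition l \<Phi> n a p'" "mass_position_condition l \<Phi> n a L'" for L' p'
    unfolding L0_def using E.line_unique[OF e that] by blast+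
  \<comment> \<open>For each mass inside \<open>(0, l)\<close> the shift condition holds for a normal \<open>p\<close> that may depend on \<open>j\<close>
    at this stage.\<close>
  have shift: "\<exists>p d. extremal M l \<omega> \<Phi> p (Re p) \<and> (measure M {0..l} < m \<longrightarrow> Re p = 0) \<and>
      (\<exists>\<delta>>0. \<forall>b. a j - \<delta> < b \<and> b < a j \<longrightarrow> \<Phi> (a j) = \<Phi> b + of_real (a j - b) * d) \<and>
      Re (\<Phi> (a j) * (2 * d - \<omega>\<^sup>2 * of_real (mass j) * \<Phi> (a j)) * cnj p) = 0"
    if j: "1 \<le> j" "j \<le> n" and aj: "0 < a j" "a j < l" for j
  proof -
    obtain \<delta> where \<delta>: "0 < \<delta>" "\<And>x. x \<in> atoms \<Longrightarrow> x \<noteq> a j \<Longrightarrow> \<delta> \<le> dist (a j) x"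
      using finite_set_avoid[OF E.finite_atoms, of "a j"] by blast
    define \<epsilon> where "\<epsilon> = min \<delta> (min (a j) (l - a j))"
    have \<epsilon>: "0 < \<epsilon>" "\<epsilon> \<le> \<delta>" "0 \<le> a j - \<epsilon>" "a j + \<epsilon> \<le> l" using \<delta> aj by (auto simp: \<epsilon>_def)
    have "{a j - \<epsilon><..<a j} \<inter> atoms = {}" "{a j<..<a j + \<epsilon>} \<inter> atoms = {}"
      using \<delta>(2) \<epsilon>(2) by (fastforce simp: dist_real_def)+
    then have null: "measure (lib_measure l \<mu>\<^sub>0) {a j - \<epsilon><..<a j} = 0" "measure (lib_measure l \<mu>\<^sub>0) {a j<..<a j + \<epsilon>} = 0"
      unfolding M_def[symmetric] using \<epsilon> by (auto intro!: E.null_between_atoms)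
    obtain p d where p: "norm p = 1"
      "\<And>\<nu>. \<nu> \<in> admissible l m \<Longrightarrow> Re (cm_integral l \<nu> (\<lambda>s. (\<Phi> s)\<^sup>2) * cnj p) \<le> Re (cm_integral l \<mu>\<^sub>0 (\<lambda>s. (\<Phi> s)\<^sup>2) * cnj p)"
      "\<And>b. a j - \<epsilon> < b \<Longrightarrow> b < a j \<Longrightarrow> \<Phi> (a j) = \<Phi> b + of_real (a j - b) * d"
      "Re (of_real (mass j) * (\<Phi> (a j) * (2 * d - \<omega>\<^sup>2 * of_real (mass j) * \<Phi> (a j))) * cnj p) = 0"
      using first_order_condition_shift[OF l \<mu>0 F0 omega_nonzero \<Phi>l bd \<epsilon>(1,3,4) null] unfolding \<Phi>_eq[symmetric] M_def[symmetric] mass_def[symmetric] by blast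
    have "mass j * Re (\<Phi> (a j) * (2 * d - \<omega>\<^sup>2 * of_real (mass j) * \<Phi> (a j)) * cnj p) = 0"
      using p(4) by (simp only: mult.assoc Re_of_real_mult)
    then have "Re (\<Phi> (a j) * (2 * d - \<omega>\<^sup>2 * of_real (mass j) * \<Phi> (a j)) * cnj p) = 0"
      using mass_pos'(1)[OF j] by (simp only: mult_eq_0_iff) auto
    then show ?thesis using to_extremal(1,3)[OF p(1,2)] p(3) \<epsilon>(1) by blast
  qed
  \<comment> \<open>To the left of a first mass at \<open>a 1 > 0\<close> the solution is constant, so the shift condition says
    that \<open>\<phi>\<^sup>2\<close> leaves \<open>a 1\<close> tangentially to the line.  By \<open>slope_tangential\<close> this needs \<open>Re p > 0\<close>, and
    then \<open>g\<close> is negative on the whole following segment, so that there is no second mass.\<close>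
  have first_zero: "a 1 = 0" if n: "2 \<le> n \<or> measure M {0..l} < m"
  proof (rule ccontr)
    assume "a 1 \<noteq> 0"
    then have pos: "0 < a 1" "a 1 < l" using mass_pos'(2)[of 1] n1 a0_less a1 by auto
    obtain p d \<delta> where ext: "extremal M l \<omega> \<Phi> p (Re p)" and c0: "measure M {0..l} < m \<longrightarrow> Re p = 0" and \<delta>: "0 < \<delta>"
      and d: "\<And>b. a 1 - \<delta> < b \<Longrightarrow> b < a 1 \<Longrightarrow> \<Phi> (a 1) = \<Phi> b + of_real (a 1 - b) * d"
      and orth: "Re (\<Phi> (a 1) * (2 * d - \<omega>\<^sup>2 * of_real (mass 1) * \<Phi> (a 1)) * cnj p) = 0"
      using shift[OF order_refl n1 pos] by blast
    interpret S: extremal M l \<omega> \<Phi> p "Re p" by (rule ext)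
    define b where "b = max (a 1 / 2) (a 1 - \<delta> / 2)"
    have b: "0 \<le> b" "b < a 1" "a 1 - \<delta> < b" using pos \<delta> by (auto simp: b_def)
    have "\<Phi> b = 1" using b a1 by (intro phi_before) auto
    then have d0: "d = 0" using d[OF b(3,2)] b \<Phi>1 by simp
    have q0: "q 0 = 0"
    proof -
      have "AE s in M. indicator {0..0} s * \<Phi> s = 0" using null_before by eventually_elim (use pos a1 in \<open>auto simp: indicator_def\<close>)
      then have "integral_upto M \<Phi> 0 = 0" unfolding integral_upto_def by (rule integral_eq_zero_AE)
      then show ?thesis by (simp add: q_def)
    qed
    have "{0<..<a 1} \<inter> atoms = {}" using E.atom_ge_a0 a1 by fastforce
    then have "measure M {0<..<a 1} = 0" using pos by (intro E.null_between_atoms) auto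
    then have q1: "q (a 1) = - (\<omega>\<^sup>2 * of_real (mass 1))"
      using q_jump[of 0 "a 1"] pos q0 \<Phi>1 by (simp add: mass_def)
    have slope: "Re (\<Phi> (a 1) * q (a 1) * cnj p) = 0" using orth unfolding d0 q1 \<Phi>1 by simp
    have Z1: "a 1 \<in> S.Z" unfolding a1 by (rule S.a0_in_Z)
    have "measure M {a 1} \<le> measure M {0..a 1}" using pos by (intro finite_measure_mono borel_in_sets) auto
    then have mp: "0 < measure M {0..a 1}" using mass_pos'(1)[of 1] n1 by (simp add: mass_def)
    note st = S.slope_tangential[OF Z1 mp slope]
    show False
    proof (cases "2 \<le> n")
      case False
      then show ?thesis using n c0 st(1) by simp
    next
      case True
      have gt: "a 1 < a 2" using enumeration_less[OF e, of 1 2] True by simp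
      define h where "h = a 2 - a 1"
      have P2: "\<Phi> (a 2) = 1 + of_real h * q (a 1)"
        using E.affine_piece[OF e, of 1 "a 2"] True gt \<Phi>1 by (simp add: h_def numeral_2_eq_2)
      have "(\<Phi> (a 2))\<^sup>2 * cnj p = cnj p - of_real (- 2 * h) * (\<Phi> (a 1) * q (a 1) * cnj p) + of_real (h\<^sup>2) * ((q (a 1))\<^sup>2 * cnj p)"
        unfolding P2 \<Phi>1 by (simp add: power2_eq_square algebra_simps)
      from Re_quadratic[OF this] have "Re ((\<Phi> (a 2))\<^sup>2 * cnj p) = Re p + h\<^sup>2 * Re ((q (a 1))\<^sup>2 * cnj p)"
        unfolding slope by simp
      moreover have "h\<^sup>2 * Re ((q (a 1))\<^sup>2 * cnj p) < 0" using st(2) gt by (intro mult_pos_neg) (auto simp: h_def)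
      moreover have "Re ((\<Phi> (a 2))\<^sup>2 * cnj p) = Re p" using S.enumeration_value[OF e, of 2] True by simp
      ultimately show False by linarith
    qed
  qed
  \<comment> \<open>With \<open>H\<close> the denominator, the jump condition and the shift condition give
    \<open>2 R - mass j * H = 0\<close>, where \<open>2 R\<close> and \<open>2 R - 2 * mass j * H\<close> are the inner products of
    the two one-sided derivatives with \<open>p0\<close>.\<close>
  have masses: "mass j = (left_deriv (\<lambda>x. (\<Phi> x)\<^sup>2) (a j) \<bullet> p0) / ((\<omega>\<^sup>2 * (\<Phi> (a j))\<^sup>2) \<bullet> p0) \<and>
      mass j = - ((right_deriv (\<lambda>x. (\<Phi> x)\<^sup>2) (a j) \<bullet> p0) / ((\<omega>\<^sup>2 * (\<Phi> (a j))\<^sup>2) \<bullet> p0))"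
    if j: "2 \<le> j" "j \<le> n" "a j < l" for j
  proof -
    define i where "i = j - 1"
    have i: "1 \<le> i" "i < n" "i + 1 = j" "i \<le> n" using j by (auto simp: i_def)
    have n2: "2 \<le> n" using j by simp
    have j1: "1 \<le> j" using j by simp
    have ij: "a i < a j" using enumeration_less[OF e i(1), of j] i j by simp
    have aj: "0 < a j" using ij mass_pos'(2)[OF i(1,4)] by simp
    obtain p d \<delta> where ext: "extremal M l \<omega> \<Phi> p (Re p)" and \<delta>: "0 < \<delta>"
      and d: "\<And>b. a j - \<delta> < b \<Longrightarrow> b < a j \<Longrightarrow> \<Phi> (a j) = \<Phi> b + of_real (a j - b) * d"
      and orth: "Re (\<Phi> (a j) * (2 * d - \<omega>\<^sup>2 * of_real (mass j) * \<Phi> (a j)) * cnj p) = 0"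
      using shift[OF j1 j(2) aj j(3)] by blast
    interpret S: extremal M l \<omega> \<Phi> p "Re p" by (rule ext)
    have pp: "p = p0"
      by (rule uniq(2)[OF n2 hyperplane_line[OF S.norm_p] S.trajectory_extremal[OF e] S.mass_position_extremal[OF e]])
    define Q where "Q = q (a i)"
    have left: "\<Phi> y = \<Phi> (a j) - of_real (a j - y) * Q" if "a i \<le> y" "y \<le> a j" for y
    proof -
      have p: "\<Phi> y = \<Phi> (a i) + of_real (y - a i) * Q" "\<Phi> (a j) = \<Phi> (a i) + of_real (a j - a i) * Q"
        using E.affine_piece[OF e i(1,4), of y] E.affine_piece[OF e i(1,4), of "a j"] that ij unfolding i(3) Q_def by auto
      show ?thesis unfolding p by (simp add: algebra_simps)
    qed
    define b where "b = max (a i) (a j - \<delta> / 2)"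
    have b: "a i \<le> b" "b < a j" "a j - \<delta> < b" using ij \<delta> by (auto simp: b_def)
    have "\<Phi> b = \<Phi> (a j) - of_real (a j - b) * Q" by (rule left) (use b in auto)
    then have "of_real (a j - b) * Q = of_real (a j - b) * d" using d[OF b(3,2)] by (simp add: algebra_simps)
    then have dQ: "d = Q" using b by simp
    have qj: "q (a j) = Q - \<omega>\<^sup>2 * of_real (mass j) * \<Phi> (a j)"
      using E.q_next[OF e i(1,2)] unfolding i(3) Q_def mass_def .
    define R H where "R = Re (\<Phi> (a j) * Q * cnj p0)" and "H = Re (\<omega>\<^sup>2 * (\<Phi> (a j))\<^sup>2 * cnj p0)"
    have "\<Phi> (a j) * (2 * d - \<omega>\<^sup>2 * of_real (mass j) * \<Phi> (a j)) * cnj p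
        = of_real 2 * (\<Phi> (a j) * Q * cnj p0) - of_real (mass j) * (\<omega>\<^sup>2 * (\<Phi> (a j))\<^sup>2 * cnj p0)"
      unfolding dQ pp by (simp add: power2_eq_square algebra_simps)
    then have eq: "2 * R - mass j * H = 0"
      using orth unfolding R_def H_def by (simp only: minus_complex.sel Re_of_real_mult)
    have R0: "R \<noteq> 0" using E.slope_incoming_nonzero[OF e i(1,2)] unfolding i(3) R_def Q_def .
    then have H0: "H \<noteq> 0" using eq by auto
    have LD: "left_deriv (\<lambda>x. (\<Phi> x)\<^sup>2) (a j) = 2 * \<Phi> (a j) * Q"
      by (rule left_derivative_affine(2)[OF ij left])
    have jl: "a j < a (j + 1)" using enumeration_less[OF e j1, of "j + 1"] j last by (cases "j = n") auto
    have RD: "right_deriv (\<lambda>x. (\<Phi> x)\<^sup>2) (a j) = 2 * \<Phi> (a j) * q (a j)"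
      by (rule right_derivative_affine[OF jl E.affine_piece[OF e j1 j(2)]])
    have "2 * \<Phi> (a j) * Q * cnj p0 = of_real 2 * (\<Phi> (a j) * Q * cnj p0)" by simp
    then have l1: "left_deriv (\<lambda>x. (\<Phi> x)\<^sup>2) (a j) \<bullet> p0 = 2 * R"
      unfolding LD inner_eq_Re R_def by (simp only: Re_of_real_mult)
    have "2 * \<Phi> (a j) * q (a j) * cnj p0 = of_real 2 * (\<Phi> (a j) * Q * cnj p0) - of_real (2 * mass j) * (\<omega>\<^sup>2 * (\<Phi> (a j))\<^sup>2 * cnj p0)"
      unfolding qj by (simp add: power2_eq_square algebra_simps)
    then have r1: "right_deriv (\<lambda>x. (\<Phi> x)\<^sup>2) (a j) \<bullet> p0 = 2 * R - 2 * mass j * H"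
      unfolding RD inner_eq_Re R_def H_def by (simp only: minus_complex.sel Re_of_real_mult)
    have h1: "(\<omega>\<^sup>2 * (\<Phi> (a j))\<^sup>2) \<bullet> p0 = H" unfolding inner_eq_Re H_def ..
    show ?thesis unfolding l1 r1 h1 using eq H0 by (simp add: field_simps)
  qed
  \<comment> \<open>jump condition at \<open>l\<close> combined with the outgoing condition\<close>
  have last_mass: "complex_of_real (mass n) = left_deriv \<Phi> (a n) / (\<omega>\<^sup>2 * \<Phi> (a n)) - \<i> / \<omega>"
    if n2: "2 \<le> n" and an: "a n = l"
  proof -
    define i where "i = n - 1"
    have i: "1 \<le> i" "i < n" "i + 1 = n" "i \<le> n" using n2 by (auto simp: i_def)
    have ij: "a i < a n" using enumeration_less[OF e i(1,2)] by simp
    define Q where "Q = q (a i)"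
    have left: "\<Phi> y = \<Phi> (a n) - of_real (a n - y) * Q" if "a i \<le> y" "y \<le> a n" for y
    proof -
      have p: "\<Phi> y = \<Phi> (a i) + of_real (y - a i) * Q" "\<Phi> (a n) = \<Phi> (a i) + of_real (a n - a i) * Q"
        using E.affine_piece[OF e i(1,4), of y] E.affine_piece[OF e i(1,4), of "a n"] that ij unfolding i(3) Q_def by auto
      show ?thesis unfolding p by (simp add: algebra_simps)
    qed
    have LD: "left_deriv \<Phi> (a n) = Q" by (rule left_derivative_affine(1)[OF ij left])
    have "q (a n) = Q - \<omega>\<^sup>2 * of_real (mass n) * \<Phi> (a n)"
      using E.q_next[OF e i(1,2)] unfolding i(3) Q_def mass_def .
    then have "\<i> * \<omega> * \<Phi> l = Q - \<omega>\<^sup>2 * of_real (mass n) * \<Phi> l" using q_end an by simp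
    then have Q: "Q = \<i> * \<omega> * \<Phi> l + \<omega>\<^sup>2 * of_real (mass n) * \<Phi> l" by simp
    show ?thesis unfolding an LD[unfolded an] Q using omega_nonzero phi_end_nonzero by (simp add: field_simps power2_eq_square)
  qed
  show ?case
  proof (rule exI[of _ n], rule exI[of _ mass], rule exI[of _ a],
      intro conjI allI impI n1 mono last repr supp1; (elim conjE)?)
    show "\<forall>j\<in>{1..n}. 0 < mass j \<and> a j \<in> {0..l}" using mass_pos' by auto
    show "\<forall>x\<in>measure_support l \<mu>\<^sub>0. a 1 \<le> x" using supp by blast
    show "\<exists>L p. line_with_unit_normal L p \<and> z\<^sub>0 \<in> L \<and> trajectory_condition l \<Phi> n a p \<and> mass_position_condition l \<Phi> n a L"
      using L0 by blast
    show "\<Phi> (a 1) = 1" by (rule \<Phi>1)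
  next
    fix L p
    assume Lp: "line_with_unit_normal L p" "z\<^sub>0 \<in> L" "trajectory_condition l \<Phi> n a p" "mass_position_condition l \<Phi> n a L"
    have np: "norm p = 1" using Lp(1) by (simp add: line_with_unit_normal_def)
    show one: "1 \<in> L"
    proof -
      have "a 1 \<in> a ` {1..n}" using n1 by auto
      moreover have "a n \<le> l" using mass_pos'(2)[OF n1 order_refl] by simp
      ultimately have "(\<Phi> (a 1))\<^sup>2 \<in> L" using Lp(4) unfolding mass_position_condition_def by (cases "a n = l") auto
      then show ?thesis unfolding \<Phi>1 by simp
    qed
    have LH: "L = {x. p \<bullet> x = p \<bullet> 1}" by (rule line_eq_hyperplane[OF Lp(1) one])
    show "L = range (\<lambda>t::real. 1 + \<i> * p * complex_of_real t)" unfolding LH by (rule line_through_one_range[OF np])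
    {
      assume n2: "2 \<le> n"
      have eq: "L = L0" "p = p0" using uniq[OF n2 Lp(1,3,4)] by auto
      show "L' = L" "p' = p"
        if "line_with_unit_normal L' p'" "trajectory_condition l \<Phi> n a p'" "mass_position_condition l \<Phi> n a L'" for L' p'
        unfolding eq by (rule uniq[OF n2 that])+
      show "a 1 = 0" using first_zero n2 by blast
      define s where "s j = Im (((\<Phi> (a j))\<^sup>2 - 1) * cnj p0)" for j
      have s: "(\<Phi> (a j))\<^sup>2 = 1 + \<i> * p0 * complex_of_real (s j)" if "j \<in> {1..n}" for j
        unfolding s_def using that by (intro line_through_one_iff(2)[OF p0(1) E.enumeration_value[OF e]]) simp_all
      have s1: "s 1 = 0" unfolding s_def \<Phi>1 by simp
      have smono: "s k < s j" if "j \<in> {1..n}" "k \<in> {1..n}" "j < k" for j k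
        using E.enumeration_decreasing[OF e, of j k] that unfolding s_def left_diff_distrib by simp
      show "\<exists>s :: nat \<Rightarrow> real. (\<forall>j\<in>{1..n}. (\<Phi> (a j))\<^sup>2 = 1 + \<i> * p * complex_of_real (s j)) \<and>
          s 1 = 0 \<and> (\<forall>j\<in>{1..n}. \<forall>k\<in>{1..n}. j < k \<longrightarrow> s k < s j)"
        unfolding eq using s s1 smono by (intro exI[of _ s] conjI ballI impI)
      show "\<forall>j\<in>{2..n}. a j < l \<longrightarrow>
          mass j = (left_deriv (\<lambda>x. (\<Phi> x)\<^sup>2) (a j) \<bullet> p) / ((\<omega>\<^sup>2 * (\<Phi> (a j))\<^sup>2) \<bullet> p) \<and>
          mass j = - ((right_deriv (\<lambda>x. (\<Phi> x)\<^sup>2) (a j) \<bullet> p) / ((\<omega>\<^sup>2 * (\<Phi> (a j))\<^sup>2) \<bullet> p))"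
        unfolding eq using masses by (metis atLeastAtMost_iff)
      show "complex_of_real (mass n) = left_deriv \<Phi> (a n) / (\<omega>\<^sup>2 * \<Phi> (a n)) - \<i> / \<omega>" if "a n = l"
        using n2 that by (rule last_mass)
    next
      assume tv: "total_variation l \<mu>\<^sub>0 < m"
      have mm: "measure M {0..l} < m" using mass_le_total_variation[OF l \<mu>0'] tv unfolding M_def by linarith
      have c0: "Re p0 = 0" by (rule ext0(3)[OF mm])
      have "Re p = 0"
      proof (cases "2 \<le> n")
        case True then show ?thesis using uniq(2)[OF True Lp(1,3,4)] c0 by simp
      next
        case False
        then have n: "n = 1" using n1 by simp
        have ch: "continuous_on {0..l} (\<lambda>s. (\<Phi> s)\<^sup>2)" by (intro continuous_intros cont_phi)
        have "cm_integral l \<mu>\<^sub>0 (\<lambda>s. (\<Phi> s)\<^sup>2) = cm_integral l (\<lambda>A. \<Sum>j=1..n. complex_of_real (mass j) * point_mass l (a j) A) (\<lambda>s. (\<Phi> s)\<^sup>2)"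
          by (subst repr) (rule refl)
        also have "\<dots> = (\<Sum>j=1..n. complex_of_real (mass j) * cm_integral l (point_mass l (a j)) (\<lambda>s. (\<Phi> s)\<^sup>2))"
          by (rule cm_integral_sum(2)[OF _ point_mass_nonneg _ l ch]) (use mass_pos' in \<open>auto intro: less_imp_le\<close>)
        also have "\<dots> = of_real (mass 1)"
          unfolding n using cm_integral_point_mass[OF mass_pos'(2)[OF order_refl n1] l ch] \<Phi>1 by simp
        finally have z: "z\<^sub>0 = of_real (mass 1 / m)" by (simp add: z\<^sub>0_eq)
        have "mass 1 \<le> measure M {0..l}" unfolding mass_def using mass_pos'(2)[of 1] n1
          by (intro finite_measure_mono borel_in_sets) auto
        then have ne: "mass 1 / m \<noteq> 1" using mm m by simp
        have "z\<^sub>0 \<in> {x. p \<bullet> x = p \<bullet> 1}" using Lp(2) LH by blast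
        then have "Re (z\<^sub>0 * cnj p) = Re p" using line_through_one_iff(1)[OF np] by blast
        then have "mass 1 / m * Re p = Re p" unfolding z Re_of_real_mult by simp
        then have "(mass 1 / m - 1) * Re p = 0" by (simp add: left_diff_distrib)
        then show ?thesis using ne by (metis eq_iff_diff_eq_0 mult_eq_0_iff)
      qed
      then show "L = \<real>" unfolding LH by (rule unit_normal_real_line[OF np])
      show "n \<le> 2"
      proof (rule ccontr)
        assume "\<not> n \<le> 2"
        then have n3: "1 < n" "2 < n" by auto
        \<comment> \<open>For \<open>c = 0\<close> each gap leads from one half of the real line to the other, and a gap cannot start
          on the half where the first one ends.\<close>
        have "Im ((\<Phi> (a (1 + 1)))\<^sup>2 * cnj p0) < 0" by (rule E.consecutive_enumeration(3)[OF e order_refl n3(1) c0])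
        moreover have "0 < Im ((\<Phi> (a 2))\<^sup>2 * cnj p0)" by (rule E.consecutive_enumeration(2)[OF e _ n3(2) c0]) simp
        moreover have "(1::nat) + 1 = 2" by simp
        ultimately show False by (simp only:)
      qed
      show "a 1 = 0" using first_zero mm by blast
    }
  qed
qed

end
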